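(* Fix an integer $k\ge3$. Let $\beta\in\mathbb C$ satisfy $$\beta^{k+1}=\frac{1}{1-\left(\tfrac12\right)^{1/k}e^{\pi i/k}},$$ let $\alpha=-\beta^{-k}$, and let $p$ be the polynomial of degree $k$ $$p(z)=\frac{(z-\alpha)(z+\beta)^k-1}{z}.$$ Then $0$ is an isolated point of $\sigma(T_{\overline{z}+p})$, and $\sigma(T_{\overline{z}+p})$ has at most finitely many isolated points.
   Context: $\mathbb D$ is the open unit disk, $dA$ normalized area measure on $\mathbb D$, $L^2_a$ the Bergman space of analytic functions in $L^2(\mathbb D,dA)$, $P$ the orthogonal projection onto $L^2_a$, and $T_\varphi f=P(\varphi f)$ for $\varphi\in L^\infty(\mathbb D)$, $f\in L^2_a$. $\sigma(T)$ denotes the spectrum. *)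

theory Defs
  imports "HOL-Analysis.Analysis" "HOL-Computational_Algebra.Polynomial"
begin

abbreviation unit_disk :: "complex set" where
  "unit_disk \<equiv> ball 0 1"

text \<open>Bergman space: analytic functions on the disk that are square integrable
  w.r.t. area measure. Functions are represented by their values on the disk and
  normalised to be 0 outside the disk (so that equality of elements is equality of functions).\<close>
definition bergman :: "(complex \<Rightarrow> complex) set" where
  "bergman = {f. f holomorphic_on unit_disk \<and> (\<forall>z. z \<notin> unit_disk \<longrightarrow> f z = 0) \<and>
      set_integrable lborel unit_disk (\<lambda>z. (cmod (f z))\<^sup>2)}"

text \<open>Norm in L^2(D, dA), dA normalised area measure (Lebesgue measure divided by pi).\<close>
definition bnorm :: "(complex \<Rightarrow> complex) \<Rightarrow> real" where
  "bnorm f = sqrt ((1 / pi) * (LINT z:unit_disk|lborel. (cmod (f z))\<^sup>2))"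

text \<open>Toeplitz operator T_phi f = P(phi f), with P the orthogonal projection onto the
  Bergman space: P u is the unique g in the Bergman space with u - g orthogonal
  (in L^2(D,dA)) to every element of the Bergman space.\<close>
definition toeplitz :: "(complex \<Rightarrow> complex) \<Rightarrow> (complex \<Rightarrow> complex) \<Rightarrow> (complex \<Rightarrow> complex)" where
  "toeplitz \<phi> f = (THE g. g \<in> bergman \<and>
      (\<forall>h\<in>bergman. (1 / pi) * (LINT z:unit_disk|lborel. (\<phi> z * f z - g z) * cnj (h z)) = 0))"

definition bergman_spectrum :: "((complex \<Rightarrow> complex) \<Rightarrow> (complex \<Rightarrow> complex)) \<Rightarrow> complex set" where
  "bergman_spectrum T = {c. \<not> (\<exists>S.
      (\<forall>f\<in>bergman. S f \<in> bergman) \<and>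
      (\<forall>f\<in>bergman. S (\<lambda>z. T f z - c * f z) = f) \<and>
      (\<forall>f\<in>bergman. (\<lambda>z. T (S f) z - c * S f z) = f) \<and>
      (\<exists>C. \<forall>f\<in>bergman. bnorm (S f) \<le> C * bnorm f))}"

definition isolated_points :: "complex set \<Rightarrow> complex set" where
  "isolated_points S = {z \<in> S. \<not> z islimpt S}"

end

theory Submission
  imports Defs  "HOL-Complex_Analysis.Complex_Analysis"
    "HOL-Computational_Algebra.Fundamental_Theorem_Algebra"
begin

text \<open>
  Writing \<open>f = (z u)'\<close>, the compression of multiplication by the conjugate of \<open>z\<close> sends \<open>f\<close> to \<open>u'\<close>, so
  \<open>T - c\<close> becomes the differential operator \<open>u \<mapsto> q u' + r u\<close> with \<open>r = p - c\<close> and \<open>q = 1 + z r\<close>, from the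
  Dirichlet-type space of \<open>u\<close> with \<open>u, u'\<close> square integrable to the Bergman space. Everything depends on the roots
  of \<open>q\<close>. A root on the circle produces approximate eigenvectors; without roots in the closed disk there is a
  kernel; with two or more roots in the open disk the operator is not onto, since a polynomial right-hand side would force a
  polynomial solution. If \<open>a\<close> is the only root in the closed disk and is simple, put
  \<open>E(a) = a q'(a)\<close>: the local exponent of the equation at \<open>a\<close> is \<open>1/E(a)\<close>, and \<open>T - c\<close> is invertible unless this
  is a natural number. Apart from this case and that of a multiple root, spectral values persist when \<open>c\<close> moves along the image of
  the circle or in a neighbourhood. Hence an isolated point of the spectrum is \<open>c = 1/a + p(a)\<close> with \<open>E(a) = 0\<close> or
  \<open>E(a) = 1/n\<close>, where \<open>E = z q' - q\<close> taken at \<open>c = 0\<close>. A lower bound on \<open>|E(a)|\<close> leaves finitely many \<open>n\<close>.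
  The constants of the theorem are chosen such that \<open>c = 0\<close> corresponds to \<open>a = \<alpha>\<close> and \<open>E(\<alpha>) = 1/2\<close>.
\<close>

section \<open>Moments of the disk\<close>

text \<open>The parameter \<open>c\<close> enters \<open>q\<close> only through the term
  \<open>- c z\<close>, which \<open>z q' - q\<close> annihilates. Hence one polynomial
  \<open>E\<close> serves all \<open>c\<close>, and the roots of \<open>q\<close> are the preimages
  of \<open>c\<close> under the single map \<open>h(z) = 1/z + p(z)\<close>, where
  \<open>h' = E / z^2\<close>. Near a simple root \<open>a\<close> the equation is
  \<open>q'(a) (z - a) u' + r(a) u = 0\<close> to first order, and \<open>q(a) = 0\<close> means
  \<open>a r(a) = -1\<close>; this is the origin of the exponent \<open>1/E(a)\<close>. If it is a
  natural number \<open>n\<close>, then \<open>(z - a)^n\<close> times a zero-free factor spans a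
  kernel, which is lost as soon as \<open>a\<close> moves and the exponent leaves the integers: this
  produces isolated points. The constants: \<open>q = (z - \<alpha>) (z + \<beta>)^k\<close> at
  \<open>c = 0\<close> must satisfy \<open>q(0) = 1\<close>, so
  \<open>\<alpha> = - \<beta>^(-k)\<close>. Then
  \<open>E(\<alpha>) = \<alpha> (\<alpha> + \<beta>)^k\<close>, and writing
  \<open>\<alpha> + \<beta> = \<beta> w\<close> turns this into \<open>- w^k\<close>. Exponent 2
  asks for \<open>w^k = -1/2\<close>, and eliminating \<open>\<alpha>\<close> gives
  \<open>\<beta>^(k+1) = 1/(1 - w)\<close>. The choice of \<open>w\<close> with
  \<open>k \<ge> 3\<close> makes \<open>|1 - w| < 1\<close>, so that \<open>|\<beta>| > 1\<close>
  and \<open>-\<beta>\<close> stays outside the closed disk.\<close>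

definition vec_to_complex :: "real ^ 2 \<Rightarrow> complex" where
  "vec_to_complex x = Complex (x $ 1) (x $ 2)"

definition complex_to_vec :: "complex \<Rightarrow> real ^ 2" where
  "complex_to_vec z = vector [Re z, Im z]"

lemma vec_to_complex_to_vec [simp]: "vec_to_complex (complex_to_vec z) = z"
  by (simp add: vec_to_complex_def complex_to_vec_def)

lemma complex_to_vec_to_complex [simp]: "complex_to_vec (vec_to_complex x) = x"
  by (simp add: vec_to_complex_def complex_to_vec_def vec_eq_iff forall_2)

lemma linear_vec_to_complex: "linear vec_to_complex"
  by (rule linearI) (simp_all add: vec_to_complex_def complex_eq_iff)

lemma linear_complex_to_vec: "linear complex_to_vec"
  by (rule linearI) (simp_all add: complex_to_vec_def vec_eq_iff forall_2)

lemma norm_vec_to_complex: "norm (vec_to_complex x) = norm x"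
  by (simp add: vec_to_complex_def norm_vec_def L2_set_def UNIV_2 cmod_def)

lemma norm_complex_to_vec: "norm (complex_to_vec z) = norm z"
  by (metis norm_vec_to_complex vec_to_complex_to_vec)

lemma vec_to_complex_measurable [measurable]: "vec_to_complex \<in> borel_measurable borel"
  using linear_vec_to_complex unfolding linear_conv_bounded_linear
  by (intro borel_measurable_continuous_onI linear_continuous_on)

lemma vimage_vec_to_complex_box:
  "vec_to_complex -` box l u = box (complex_to_vec l) (complex_to_vec u)"
  by (auto simp: vec_to_complex_def complex_to_vec_def box_def Basis_complex_def
        Basis_vec_def inner_axis forall_2 UNIV_2)

text \<open>Both measures give a box the product of its side lengths, and
  \<open>vec_to_complex\<close> pulls boxes back to boxes. This carries the invariance of Lebesgue
  measure under orthogonal maps from \<open>real ^ 2\<close> to \<open>complex\<close>.\<close>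

lemma lborel_complex_eq_distr: "(lborel :: complex measure) = distr lborel borel vec_to_complex"
proof (rule lborel_eqI)
  fix l u :: complex
  assume *: "\<And>b. b \<in> Basis \<Longrightarrow> l \<bullet> b \<le> u \<bullet> b"
  have "Re l \<le> Re u" "Im l \<le> Im u"
    using *[of 1] *[of \<i>] by (auto simp: Basis_complex_def)
  then have "emeasure lborel (box (complex_to_vec l) (complex_to_vec u))
      = ennreal (\<Prod>b\<in>Basis. (complex_to_vec u - complex_to_vec l) \<bullet> b)"
    by (subst emeasure_lborel_box)
      (auto simp: complex_to_vec_def Basis_vec_def inner_axis UNIV_2)
  also have "(\<Prod>b\<in>Basis. (complex_to_vec u - complex_to_vec l) \<bullet> b) = (\<Prod>b\<in>Basis. (u - l) \<bullet> b)"
  proof -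
    have B: "(Basis :: (real^2) set) = {axis 1 1, axis 2 1}"
      by (auto simp: Basis_vec_def UNIV_2)
    have "axis 1 1 \<noteq> (axis 2 1 :: real^2)"
      by (simp add: axis_eq_axis)
    then have "(\<Prod>b\<in>Basis. (complex_to_vec u - complex_to_vec l) \<bullet> b) = (Re u - Re l) * (Im u - Im l)"
      unfolding B by (simp add: complex_to_vec_def inner_axis)
    also have "\<dots> = (\<Prod>b\<in>Basis. (u - l) \<bullet> b)"
      by (simp add: Basis_complex_def)
    finally show ?thesis .
  qed
  finally show "emeasure (distr lborel borel vec_to_complex) (box l u) = (\<Prod>b\<in>Basis. (u - l) \<bullet> b)"
    by (subst emeasure_distr) (simp_all add: vimage_vec_to_complex_box)
qed simp

text \<open>The preimage of a box under multiplication by \<open>w\<close> is its image under the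
  orthogonal map \<open>f\<close>, multiplication by \<open>cnj w\<close>, and orthogonal images
  keep their measure.\<close>

lemma lborel_distr_rotation:
  fixes w :: complex
  assumes w: "cmod w = 1"
  shows "distr lborel borel ((*) w) = lborel"
proof (rule lborel_eqI[symmetric])
  fix l u :: complex
  assume *: "\<And>b. b \<in> Basis \<Longrightarrow> l \<bullet> b \<le> u \<bullet> b"
  define f where "f x = complex_to_vec (cnj w * vec_to_complex x)" for x
  have wc: "w * cnj w = 1" "cnj w * w = 1"
    using w by (simp_all add: complex_norm_square[symmetric] mult.commute)
  have f: "orthogonal_transformation f"
    unfolding orthogonal_transformation f_def
    using linear_compose[OF linear_compose[OF linear_vec_to_complex, of "(*) (cnj w)"] linear_complex_to_vec] w
    by (auto simp: o_def norm_complex_to_vec norm_vec_to_complex norm_mult intro: linear_times)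
  let ?B = "box (complex_to_vec l) (complex_to_vec u)"
  have eq: "vec_to_complex -` ((*) w -` box l u) = f ` ?B"
  proof (intro equalityI subsetI)
    fix x assume "x \<in> vec_to_complex -` ((*) w -` box l u)"
    then have "complex_to_vec (w * vec_to_complex x) \<in> ?B"
      unfolding vimage_vec_to_complex_box[symmetric] by simp
    moreover have "f (complex_to_vec (w * vec_to_complex x)) = x"
      by (simp add: f_def mult.assoc[symmetric] wc)
    ultimately show "x \<in> f ` ?B" by (metis imageI)
  next
    fix x assume "x \<in> f ` ?B"
    then obtain y where "y \<in> vec_to_complex -` box l u" "x = f y"
      unfolding vimage_vec_to_complex_box[symmetric] by auto
    then show "x \<in> vec_to_complex -` ((*) w -` box l u)"
      by (simp add: f_def mult.assoc[symmetric] wc)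
  qed
  have mb: "(*) w -` box l u \<in> sets borel"
    using measurable_sets[of "(*) w" borel borel "box l u"] by simp
  have "emeasure (distr lborel borel ((*) w)) (box l u) = emeasure lborel ((*) w -` box l u)"
    by (subst emeasure_distr) simp_all
  also have "\<dots> = emeasure lborel (vec_to_complex -` ((*) w -` box l u))"
    by (subst lborel_complex_eq_distr, subst emeasure_distr) (use mb in simp_all)
  also have "\<dots> = emeasure lebesgue (f ` ?B)"
    unfolding eq[symmetric]
    using measurable_sets[OF vec_to_complex_measurable mb] by (simp add: emeasure_completion)
  also have "\<dots> = ennreal (measure lebesgue (f ` ?B))"
    using measurable_orthogonal_image[OF f, of ?B] by (intro emeasure_eq_measure2) simp
  also have "measure lebesgue (f ` ?B) = measure lebesgue ?B"
    by (rule measure_orthogonal_image[OF f]) simp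
  also have "ennreal (measure lebesgue ?B) = emeasure lebesgue ?B"
    by (rule emeasure_eq_measure2[symmetric]) simp
  also have "\<dots> = emeasure lborel (vec_to_complex -` box l u)"
    by (simp add: vimage_vec_to_complex_box)
  also have "\<dots> = emeasure lborel (box l u)"
    by (simp add: lborel_complex_eq_distr emeasure_distr)
  also have "\<dots> = (\<Prod>b\<in>Basis. (u - l) \<bullet> b)"
    using * by (rule emeasure_lborel_box)
  finally show "emeasure (distr lborel borel ((*) w)) (box l u) = (\<Prod>b\<in>Basis. (u - l) \<bullet> b)" .
qed simp

section \<open>Integrals of monomials over disks, by rotation and scaling\<close>

lemma set_integrable_ball_continuous:
  fixes f :: "complex \<Rightarrow> 'b::{banach, second_countable_topology}"
  assumes "continuous_on (cball 0 t) f"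
  shows "set_integrable lborel (ball 0 t) f"
  using borel_integrable_compact[OF compact_cball assms]
  unfolding set_integrable_def[symmetric]
  by (rule set_integrable_subset) (simp_all add: ball_subset_cball)

lemma set_integral_ball_rotate:
  fixes f :: "complex \<Rightarrow> complex" and w :: complex
  assumes w: "cmod w = 1" and [measurable]: "f \<in> borel_measurable borel"
  shows "(LINT z:ball 0 t|lborel. f (w * z)) = (LINT z:ball 0 t|lborel. f z)"
proof -
  have "(LINT z:ball 0 t|lborel. f z) = (LINT z:ball 0 t|distr lborel borel ((*) w). f z)"
    by (simp add: lborel_distr_rotation w)
  also have "\<dots> = (LINT z|lborel. indicator (ball 0 t) (w * z) *\<^sub>R f (w * z))"
    unfolding set_lebesgue_integral_def by (subst integral_distr) (auto intro!: borel_measurable_scaleR borel_measurable_indicator)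
  also have "\<dots> = (LINT z:ball 0 t|lborel. f (w * z))"
    by (simp add: set_lebesgue_integral_def indicator_def norm_mult w)
  finally show ?thesis by simp
qed

text \<open>Rotation by a \<open>w\<close> with \<open>w ^ n * cnj w ^ m = -1\<close> both preserves
  and negates the integral. The angle is computed with real numbers, so that \<open>n < m\<close>
  and \<open>n > m\<close> are treated alike.\<close>

lemma disk_moment_orthogonal:
  assumes "n \<noteq> m"
  shows "(LINT z:ball 0 t|lborel. z ^ n * cnj z ^ m) = 0"
proof -
  define w where "w = cis (pi / (real n - real m))"
  have "cmod w = 1" by (simp add: w_def)
  have "w ^ n * cnj w ^ m = cis (real n * (pi / (real n - real m)) - real m * (pi / (real n - real m)))"
    unfolding w_def cis_cnj Complex.DeMoivre cis_mult by simp
  also have "real n * (pi / (real n - real m)) - real m * (pi / (real n - real m)) = pi"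
    using assms by (simp add: diff_divide_distrib[symmetric] left_diff_distrib[symmetric])
  finally have wm: "w ^ n * cnj w ^ m = -1" by simp
  have "(LINT z:ball 0 t|lborel. z ^ n * cnj z ^ m)
      = (LINT z:ball 0 t|lborel. (w * z) ^ n * cnj (w * z) ^ m)"
    by (rule set_integral_ball_rotate[symmetric, OF \<open>cmod w = 1\<close>])
      (intro borel_measurable_continuous_onI continuous_intros)
  also have "(\<lambda>z. (w * z) ^ n * cnj (w * z) ^ m) = (\<lambda>z. -1 * (z ^ n * cnj z ^ m))"
  proof
    fix z
    have "(w * z) ^ n * cnj (w * z) ^ m = (w ^ n * cnj w ^ m) * (z ^ n * cnj z ^ m)"
      unfolding complex_cnj_mult power_mult_distrib by (simp only: mult_ac)
    then show "(w * z) ^ n * cnj (w * z) ^ m = -1 * (z ^ n * cnj z ^ m)"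
      by (simp only: wm)
  qed
  also have "(LINT z:ball 0 t|lborel. -1 * (z ^ n * cnj z ^ m))
      = - (LINT z:ball 0 t|lborel. z ^ n * cnj z ^ m)"
    by (simp add: set_lebesgue_integral_def)
  finally show ?thesis by simp
qed

lemma disk_moment_scale:
  assumes t: "t > 0"
  shows "(LINT z:ball (0::complex) t|lborel. cmod z ^ (2*n)) = t ^ (2*n+2) * (LINT z:ball (0::complex) 1|lborel. cmod z ^ (2*n))"
proof -
  have "(LINT z:ball (0::complex) t|lborel. cmod z ^ (2*n))
    = (LINT z:ball (0::complex) t|density (distr lborel borel (\<lambda>x. 0 + t *\<^sub>R x)) (\<lambda>_. ennreal \<bar>t\<bar>^DIM(complex)). cmod z ^ (2*n))"
    using t by (subst lborel_affine[of t "0::complex"]) (simp_all add: ennreal_power)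
  also have "\<dots> = t^2 * (LINT z|lborel. indicator (ball 0 t) (t *\<^sub>R z :: complex) * cmod (t *\<^sub>R z) ^ (2*n))"
  proof -
    have "ennreal \<bar>t\<bar> ^ DIM(complex) = ennreal (t^2)"
      using t by (simp add: ennreal_power)
    moreover have "(\<lambda>z. indicator (ball 0 t) z *\<^sub>R cmod z ^ (2*n)) \<in> borel_measurable borel"
      by (intro borel_measurable_scaleR borel_measurable_indicator borel_measurable_continuous_onI continuous_intros) auto
    ultimately show ?thesis
      unfolding set_lebesgue_integral_def
      by (simp add: integral_real_density integral_distr del: norm_scaleR)
  qed
  also have "(LINT z|lborel. indicator (ball 0 t) (t *\<^sub>R z :: complex) * cmod (t *\<^sub>R z) ^ (2*n))
      = (LINT z|lborel. t ^ (2*n) * (indicator (ball 0 1) (z :: complex) * cmod z ^ (2*n)))"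
    using t by (intro Bochner_Integration.integral_cong) (auto simp: indicator_def power_mult_distrib)
  finally show ?thesis
    by (simp add: set_lebesgue_integral_def power_add power2_eq_square)
qed

lemma measure_disk: "t \<ge> 0 \<Longrightarrow> measure lborel (ball (0::complex) t) = pi * t^2"
  by (simp add: content_ball unit_ball_vol_2)

text \<open>Scaling replaces polar coordinates. The integral over the annulus
  \<open>t \<le> |z| < 1\<close> is \<open>c * (1 - t^(2*n+2))\<close>, and there the integrand lies
  between \<open>t^(2*n)\<close> and 1. Dividing by \<open>1 - t^2\<close> leaves a geometric sum,
  which tends to \<open>n + 1\<close> as \<open>t\<close> tends to 1.\<close>

lemma disk_moment: "(LINT z:ball (0::complex) 1|lborel. cmod z ^ (2*n)) = pi / (real n + 1)"
proof -
  define c where "c = (LINT z:ball (0::complex) 1|lborel. cmod z ^ (2*n))"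
  have int: "set_integrable lborel (ball (0::complex) t) (\<lambda>z. cmod z ^ (2*n))"
       "set_integrable lborel (ball (0::complex) t) (\<lambda>z. s)" for t s :: real
    by (intro set_integrable_ball_continuous continuous_intros)+
  have const: "(LINT z:ball (0::complex) t|lborel. s) = pi * t^2 * s" if "t \<ge> 0" for t s :: real
    using that measure_disk[of t] by (simp add: set_integral_const emeasure_ball)
  have mono: "(LINT z:ball 0 t|lborel. g z) \<le> (LINT z:ball (0::complex) 1|lborel. g z)"
    if "t < 1" "\<And>z. t \<le> cmod z \<Longrightarrow> cmod z < 1 \<Longrightarrow> g z \<ge> (0::real)"
      "\<And>s. set_integrable lborel (ball 0 s) g" for t g
    unfolding set_lebesgue_integral_def
    using that by (intro integral_mono) (auto simp: indicator_def set_integrable_def)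
  have ev: "pi * t^(2*n) \<le> c * (\<Sum>i\<le>n. (t^2)^i)" "c * (\<Sum>i\<le>n. (t^2)^i) \<le> pi" if t: "0 < t" "t < 1" for t
  proof -
    have geom: "1 - t^(2*n+2) = (1 - t^2) * (\<Sum>i\<le>n. (t^2)^i)"
      using one_diff_power_eq[of "t^2" "Suc n"] by (simp add: power_mult[symmetric] power_add[symmetric] lessThan_Suc_atMost del: power_Suc)
    have pos: "1 - t^2 > 0" using t by (simp add: power_less_one_iff)
    have "(LINT z:ball (0::complex) t|lborel. cmod z ^ (2*n) - t^(2*n))
        \<le> (LINT z:ball (0::complex) 1|lborel. cmod z ^ (2*n) - t^(2*n))"
      using t int by (intro mono set_integral_diff) (auto intro: power_mono)
    then have "t^(2*n+2) * c - pi * t^2 * t^(2*n) \<le> c - pi * t^(2*n)"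
      unfolding set_integral_diff(2)[OF int(1) int(2)] c_def const[OF less_imp_le[OF t(1)]]
        const[OF zero_le_one] disk_moment_scale[OF t(1)] by simp
    then have "(pi * t^(2*n)) * (1 - t^2) \<le> c * (1 - t^(2*n+2))"
      by (simp add: algebra_simps)
    then show "pi * t^(2*n) \<le> c * (\<Sum>i\<le>n. (t^2)^i)"
      using pos mult_le_cancel_right_pos[OF pos, of "pi * t^(2*n)" "c * (\<Sum>i\<le>n. (t^2)^i)"]
      unfolding geom by (simp only: mult_ac)
    have "(LINT z:ball (0::complex) t|lborel. 1 - cmod z ^ (2*n))
        \<le> (LINT z:ball (0::complex) 1|lborel. 1 - cmod z ^ (2*n))"
      using t int by (intro mono set_integral_diff) (auto intro: power_le_one)
    then have "pi * t^2 - t^(2*n+2) * c \<le> pi - c"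
      unfolding set_integral_diff(2)[OF int(2) int(1)] c_def const[OF less_imp_le[OF t(1)]]
        const[OF zero_le_one] disk_moment_scale[OF t(1)] by simp
    then have "c * (1 - t^(2*n+2)) \<le> pi * (1 - t^2)"
      by (simp add: algebra_simps)
    then show "c * (\<Sum>i\<le>n. (t^2)^i) \<le> pi"
      using pos mult_le_cancel_right_pos[OF pos, of "c * (\<Sum>i\<le>n. (t^2)^i)" pi]
      unfolding geom by (simp only: mult_ac)
  qed
  have lim: "((\<lambda>t. c * (\<Sum>i\<le>n. (t^2)^i)) \<longlongrightarrow> c * (\<Sum>i\<le>n. (1^2)^i)) (at_left 1)"
    "((\<lambda>t::real. pi * t^(2*n)) \<longlongrightarrow> pi * 1^(2*n)) (at_left 1)"
    by (intro tendsto_intros)+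
  have event: "eventually (\<lambda>t. 0 < t \<and> t < (1::real)) (at_left 1)"
    using eventually_at_left_real[of 0 1] by (auto elim: eventually_mono)
  have "c * (real n + 1) \<le> pi"
    using tendsto_upperbound[OF lim(1) eventually_mono[OF event]] ev by (simp add: mult.commute add.commute)
  moreover have "pi \<le> c * (real n + 1)"
    using tendsto_le[OF _ lim eventually_mono[OF event]] ev by (simp add: mult.commute add.commute)
  ultimately show ?thesis by (simp add: c_def field_simps)
qed

lemma disk_moment_radius:
  assumes "0 < t"
  shows "(LINT z:ball 0 t|lborel. z ^ n * cnj z ^ m)
    = (if n = m then of_real (pi * t ^ (2*n+2) / (real n + 1)) else 0)"
proof (cases "n = m")
  case True
  have "z ^ n * cnj z ^ n = of_real (cmod z ^ (2*n))" for z
    by (metis complex_norm_square of_real_power power_mult power_mult_distrib)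
  then have "(LINT z:ball 0 t|lborel. z ^ n * cnj z ^ m) = of_real (LINT z:ball (0::complex) t|lborel. cmod z ^ (2*n))"
    using True by (simp add: set_integral_complex_of_real[symmetric])
  then show ?thesis
    using True assms by (simp add: disk_moment_scale disk_moment)
qed (simp add: disk_moment_orthogonal)

section \<open>Parseval's identity\<close>

text \<open>The squared Bergman norm of the monomial \<open>a n * z ^ n\<close>.\<close>

definition weighted_sq :: "(nat \<Rightarrow> complex) \<Rightarrow> nat \<Rightarrow> real" where
  "weighted_sq a n = (cmod (a n))\<^sup>2 / (real n + 1)"

lemma weighted_sq_nonneg: "weighted_sq a n \<ge> 0"
  by (simp add: weighted_sq_def)

lemma summable_disk:
  assumes "\<And>z. z \<in> unit_disk \<Longrightarrow> summable (\<lambda>n. a n * z ^ n)" and "0 \<le> t" "t < 1"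
  shows "summable (\<lambda>n. cmod (a n) * t ^ n)"
proof -
  obtain s where s: "t < s" "s < 1" using dense assms(3) by blast
  have "summable (\<lambda>n. norm (a n * of_real t ^ n))"
    using assms(1)[of "of_real s"] s assms(2) by (intro powser_insidea[where x = "of_real s"]) auto
  then show ?thesis
    using assms(2) by (simp add: norm_mult norm_power)
qed

text \<open>For \<open>t < 1\<close> the partial sums are bounded on the disk of radius
  \<open>t\<close> by the sum of \<open>cmod (a n) * t ^ n\<close>, so dominated convergence reduces
  the claim to polynomials, where the moments give it.\<close>

lemma parseval_radius:
  assumes a: "\<And>z. z \<in> unit_disk \<Longrightarrow> (\<lambda>n. a n * z ^ n) sums f z" and t: "0 < t" "t < 1"
  shows "(\<lambda>n. pi * weighted_sq a n * t ^ (2*n+2)) sums (LINT z:ball 0 t|lborel. (cmod (f z))\<^sup>2)"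
    and "set_integrable lborel (ball 0 t) (\<lambda>z. (cmod (f z))\<^sup>2)"
proof -
  define s where "s N z = (\<Sum>n<N. a n * z ^ n)" for N z
  define B where "B = (\<Sum>n. cmod (a n) * t ^ n)"
  have sm: "summable (\<lambda>n. cmod (a n) * t ^ n)"
    using a t by (intro summable_disk) (auto dest: sums_summable)
  have sB: "cmod (s N z) \<le> B" if "z \<in> ball 0 t" for N z
  proof -
    have "cmod (s N z) \<le> (\<Sum>n<N. cmod (a n) * t ^ n)"
      unfolding s_def using that t
      by (intro sum_norm_le) (auto simp: norm_mult norm_power intro!: mult_left_mono power_mono)
    also have "\<dots> \<le> B"
      unfolding B_def using sm t by (intro sum_le_suminf) auto
    finally show ?thesis .
  qed
  have cont: "continuous_on UNIV (s N)" for N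
    unfolding s_def by (intro continuous_intros)
  have holf: "f holomorphic_on unit_disk"
    by (rule power_series_holomorphic[where a = a]) (use a in simp)
  have contf: "continuous_on (cball 0 t) f"
    using holomorphic_on_imp_continuous_on[OF holf] t by (auto intro: continuous_on_subset)
  show "set_integrable lborel (ball 0 t) (\<lambda>z. (cmod (f z))\<^sup>2)"
    by (intro set_integrable_ball_continuous continuous_intros contf)
  have "(\<lambda>N. LINT z:ball 0 t|lborel. (cmod (s N z))\<^sup>2) \<longlonglongrightarrow> (LINT z:ball 0 t|lborel. (cmod (f z))\<^sup>2)"
    unfolding set_lebesgue_integral_def
  proof (rule integral_dominated_convergence)
    show "(\<lambda>z. indicator (ball 0 t) z *\<^sub>R (cmod (f z))\<^sup>2) \<in> borel_measurable lborel"
      using \<open>set_integrable lborel (ball 0 t) (\<lambda>z. (cmod (f z))\<^sup>2)\<close>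
      by (simp only: set_integrable_def) (rule borel_measurable_integrable)
    show "(\<lambda>z. indicator (ball 0 t) z *\<^sub>R (cmod (s N z))\<^sup>2) \<in> borel_measurable lborel" for N
      using cont by (intro borel_measurable_scaleR borel_measurable_indicator)
        (auto intro!: borel_measurable_continuous_onI continuous_intros)
    show "integrable lborel (\<lambda>z::complex. indicator (ball 0 t) z *\<^sub>R B\<^sup>2)"
      using set_integrable_ball_continuous[of t "\<lambda>_. B\<^sup>2"] by (simp add: set_integrable_def)
    show "AE z in lborel. (\<lambda>N. indicator (ball 0 t) z *\<^sub>R (cmod (s N z))\<^sup>2) \<longlonglongrightarrow> indicator (ball 0 t) z *\<^sub>R (cmod (f z))\<^sup>2"
    proof (rule AE_I2)
      fix z
      show "(\<lambda>N. indicator (ball 0 t) z *\<^sub>R (cmod (s N z))\<^sup>2) \<longlonglongrightarrow> indicator (ball 0 t) z *\<^sub>R (cmod (f z))\<^sup>2"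
      proof (cases "z \<in> ball 0 t")
        case True
        then have "(\<lambda>N. s N z) \<longlonglongrightarrow> f z"
          using a[of z] t by (simp add: sums_def s_def)
        then show ?thesis by (intro tendsto_intros)
      qed simp
    qed
    show "AE z in lborel. norm (indicator (ball 0 t) z *\<^sub>R (cmod (s N z))\<^sup>2) \<le> indicator (ball 0 t) z *\<^sub>R B\<^sup>2" for N
      using sB by (intro AE_I2) (auto simp: indicator_def intro!: power_mono)
  qed
  moreover have "(LINT z:ball 0 t|lborel. (cmod (s N z))\<^sup>2) = (\<Sum>n<N. pi * weighted_sq a n * t ^ (2*n+2))" for N
  proof -
    have int: "set_integrable lborel (ball 0 t) (\<lambda>z. (a n * cnj (a m)) * (z ^ n * cnj z ^ m))" for n m
      by (intro set_integrable_ball_continuous continuous_intros)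
    have sq: "of_real ((cmod (s N z))\<^sup>2) = (\<Sum>n<N. \<Sum>m<N. (a n * cnj (a m)) * (z ^ n * cnj z ^ m))" for z
      unfolding complex_norm_square s_def
      by (simp add: cnj_sum sum_product mult_ac)
    have "complex_of_real (LINT z:ball 0 t|lborel. (cmod (s N z))\<^sup>2)
        = (LINT z:ball 0 t|lborel. (\<Sum>n<N. \<Sum>m<N. (a n * cnj (a m)) * (z ^ n * cnj z ^ m)))"
      by (simp only: set_integral_complex_of_real[symmetric] sq)
    also have "\<dots> = (\<Sum>n<N. \<Sum>m<N. (a n * cnj (a m)) * (LINT z:ball 0 t|lborel. z ^ n * cnj z ^ m))"
    proof -
      have "(LINT z:ball 0 t|lborel. (\<Sum>n<N. \<Sum>m<N. (a n * cnj (a m)) * (z ^ n * cnj z ^ m)))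
        = (LINT z|lborel. (\<Sum>n<N. \<Sum>m<N. indicator (ball 0 t) z *\<^sub>R ((a n * cnj (a m)) * (z ^ n * cnj z ^ m))))"
        by (simp add: set_lebesgue_integral_def scaleR_sum_right)
      also have "\<dots> = (\<Sum>n<N. \<Sum>m<N. LINT z:ball 0 t|lborel. (a n * cnj (a m)) * (z ^ n * cnj z ^ m))"
        using int unfolding set_lebesgue_integral_def set_integrable_def
        by (simp only: Bochner_Integration.integral_sum Bochner_Integration.integrable_sum)
      finally show ?thesis by (simp only: set_integral_mult_right)
    qed
    also have "\<dots> = (\<Sum>n<N. of_real (pi * weighted_sq a n * t ^ (2*n+2)))"
    proof (rule sum.cong)
      fix n assume "n \<in> {..<N}"
      then have "(\<Sum>m<N. (a n * cnj (a m)) * (LINT z:ball 0 t|lborel. z ^ n * cnj z ^ m))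
          = (a n * cnj (a n)) * of_real (pi * t ^ (2*n+2) / (real n + 1))"
        unfolding disk_moment_radius[OF t(1)] by (simp add: if_distrib[of "\<lambda>x. _ * x"] cong: if_cong)
      also have "\<dots> = of_real (pi * weighted_sq a n * t ^ (2*n+2))"
        unfolding complex_norm_square[symmetric] weighted_sq_def by simp
      finally show "(\<Sum>m<N. (a n * cnj (a m)) * (LINT z:ball 0 t|lborel. z ^ n * cnj z ^ m))
          = of_real (pi * weighted_sq a n * t ^ (2*n+2))" .
    qed simp
    finally show ?thesis by (simp flip: of_real_sum del: of_real_mult of_real_power)
  qed
  ultimately show "(\<lambda>n. pi * weighted_sq a n * t ^ (2*n+2)) sums (LINT z:ball 0 t|lborel. (cmod (f z))\<^sup>2)"
    by (simp add: sums_def)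
qed

text \<open>Each finite sum at radius \<open>t\<close> is at most the integral over the whole disk;
  let \<open>t\<close> tend to 1 in the finite sum.\<close>

lemma parseval_summable:
  assumes a: "\<And>z. z \<in> unit_disk \<Longrightarrow> (\<lambda>n. a n * z ^ n) sums f z"
    and int: "set_integrable lborel unit_disk (\<lambda>z. (cmod (f z))\<^sup>2)"
  shows "summable (weighted_sq a)"
proof (rule summableI_nonneg_bounded)
  fix N
  let ?I = "LINT z:unit_disk|lborel. (cmod (f z))\<^sup>2"
  have "(\<Sum>n<N. pi * weighted_sq a n * t ^ (2*n+2)) \<le> ?I" if t: "0 < t" "t < 1" for t
  proof -
    have p: "(\<lambda>n. pi * weighted_sq a n * t ^ (2*n+2)) sums (LINT z:ball 0 t|lborel. (cmod (f z))\<^sup>2)"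
      "set_integrable lborel (ball 0 t) (\<lambda>z. (cmod (f z))\<^sup>2)"
      using parseval_radius[of a f t] a t by blast+
    have "(\<Sum>n<N. pi * weighted_sq a n * t ^ (2*n+2)) \<le> (LINT z:ball 0 t|lborel. (cmod (f z))\<^sup>2)"
      using p(1) t by (subst sums_unique[OF p(1)], intro sum_le_suminf)
        (auto simp: weighted_sq_nonneg sums_iff)
    also have "\<dots> \<le> ?I"
      unfolding set_lebesgue_integral_def
      using p(2) int t by (intro integral_mono) (auto simp: set_integrable_def indicator_def)
    finally show ?thesis .
  qed
  moreover have "eventually (\<lambda>t. 0 < t \<and> t < (1::real)) (at_left 1)"
    using eventually_at_left_real[of 0 1] by (auto elim: eventually_mono)
  ultimately have ev: "eventually (\<lambda>t. (\<Sum>n<N. pi * weighted_sq a n * t ^ (2*n+2)) \<le> ?I) (at_left 1)"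
    by (auto elim: eventually_mono)
  have "((\<lambda>t. \<Sum>n<N. pi * weighted_sq a n * t ^ (2*n+2)) \<longlongrightarrow> (\<Sum>n<N. pi * weighted_sq a n * 1 ^ (2*n+2))) (at_left 1)"
    by (intro tendsto_intros)
  from tendsto_upperbound[OF this ev] have "pi * (\<Sum>n<N. weighted_sq a n) \<le> ?I"
    by (simp add: sum_distrib_left)
  then show "(\<Sum>n<N. weighted_sq a n) \<le> ?I / pi"
    by (simp add: field_simps)
qed (rule weighted_sq_nonneg)

text \<open>Here integrability is a conclusion. Along increasing radii \<open>t j\<close>, monotone
  convergence treats the integrals and Tannery's theorem the series.\<close>

lemma parseval_integral:
  assumes a: "\<And>z. z \<in> unit_disk \<Longrightarrow> (\<lambda>n. a n * z ^ n) sums f z" and s: "summable (weighted_sq a)"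
  shows "set_integrable lborel unit_disk (\<lambda>z. (cmod (f z))\<^sup>2)"
    and "(LINT z:unit_disk|lborel. (cmod (f z))\<^sup>2) = pi * (\<Sum>n. weighted_sq a n)"
proof -
  define t where "t j = 1 - 1 / (real j + 2)" for j
  have t: "0 < t j" "t j < 1" for j
    by (auto simp: t_def field_simps)
  have tmono: "t i \<le> t j" if "i \<le> j" for i j
    using that by (auto simp: t_def intro!: divide_left_mono)
  have tlim: "t \<longlonglongrightarrow> 1"
    unfolding t_def by real_asymp
  let ?F = "\<lambda>j z. indicator (ball 0 (t j)) z *\<^sub>R (cmod (f z))\<^sup>2"
  let ?u = "\<lambda>z. indicator unit_disk z *\<^sub>R (cmod (f z))\<^sup>2"
  have p: "(\<lambda>n. pi * weighted_sq a n * t j ^ (2*n+2)) sums (LINT z:ball 0 (t j)|lborel. (cmod (f z))\<^sup>2)"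
    "set_integrable lborel (ball 0 (t j)) (\<lambda>z. (cmod (f z))\<^sup>2)" for j
    using parseval_radius[of a f "t j"] a t by blast+
  have lim: "(\<lambda>j. ?F j z) \<longlonglongrightarrow> ?u z" for z
  proof (cases "z \<in> unit_disk")
    case True
    then have "eventually (\<lambda>j. cmod z < t j) sequentially"
      using order_tendstoD(1)[OF tlim, of "cmod z"] by simp
    then have "eventually (\<lambda>j. ?F j z = ?u z) sequentially"
      by eventually_elim (use True in auto)
    then show ?thesis by (rule tendsto_eventually)
  next
    case False
    then have "z \<notin> ball 0 (t j)" for j using t[of j] by auto
    then show ?thesis using False by simp
  qed
  have int: "integrable lborel (?F j)" for j
    using p(2) by (simp add: set_integrable_def)
  have mono: "AE z in lborel. mono (\<lambda>j. ?F j z)"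
    using tmono by (auto simp: mono_def indicator_def intro!: AE_I2) (meson le_less_trans not_le order.trans)
  have meas: "?u \<in> borel_measurable lborel"
    by (rule borel_measurable_LIMSEQ_metric[OF borel_measurable_integrable[OF int] lim])
  have eq: "integral\<^sup>L lborel (?F j) = (\<Sum>n. pi * weighted_sq a n * t j ^ (2*n+2))" for j
    using p(1)[of j] by (simp add: sums_iff set_lebesgue_integral_def)
  have "(\<lambda>j. \<Sum>n. pi * weighted_sq a n * t j ^ (2*n+2)) \<longlonglongrightarrow> (\<Sum>n. pi * weighted_sq a n)"
  proof (rule tannerys_theorem[THEN conjunct2, THEN conjunct2])
    show "(\<lambda>j. pi * weighted_sq a n * t j ^ (2*n+2)) \<longlonglongrightarrow> pi * weighted_sq a n" for n
      using tendsto_mult_left[OF tendsto_power[OF tlim, of "2*n+2"], of "pi * weighted_sq a n"] by simp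
    have "norm (pi * weighted_sq a n * t j ^ (2*n+2)) \<le> pi * weighted_sq a n" for n j
      using t[of j] weighted_sq_nonneg[of a n] power_le_one[of "t j" "2*n+2"]
      by (auto simp: abs_mult intro!: mult_left_le mult_nonneg_nonneg simp del: power_add power_Suc)
    then show "eventually (\<lambda>(n,j). norm (pi * weighted_sq a n * t j ^ (2*n+2)) \<le> pi * weighted_sq a n) (at_top \<times>\<^sub>F sequentially)"
      by (auto intro!: always_eventually)
    show "summable (\<lambda>n. pi * weighted_sq a n)"
      using s by (rule summable_mult)
  qed simp
  then have ilim: "(\<lambda>j. integral\<^sup>L lborel (?F j)) \<longlonglongrightarrow> pi * (\<Sum>n. weighted_sq a n)"
    unfolding eq using s by (simp only: suminf_mult)
  show "set_integrable lborel unit_disk (\<lambda>z. (cmod (f z))\<^sup>2)"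
    unfolding set_integrable_def by (rule integrable_monotone_convergence[OF int mono _ ilim meas]) (rule AE_I2, rule lim)
  show "(LINT z:unit_disk|lborel. (cmod (f z))\<^sup>2) = pi * (\<Sum>n. weighted_sq a n)"
    unfolding set_lebesgue_integral_def
    by (rule integral_monotone_convergence[OF int mono _ ilim meas]) (rule AE_I2, rule lim)
qed

section \<open>Square integrable holomorphic functions on the disk\<close>

definition disk_L2 :: "(complex \<Rightarrow> complex) \<Rightarrow> bool" where
  "disk_L2 u \<longleftrightarrow> u holomorphic_on unit_disk \<and> set_integrable lborel unit_disk (\<lambda>z. (cmod (u z))\<^sup>2)"

text \<open>\<open>disk_L2\<close> is \<open>bergman\<close> without the normalisation outside the
  disk, which is inconvenient for derivatives and products; \<open>on_disk\<close> restores
  it.\<close>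

definition on_disk :: "(complex \<Rightarrow> complex) \<Rightarrow> complex \<Rightarrow> complex" where
  "on_disk u z = (if z \<in> unit_disk then u z else 0)"

lemma bergman_iff: "f \<in> bergman \<longleftrightarrow> disk_L2 f \<and> (\<forall>z. z \<notin> unit_disk \<longrightarrow> f z = 0)"
  by (auto simp: bergman_def disk_L2_def)

lemma set_integrable_disk_cong:
  fixes f g :: "complex \<Rightarrow> 'b::{banach, second_countable_topology}"
  assumes "\<And>z. z \<in> unit_disk \<Longrightarrow> f z = g z"
  shows "set_integrable lborel unit_disk f \<longleftrightarrow> set_integrable lborel unit_disk g"
  unfolding set_integrable_def using assms
  by (intro Bochner_Integration.integrable_cong) (auto simp: indicator_def)

lemma disk_L2_cong:
  assumes "\<And>z. z \<in> unit_disk \<Longrightarrow> u z = v z"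
  shows "disk_L2 u \<longleftrightarrow> disk_L2 v"
proof -
  have "u holomorphic_on unit_disk \<longleftrightarrow> v holomorphic_on unit_disk"
    using assms by (rule holomorphic_cong[OF refl])
  moreover have "set_integrable lborel unit_disk (\<lambda>z. (cmod (u z))\<^sup>2)
      \<longleftrightarrow> set_integrable lborel unit_disk (\<lambda>z. (cmod (v z))\<^sup>2)"
    using assms by (intro set_integrable_disk_cong) simp
  ultimately show ?thesis by (simp add: disk_L2_def)
qed

lemma bnorm_cong:
  assumes "\<And>z. z \<in> unit_disk \<Longrightarrow> u z = v z"
  shows "bnorm u = bnorm v"
proof -
  have "(LINT z:unit_disk|lborel. (cmod (u z))\<^sup>2) = (LINT z:unit_disk|lborel. (cmod (v z))\<^sup>2)"
    using assms by (intro set_lebesgue_integral_cong) simp_all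
  then show ?thesis by (simp add: bnorm_def)
qed

lemma on_disk_in_bergman: "disk_L2 u \<Longrightarrow> on_disk u \<in> bergman"
  using disk_L2_cong[of u "on_disk u"] by (simp add: bergman_iff on_disk_def)

lemma bnorm_on_disk: "bnorm (on_disk u) = bnorm u"
  by (rule bnorm_cong) (simp add: on_disk_def)

lemma bnorm_nonneg: "bnorm u \<ge> 0"
  unfolding bnorm_def set_lebesgue_integral_def by (simp add: integral_nonneg_AE)

lemma bnorm_square: "(bnorm u)\<^sup>2 = (1 / pi) * (LINT z:unit_disk|lborel. (cmod (u z))\<^sup>2)"
  unfolding bnorm_def set_lebesgue_integral_def by (simp add: integral_nonneg_AE)

lemma set_borel_measurable_disk:
  fixes g :: "complex \<Rightarrow> 'b::{banach, second_countable_topology}"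
  assumes "continuous_on unit_disk g"
  shows "set_borel_measurable lborel unit_disk g"
  using borel_measurable_continuous_on_indicator[OF _ assms]
  by (simp add: set_borel_measurable_def)

lemma disk_L2_mult:
  assumes u: "disk_L2 u" and g: "g holomorphic_on unit_disk" "\<And>z. z \<in> unit_disk \<Longrightarrow> cmod (g z) \<le> B"
  shows "disk_L2 (\<lambda>z. g z * u z)" and "bnorm (\<lambda>z. g z * u z) \<le> B * bnorm u"
proof -
  have B: "B \<ge> 0" using g(2)[of 0] by (auto intro: order_trans[OF norm_ge_zero])
  have hol: "(\<lambda>z. g z * u z) holomorphic_on unit_disk"
    using u g by (auto simp: disk_L2_def intro: holomorphic_on_mult)
  have le: "(cmod (g z * u z))\<^sup>2 \<le> B\<^sup>2 * (cmod (u z))\<^sup>2" if "z \<in> unit_disk" for z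
    using g(2)[OF that] by (simp add: norm_mult power_mult_distrib mult_right_mono power_mono)
  have int: "set_integrable lborel unit_disk (\<lambda>z. B\<^sup>2 * (cmod (u z))\<^sup>2)"
    using u by (simp add: disk_L2_def)
  have int2: "set_integrable lborel unit_disk (\<lambda>z. (cmod (g z * u z))\<^sup>2)"
  proof (rule set_integrable_bound[OF int])
    show "set_borel_measurable lborel unit_disk (\<lambda>z. (cmod (g z * u z))\<^sup>2)"
      by (intro set_borel_measurable_disk continuous_intros holomorphic_on_imp_continuous_on[OF hol])
  qed (use le in auto)
  with hol show "disk_L2 (\<lambda>z. g z * u z)" by (simp add: disk_L2_def)
  have "(LINT z:unit_disk|lborel. (cmod (g z * u z))\<^sup>2) \<le> (LINT z:unit_disk|lborel. B\<^sup>2 * (cmod (u z))\<^sup>2)"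
    by (rule set_integral_mono[OF int2 int]) (rule le)
  then have "(bnorm (\<lambda>z. g z * u z))\<^sup>2 \<le> (B * bnorm u)\<^sup>2"
    unfolding power_mult_distrib bnorm_square by (simp add: divide_right_mono)
  then show "bnorm (\<lambda>z. g z * u z) \<le> B * bnorm u"
    by (rule power2_le_imp_le) (simp add: B bnorm_nonneg)
qed

text \<open>The crude factor 2 comes from \<open>|x + y|^2 \<le> 2 |x|^2 + 2 |y|^2\<close> and
  stands in for the triangle inequality; only boundedness of operators matters later.\<close>

lemma disk_L2_add:
  assumes u: "disk_L2 u" and v: "disk_L2 v"
  shows "disk_L2 (\<lambda>z. u z + v z)" and "bnorm (\<lambda>z. u z + v z) \<le> 2 * (bnorm u + bnorm v)"
proof -
  have hol: "(\<lambda>z. u z + v z) holomorphic_on unit_disk"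
    using u v by (auto simp: disk_L2_def intro: holomorphic_on_add)
  have le: "(cmod (u z + v z))\<^sup>2 \<le> 2 * (cmod (u z))\<^sup>2 + 2 * (cmod (v z))\<^sup>2" for z
  proof -
    have "(cmod (u z + v z))\<^sup>2 \<le> (cmod (u z) + cmod (v z))\<^sup>2"
      by (intro power_mono norm_triangle_ineq) simp
    also have "\<dots> \<le> 2 * (cmod (u z))\<^sup>2 + 2 * (cmod (v z))\<^sup>2"
      using sum_squares_bound[of "cmod (u z)" "cmod (v z)"] by (simp add: power2_sum)
    finally show ?thesis .
  qed
  have int: "set_integrable lborel unit_disk (\<lambda>z. 2 * (cmod (u z))\<^sup>2 + 2 * (cmod (v z))\<^sup>2)"
    using u v by (auto simp: disk_L2_def intro!: set_integral_add(1))
  have int2: "set_integrable lborel unit_disk (\<lambda>z. (cmod (u z + v z))\<^sup>2)"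
  proof (rule set_integrable_bound[OF int])
    show "set_borel_measurable lborel unit_disk (\<lambda>z. (cmod (u z + v z))\<^sup>2)"
      by (intro set_borel_measurable_disk continuous_intros holomorphic_on_imp_continuous_on[OF hol])
  qed (use le in auto)
  with hol show "disk_L2 (\<lambda>z. u z + v z)" by (simp add: disk_L2_def)
  have "(LINT z:unit_disk|lborel. (cmod (u z + v z))\<^sup>2)
      \<le> (LINT z:unit_disk|lborel. 2 * (cmod (u z))\<^sup>2 + 2 * (cmod (v z))\<^sup>2)"
    by (rule set_integral_mono[OF int2 int]) (rule le)
  also have "\<dots> = 2 * (LINT z:unit_disk|lborel. (cmod (u z))\<^sup>2) + 2 * (LINT z:unit_disk|lborel. (cmod (v z))\<^sup>2)"
    using u v by (subst set_integral_add(2)) (auto simp: disk_L2_def)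
  finally have "(bnorm (\<lambda>z. u z + v z))\<^sup>2 \<le> 2 * (bnorm u)\<^sup>2 + 2 * (bnorm v)\<^sup>2"
    unfolding bnorm_square by (simp add: field_simps)
  also have "\<dots> \<le> (2 * (bnorm u + bnorm v))\<^sup>2"
    using bnorm_nonneg[of u] bnorm_nonneg[of v] by (simp add: power2_eq_square algebra_simps)
  finally show "bnorm (\<lambda>z. u z + v z) \<le> 2 * (bnorm u + bnorm v)"
    by (rule power2_le_imp_le) (simp add: bnorm_nonneg)
qed

lemma disk_L2_bounded:
  assumes "g holomorphic_on unit_disk" "\<And>z. z \<in> unit_disk \<Longrightarrow> cmod (g z) \<le> B"
  shows "disk_L2 g"
proof -
  have "disk_L2 (\<lambda>_. 1)"
    using set_integrable_ball_continuous[of 1 "\<lambda>_. 1::real"] by (simp add: disk_L2_def)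
  from disk_L2_mult(1)[OF this assms] show ?thesis by simp
qed

section \<open>Taylor coefficients\<close>

abbreviation tcoeff :: "(complex \<Rightarrow> complex) \<Rightarrow> nat \<Rightarrow> complex" where
  "tcoeff u n \<equiv> fps_nth (fps_expansion u 0) n"

lemma disk_has_fps_expansion:
  "u holomorphic_on unit_disk \<Longrightarrow> u has_fps_expansion fps_expansion u 0"
  by (rule has_fps_expansion_fps_expansion[of unit_disk]) simp_all

lemma tcoeff_sums:
  assumes "u holomorphic_on unit_disk" "z \<in> unit_disk"
  shows "(\<lambda>n. tcoeff u n * z ^ n) sums u z"
  using holomorphic_power_series[OF assms] by (simp add: fps_expansion_def)

lemma tcoeff_unique:
  assumes "\<And>z. z \<in> unit_disk \<Longrightarrow> (\<lambda>n. a n * z ^ n) sums u z"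
  shows "u holomorphic_on unit_disk" and "tcoeff u n = a n"
proof -
  show "u holomorphic_on unit_disk"
    by (rule power_series_holomorphic[where a = a]) (use assms in simp)
  have "u has_fps_expansion Abs_fps a"
    using assms by (intro has_fps_expansionI)
      (auto intro!: eventually_mono[OF eventually_nhds_in_open[of unit_disk]])
  then show "tcoeff u n = a n"
    by (simp add: fps_expansion_eqI)
qed

lemma tcoeff_eq_imp_eq:
  assumes "u holomorphic_on unit_disk" "v holomorphic_on unit_disk"
    "fps_expansion u 0 = fps_expansion v 0" "z \<in> unit_disk"
  shows "u z = v z"
  using tcoeff_sums[OF assms(1,4)] tcoeff_sums[OF assms(2,4)] assms(3) by (simp add: sums_iff)

lemma disk_L2_tcoeff:
  assumes "disk_L2 u"
  shows "summable (weighted_sq (tcoeff u))" and "(bnorm u)\<^sup>2 = (\<Sum>n. weighted_sq (tcoeff u) n)"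
proof -
  have hol: "u holomorphic_on unit_disk" using assms by (simp add: disk_L2_def)
  show *: "summable (weighted_sq (tcoeff u))"
    using assms by (intro parseval_summable[OF tcoeff_sums[OF hol]]) (simp_all add: disk_L2_def)
  show "(bnorm u)\<^sup>2 = (\<Sum>n. weighted_sq (tcoeff u) n)"
    unfolding bnorm_square by (subst parseval_integral(2)[OF tcoeff_sums[OF hol] *]) simp_all
qed

lemma disk_L2I_tcoeff:
  assumes "u holomorphic_on unit_disk" "summable (weighted_sq (tcoeff u))"
  shows "disk_L2 u"
  using parseval_integral(1)[OF tcoeff_sums[OF assms(1)] assms(2)] assms(1) by (simp add: disk_L2_def)

lemma summable_linear_growth:
  fixes a :: "nat \<Rightarrow> complex"
  assumes "\<And>n. cmod (a n) \<le> K * (real n + 1)" and z: "z \<in> unit_disk"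
  shows "summable (\<lambda>n. a n * z ^ n)"
proof (rule summable_comparison_test')
  have "summable (\<lambda>n. diffs (\<lambda>_. 1::real) n * cmod z ^ n)"
    using z by (intro termdiff_converges[where K = 1]) (auto intro!: summable_geometric)
  then show "summable (\<lambda>n. K * (diffs (\<lambda>_. 1) n * cmod z ^ n))"
    by (rule summable_mult)
  show "norm (a n * z ^ n) \<le> K * (diffs (\<lambda>_. 1) n * cmod z ^ n)" if "n \<ge> 0" for n
    using mult_right_mono[OF assms(1)[of n], of "cmod z ^ n"]
    by (simp add: norm_mult norm_power diffs_def algebra_simps)
qed

lemma weighted_sq_summable_imp_linear_growth:
  assumes "summable (weighted_sq a)"
  obtains K where "\<And>n. cmod (a n) \<le> K * (real n + 1)"
proof -
  obtain C where C: "\<And>n. weighted_sq a n \<le> C"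
    using summable_imp_Bseq[OF assms] by (auto simp: Bseq_def weighted_sq_nonneg)
  have "cmod (a n) \<le> (1 + C) * (real n + 1)" for n
  proof -
    have "(cmod (a n))\<^sup>2 \<le> C * (real n + 1)"
      using C[of n] by (simp add: weighted_sq_def field_simps)
    moreover have "cmod (a n) \<le> 1 + (cmod (a n))\<^sup>2"
      using sum_squares_bound[of 1 "cmod (a n)"] norm_ge_zero[of "a n"] unfolding power2_eq_square by linarith
    ultimately show ?thesis by (simp add: algebra_simps)
  qed
  then show ?thesis by (rule that)
qed

text \<open>With \<open>disk_L2_tcoeff\<close> this identifies the Bergman space with the sequences
  for which \<open>weighted_sq\<close> is summable, so functions can be built from their
  coefficients.\<close>

lemma ex_disk_L2_tcoeff:
  assumes "summable (weighted_sq a)"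
  obtains u where "disk_L2 u" "\<And>n. tcoeff u n = a n" "(bnorm u)\<^sup>2 = (\<Sum>n. weighted_sq a n)"
proof -
  obtain K where K: "\<And>n. cmod (a n) \<le> K * (real n + 1)"
    using weighted_sq_summable_imp_linear_growth[OF assms] by blast
  define u where "u z = (\<Sum>n. a n * z ^ n)" for z
  have s: "(\<lambda>n. a n * z ^ n) sums u z" if "z \<in> unit_disk" for z
    unfolding u_def using summable_linear_growth[OF K that] by (rule summable_sums)
  note t = tcoeff_unique[of a u, OF s]
  have tc: "tcoeff u n = a n" for n using t(2) by simp
  then have "weighted_sq (tcoeff u) = weighted_sq a" by (simp add: weighted_sq_def fun_eq_iff)
  moreover have "disk_L2 u"
    using t(1) assms \<open>weighted_sq (tcoeff u) = weighted_sq a\<close> by (intro disk_L2I_tcoeff) simp_all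
  ultimately show ?thesis
    using that tc disk_L2_tcoeff(2)[OF \<open>disk_L2 u\<close>] by simp
qed

section \<open>The Toeplitz operator as a differential operator\<close>

lemma bnorm_eq_0_imp:
  assumes "disk_L2 u" "bnorm u = 0" "z \<in> unit_disk"
  shows "u z = 0"
proof -
  have "(\<Sum>n. weighted_sq (tcoeff u) n) = 0"
    using disk_L2_tcoeff(2)[OF assms(1)] assms(2) by simp
  then have "\<forall>n. weighted_sq (tcoeff u) n = 0"
    using suminf_eq_zero_iff[OF disk_L2_tcoeff(1)[OF assms(1)]] weighted_sq_nonneg by blast
  then have "tcoeff u n = 0" for n
    unfolding weighted_sq_def by (metis add_nonneg_pos divide_eq_0_iff less_irrefl norm_eq_zero of_nat_0_le_iff zero_eq_power2 zero_less_one)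
  then show ?thesis
    using tcoeff_sums[of u z] assms by (simp add: disk_L2_def sums_iff)
qed

lemma disk_L2_cmult: "disk_L2 u \<Longrightarrow> disk_L2 (\<lambda>z. c * u z)"
  by (rule disk_L2_mult(1)[where B = "cmod c"]) simp_all

lemma tcoeff_add:
  assumes "u holomorphic_on unit_disk" "v holomorphic_on unit_disk"
  shows "tcoeff (\<lambda>z. u z + c * v z) n = tcoeff u n + c * tcoeff v n"
proof -
  have "(\<lambda>z. u z + c * v z) has_fps_expansion fps_expansion u 0 + fps_const c * fps_expansion v 0"
    by (intro fps_expansion_intros disk_has_fps_expansion assms)
  then show ?thesis by (simp add: fps_expansion_eqI)
qed

text \<open>All four terms are given the shape \<open>x + w * y\<close>, so that they match
  \<open>F w\<close> in \<open>bergman_inner_sums\<close>.\<close>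

lemma complex_polarization:
  "x * cnj y = (of_real ((cmod (x + 1 * y))\<^sup>2) - of_real ((cmod (x + (-1) * y))\<^sup>2)
     + \<i> * of_real ((cmod (x + \<i> * y))\<^sup>2) - \<i> * of_real ((cmod (x + (-\<i>) * y))\<^sup>2)) / 4"
  unfolding complex_norm_square by (simp add: algebra_simps) 

lemma set_integrable_disk_mult:
  assumes f: "disk_L2 f" and h: "disk_L2 h" and \<phi>: "continuous_on unit_disk \<phi>" "\<And>z. z \<in> unit_disk \<Longrightarrow> cmod (\<phi> z) \<le> B"
  shows "set_integrable lborel unit_disk (\<lambda>z. \<phi> z * f z * cnj (h z))"
proof (rule set_integrable_bound)
  show "set_integrable lborel unit_disk (\<lambda>z. B * ((cmod (f z))\<^sup>2 + (cmod (h z))\<^sup>2))"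
    using f h by (auto simp: disk_L2_def intro!: set_integral_add(1))
  show "set_borel_measurable lborel unit_disk (\<lambda>z. \<phi> z * f z * cnj (h z))"
    using f h \<phi>(1) by (intro set_borel_measurable_disk continuous_intros)
      (auto simp: disk_L2_def intro: holomorphic_on_imp_continuous_on)
  have "cmod (\<phi> z * f z * cnj (h z)) \<le> norm (B * ((cmod (f z))\<^sup>2 + (cmod (h z))\<^sup>2))" if z: "z \<in> unit_disk" for z
  proof -
    have "0 \<le> cmod (f z) * cmod (h z)" "0 \<le> (cmod (f z))\<^sup>2" "0 \<le> (cmod (h z))\<^sup>2" by simp_all
    then have "cmod (f z) * cmod (h z) \<le> (cmod (f z))\<^sup>2 + (cmod (h z))\<^sup>2"
      using sum_squares_bound[of "cmod (f z)" "cmod (h z)"] by linarith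
    moreover have "0 \<le> B" using \<phi>(2)[OF z] norm_ge_zero order_trans by blast
    ultimately have "cmod (\<phi> z) * (cmod (f z) * cmod (h z)) \<le> B * ((cmod (f z))\<^sup>2 + (cmod (h z))\<^sup>2)"
      using \<phi>(2)[OF z] by (intro mult_mono) auto
    then show ?thesis by (simp add: norm_mult mult.assoc)
  qed
  then show "AE z in lborel. z \<in> unit_disk \<longrightarrow> cmod (\<phi> z * f z * cnj (h z)) \<le> norm (B * ((cmod (f z))\<^sup>2 + (cmod (h z))\<^sup>2))"
    by simp
qed

text \<open>Polarization derives this from the norm formula, which avoids a second interchange of
  sum and integral.\<close>

lemma bergman_inner_sums:
  assumes f: "disk_L2 f" and g: "disk_L2 g"
  shows "(\<lambda>n. tcoeff f n * cnj (tcoeff g n) / of_nat (n + 1)) sums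
    ((1 / pi) * (LINT z:unit_disk|lborel. f z * cnj (g z)))"
proof -
  define F where "F w z = f z + w * g z" for w z
  have hol: "f holomorphic_on unit_disk" "g holomorphic_on unit_disk"
    using f g by (auto simp: disk_L2_def)
  have F: "disk_L2 (F w)" for w
    unfolding F_def by (intro disk_L2_add disk_L2_cmult f g)
  define N where "N w = complex_of_real ((bnorm (F w))\<^sup>2)" for w
  have S: "(\<lambda>n. complex_of_real (weighted_sq (tcoeff (F w)) n)) sums N w" for w
    unfolding N_def sums_of_real_iff using disk_L2_tcoeff[OF F[of w]] by (simp add: sums_iff)
  have "(\<lambda>n. (of_real (weighted_sq (tcoeff (F 1)) n) - of_real (weighted_sq (tcoeff (F (-1))) n)
      + \<i> * of_real (weighted_sq (tcoeff (F \<i>)) n) - \<i> * of_real (weighted_sq (tcoeff (F (-\<i>))) n)) / 4)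
      sums ((N 1 - N (-1) + \<i> * N \<i> - \<i> * N (-\<i>)) / 4)"
    by (intro sums_divide sums_diff sums_add sums_mult S)
  moreover have "(of_real (weighted_sq (tcoeff (F 1)) n) - of_real (weighted_sq (tcoeff (F (-1))) n)
      + \<i> * of_real (weighted_sq (tcoeff (F \<i>)) n) - \<i> * of_real (weighted_sq (tcoeff (F (-\<i>))) n)) / 4
      = tcoeff f n * cnj (tcoeff g n) / of_nat (n + 1)" for n
    unfolding complex_polarization[of "tcoeff f n" "tcoeff g n"] weighted_sq_def F_def tcoeff_add[OF hol]
    by (simp add: of_real_divide diff_divide_distrib add_divide_distrib add.commute mult.commute)
  moreover have "(N 1 - N (-1) + \<i> * N \<i> - \<i> * N (-\<i>)) / 4 = (1 / pi) * (LINT z:unit_disk|lborel. f z * cnj (g z))"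
  proof -
    have I: "set_integrable lborel unit_disk (\<lambda>z. complex_of_real ((cmod (F w z))\<^sup>2))" for w
      using F[of w] unfolding disk_L2_def set_integrable_def
      by (simp only: scaleR_conv_of_real of_real_mult[symmetric] complex_of_real_integrable_eq) simp
    have "(LINT z:unit_disk|lborel. f z * cnj (g z))
      = (LINT z:unit_disk|lborel. (of_real ((cmod (F 1 z))\<^sup>2) - of_real ((cmod (F (-1) z))\<^sup>2)
     + \<i> * of_real ((cmod (F \<i> z))\<^sup>2) - \<i> * of_real ((cmod (F (-\<i>) z))\<^sup>2)) / 4)"
      by (subst complex_polarization) (simp only: F_def)
    also have "\<dots> = ((LINT z:unit_disk|lborel. of_real ((cmod (F 1 z))\<^sup>2)) - (LINT z:unit_disk|lborel. of_real ((cmod (F (-1) z))\<^sup>2))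
     + \<i> * (LINT z:unit_disk|lborel. of_real ((cmod (F \<i> z))\<^sup>2)) - \<i> * (LINT z:unit_disk|lborel. of_real ((cmod (F (-\<i>) z))\<^sup>2))) / 4"
      by (simp only: set_integral_divide_zero set_integral_mult_right set_integral_diff set_integral_add I
          set_integrable_mult_right)
    finally show ?thesis
      unfolding N_def bnorm_square set_integral_complex_of_real of_real_mult
      by (simp add: diff_divide_distrib add_divide_distrib mult_ac)
  qed
  ultimately show ?thesis by simp
qed

text \<open>For the uniqueness demanded by \<open>THE\<close>: the difference of two candidates lies
  in the Bergman space, hence is orthogonal to itself and vanishes.\<close>

lemma toeplitz_eqI:
  assumes f: "f \<in> bergman" and g: "g \<in> bergman"
    and \<phi>: "continuous_on unit_disk \<phi>" "\<And>z. z \<in> unit_disk \<Longrightarrow> cmod (\<phi> z) \<le> B"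
    and eq: "\<And>h. h \<in> bergman \<Longrightarrow>
      (LINT z:unit_disk|lborel. \<phi> z * f z * cnj (h z)) = (LINT z:unit_disk|lborel. g z * cnj (h z))"
  shows "toeplitz \<phi> f = g"
  unfolding toeplitz_def
proof (rule the_equality)
  have int1: "set_integrable lborel unit_disk (\<lambda>z. \<phi> z * f z * cnj (h z))" if "h \<in> bergman" for h
    using that f by (intro set_integrable_disk_mult[OF _ _ \<phi>]) (auto simp: bergman_iff)
  have int2: "set_integrable lborel unit_disk (\<lambda>z. k z * cnj (h z))" if "h \<in> bergman" "k \<in> bergman" for h k
    using that set_integrable_disk_mult[of k h "\<lambda>_. 1" 1] by (auto simp: bergman_iff)
  have split: "(LINT z:unit_disk|lborel. (\<phi> z * f z - k z) * cnj (h z))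
      = (LINT z:unit_disk|lborel. \<phi> z * f z * cnj (h z)) - (LINT z:unit_disk|lborel. k z * cnj (h z))"
    if "h \<in> bergman" "k \<in> bergman" for h k
    unfolding left_diff_distrib using that by (intro set_integral_diff(2) int1 int2)
  show "g \<in> bergman \<and> (\<forall>h\<in>bergman. (1 / pi) * (LINT z:unit_disk|lborel. (\<phi> z * f z - g z) * cnj (h z)) = 0)"
    using g by (simp add: split eq)
  fix g' assume *: "g' \<in> bergman \<and> (\<forall>h\<in>bergman. (1 / pi) * (LINT z:unit_disk|lborel. (\<phi> z * f z - g' z) * cnj (h z)) = 0)"
  define k where "k z = g' z + (-1) * g z" for z
  have L2: "disk_L2 k"
    unfolding k_def using * g by (intro disk_L2_add disk_L2_cmult) (auto simp: bergman_iff)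
  have k: "k \<in> bergman"
    using L2 * g by (auto simp: bergman_iff k_def)
  have "(LINT z:unit_disk|lborel. \<phi> z * f z * cnj (k z)) - (LINT z:unit_disk|lborel. g' z * cnj (k z)) = 0"
    using * k split[of k g'] by simp
  then have "(LINT z:unit_disk|lborel. g' z * cnj (k z)) - (LINT z:unit_disk|lborel. g z * cnj (k z)) = 0"
    using eq[OF k] by simp
  then have "(LINT z:unit_disk|lborel. k z * cnj (k z)) = 0"
    using * g k by (subst (asm) set_integral_diff(2)[symmetric]) (simp_all add: int2 k_def algebra_simps)
  then have "complex_of_real (LINT z:unit_disk|lborel. (cmod (k z))\<^sup>2) = 0"
    by (simp only: set_integral_complex_of_real[symmetric] complex_norm_square)
  then have "bnorm k = 0" by (simp add: bnorm_def)
  then have "k z = 0" for z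
    using bnorm_eq_0_imp[OF L2] k by (cases "z \<in> unit_disk") (auto simp: bergman_iff)
  then show "g' = g" by (auto simp: k_def fun_eq_iff)
qed

lemma poly_bounded_disk:
  fixes p :: "complex poly"
  obtains B where "B > 0" "\<And>z. z \<in> cball 0 1 \<Longrightarrow> cmod (poly p z) \<le> B"
proof -
  have "compact (poly p ` cball 0 1)"
    by (intro compact_continuous_image continuous_intros) simp
  then show ?thesis
    using that by (auto dest!: compact_imp_bounded simp: bounded_pos)
qed

lemma tcoeff_deriv:
  assumes "u holomorphic_on unit_disk"
  shows "tcoeff (deriv u) n = of_nat (n + 1) * tcoeff u (n + 1)"
proof -
  have "deriv u has_fps_expansion fps_deriv (fps_expansion u 0)"
    by (intro fps_expansion_intros disk_has_fps_expansion assms)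
  then show ?thesis by (simp add: fps_expansion_eqI)
qed

lemma tcoeff_deriv_times:
  assumes "u holomorphic_on unit_disk"
  shows "tcoeff (\<lambda>z. u z + z * deriv u z) n = of_nat (n + 1) * tcoeff u n"
proof -
  have "(\<lambda>z. u z + z * deriv u z) has_fps_expansion fps_expansion u 0 + fps_X * fps_deriv (fps_expansion u 0)"
    by (intro fps_expansion_intros disk_has_fps_expansion assms)
  then show ?thesis
    by (cases n) (simp_all add: fps_expansion_eqI algebra_simps)
qed

text \<open>On monomials, the compression of multiplication by the conjugate of \<open>z\<close> maps \<open>z^n\<close> to \<open>n/(n+1) z^(n-1)\<close>.
  In terms of \<open>u\<close> with \<open>f = (z u)'\<close> it is therefore plain differentiation.\<close>

lemma toeplitz_eq:
  assumes u: "disk_L2 u" "disk_L2 (deriv u)"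
  shows "toeplitz (\<lambda>z. cnj z + poly p z) (on_disk (\<lambda>z. u z + z * deriv u z))
    = on_disk (\<lambda>z. deriv u z + poly p z * (u z + z * deriv u z))"
proof -
  define f where "f z = u z + z * deriv u z" for z
  obtain B where B: "B > 0" "\<And>z. z \<in> cball 0 1 \<Longrightarrow> cmod (poly p z) \<le> B"
    using poly_bounded_disk by blast
  have hol: "u holomorphic_on unit_disk" "deriv u holomorphic_on unit_disk"
    using u by (auto simp: disk_L2_def)
  have zL2: "disk_L2 (\<lambda>z. z * v z)" if "disk_L2 v" for v
    by (rule disk_L2_mult(1)[OF that, of "\<lambda>z. z" 1]) (auto intro: holomorphic_intros)
  have f: "disk_L2 f"
    unfolding f_def by (intro disk_L2_add zL2 u)
  have pL2: "disk_L2 (\<lambda>z. poly p z * f z)"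
    by (rule disk_L2_mult(1)[OF f, of _ B]) (auto intro: holomorphic_intros B)
  have tf: "tcoeff f n = of_nat (n + 1) * tcoeff u n" for n
    using tcoeff_deriv_times[OF hol(1)] by (simp only: f_def[abs_def])
  note td = tcoeff_deriv[OF hol(1)]
  have "toeplitz (\<lambda>z. cnj z + poly p z) (on_disk f) = on_disk (\<lambda>z. deriv u z + poly p z * f z)"
  proof (rule toeplitz_eqI[where B = "1 + B"])
    show "on_disk f \<in> bergman" by (intro on_disk_in_bergman f)
    show "on_disk (\<lambda>z. deriv u z + poly p z * f z) \<in> bergman"
      by (intro on_disk_in_bergman disk_L2_add u pL2)
    show "continuous_on unit_disk (\<lambda>z. cnj z + poly p z)" by (intro continuous_intros)
    show "cmod (cnj z + poly p z) \<le> 1 + B" if "z \<in> unit_disk" for z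
      using that B(2)[of z] by (intro order_trans[OF norm_triangle_ineq] add_mono) auto
    fix h assume "h \<in> bergman"
    then have h: "disk_L2 h" by (simp add: bergman_iff)
    then have holh: "h holomorphic_on unit_disk" by (simp add: disk_L2_def)
    have "(\<lambda>z. z * h z) has_fps_expansion fps_X * fps_expansion h 0"
      by (intro fps_expansion_intros disk_has_fps_expansion holh)
    then have th: "tcoeff (\<lambda>z. z * h z) n = (if n = 0 then 0 else tcoeff h (n - 1))" for n
      by (simp add: fps_expansion_eqI)
    \<comment> \<open>The factor \<open>cnj z\<close> moves to the other side as
      \<open>z * h z\<close>, which shifts the coefficients of \<open>h\<close> by one. Since
      \<open>tcoeff f n\<close> is \<open>n + 1\<close> times \<open>tcoeff u n\<close>, the weights
      cancel, and the series is the one for \<open>deriv u\<close> against \<open>h\<close>.\<close>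
    have "(\<lambda>n. tcoeff f n * cnj (tcoeff (\<lambda>z. z * h z) n) / of_nat (n + 1)) sums
       ((1 / pi) * (LINT z:unit_disk|lborel. f z * cnj (z * h z)))"
      by (rule bergman_inner_sums[OF f zL2[OF h]])
    then have "(\<lambda>n. tcoeff u (Suc n) * cnj (tcoeff h n)) sums
       ((1 / pi) * (LINT z:unit_disk|lborel. f z * cnj (z * h z)))"
      using sums_Suc_iff[of "\<lambda>n. tcoeff f n * cnj (tcoeff (\<lambda>z. z * h z) n) / of_nat (n + 1)"]
      by (simp add: tf th del: of_nat_Suc of_nat_add)
    moreover have "(\<lambda>n. tcoeff u (Suc n) * cnj (tcoeff h n)) sums
       ((1 / pi) * (LINT z:unit_disk|lborel. deriv u z * cnj (h z)))"
      using bergman_inner_sums[OF u(2) h] by (simp add: td del: of_nat_Suc of_nat_add)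
    ultimately have "complex_of_real (1 / pi) * (LINT z:unit_disk|lborel. f z * cnj (z * h z))
        = (1 / pi) * (LINT z:unit_disk|lborel. deriv u z * cnj (h z))"
      by (rule sums_unique2)
    then have eq: "(LINT z:unit_disk|lborel. f z * cnj (z * h z)) = (LINT z:unit_disk|lborel. deriv u z * cnj (h z))"
      by simp
    have int: "set_integrable lborel unit_disk (\<lambda>z. cnj z * f z * cnj (h z))"
      "set_integrable lborel unit_disk (\<lambda>z. poly p z * f z * cnj (h z))"
      "set_integrable lborel unit_disk (\<lambda>z. 1 * deriv u z * cnj (h z))"
      by (rule set_integrable_disk_mult[OF _ h, where B = "1 + B"];
          use f u B in \<open>force intro!: continuous_intros intro: add_increasing\<close>)+
    have "(LINT z:unit_disk|lborel. (cnj z + poly p z) * on_disk f z * cnj (h z))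
      = (LINT z:unit_disk|lborel. cnj z * f z * cnj (h z) + poly p z * f z * cnj (h z))"
      by (intro set_lebesgue_integral_cong) (auto simp: on_disk_def algebra_simps)
    also have "\<dots> = (LINT z:unit_disk|lborel. cnj z * f z * cnj (h z)) + (LINT z:unit_disk|lborel. poly p z * f z * cnj (h z))"
      by (rule set_integral_add(2)[OF int(1,2)])
    also have "(LINT z:unit_disk|lborel. cnj z * f z * cnj (h z)) = (LINT z:unit_disk|lborel. 1 * deriv u z * cnj (h z))"
      using eq by (simp add: mult_ac)
    also have "\<dots> + (LINT z:unit_disk|lborel. poly p z * f z * cnj (h z))
      = (LINT z:unit_disk|lborel. 1 * deriv u z * cnj (h z) + poly p z * f z * cnj (h z))"
      by (rule set_integral_add(2)[OF int(3,2), symmetric])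
    also have "\<dots> = (LINT z:unit_disk|lborel. on_disk (\<lambda>z. deriv u z + poly p z * f z) z * cnj (h z))"
      by (intro set_lebesgue_integral_cong) (auto simp: on_disk_def algebra_simps)
    finally show "(LINT z:unit_disk|lborel. (cnj z + poly p z) * on_disk f z * cnj (h z))
      = (LINT z:unit_disk|lborel. on_disk (\<lambda>z. deriv u z + poly p z * f z) z * cnj (h z))" .
  qed
  then show ?thesis by (simp only: f_def[abs_def])
qed

text \<open>\<open>u\<close> is \<open>1/z\<close> times the primitive of \<open>f\<close> vanishing
  at 0, so its coefficients are those of \<open>f\<close> divided by \<open>n + 1\<close>. The
  derivative shifts the index by one; the weights \<open>1/(n+1)\<close> and \<open>1/(n+2)\<close>
  differ by a factor of at most 2.\<close>

lemma bergman_primitive: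
  assumes "f \<in> bergman"
  obtains u where "disk_L2 u" "disk_L2 (deriv u)" "f = on_disk (\<lambda>z. u z + z * deriv u z)"
proof -
  define a where "a n = tcoeff f n / of_nat (n + 1)" for n
  have f: "disk_L2 f" and holf: "f holomorphic_on unit_disk"
    using assms by (auto simp: bergman_iff disk_L2_def)
  have sf: "summable (weighted_sq (tcoeff f))" by (rule disk_L2_tcoeff[OF f])
  have "weighted_sq a n \<le> weighted_sq (tcoeff f) n" for n
  proof -
    have "cmod (a n) \<le> cmod (tcoeff f n)"
      by (simp add: a_def norm_divide divide_le_eq mult_le_cancel_left1 del: of_nat_Suc of_nat_add)
    then show ?thesis unfolding weighted_sq_def by (intro divide_right_mono power_mono) auto
  qed
  then have "summable (weighted_sq a)"
    by (intro summable_comparison_test'[OF sf]) (simp add: weighted_sq_nonneg)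
  then obtain u where u: "disk_L2 u" "\<And>n. tcoeff u n = a n"
    using ex_disk_L2_tcoeff by blast
  then have hol: "u holomorphic_on unit_disk" "deriv u holomorphic_on unit_disk"
    by (auto simp: disk_L2_def intro!: holomorphic_deriv)
  have td: "tcoeff (deriv u) n = of_nat (n + 1) * a (n + 1)" for n
    by (simp only: tcoeff_deriv[OF hol(1)] u(2))
  have "weighted_sq (tcoeff (deriv u)) n \<le> 2 * weighted_sq (tcoeff f) (n + 1)" for n
  proof -
    have "cmod (tcoeff (deriv u) n) \<le> cmod (tcoeff f (n + 1))"
      unfolding td using mult_right_mono[of "real (Suc n)" "real (Suc (Suc n))" "cmod (tcoeff f (Suc n))"]
      by (simp add: a_def norm_mult norm_divide divide_le_eq mult.commute del: of_nat_Suc of_nat_add)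
    then have "(cmod (tcoeff (deriv u) n))\<^sup>2 \<le> (cmod (tcoeff f (n + 1)))\<^sup>2"
      by (rule power_mono) simp
    moreover have "1 / (real n + 1) \<le> 2 / (real (n + 1) + 1)"
      by (simp add: field_simps)
    ultimately have "(cmod (tcoeff (deriv u) n))\<^sup>2 * (1 / (real n + 1)) \<le> (cmod (tcoeff f (n + 1)))\<^sup>2 * (2 / (real (n + 1) + 1))"
      by (intro mult_mono) auto
    then show ?thesis by (simp add: weighted_sq_def mult.commute)
  qed
  moreover have "summable (\<lambda>n. 2 * weighted_sq (tcoeff f) (n + 1))"
    using sf by (intro summable_mult) (simp only: summable_iff_shift)
  ultimately have "summable (weighted_sq (tcoeff (deriv u)))"
    by (auto simp: weighted_sq_nonneg intro: summable_comparison_test'[where g = "\<lambda>n. 2 * weighted_sq (tcoeff f) (n + 1)" and N = 0])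
  then have d: "disk_L2 (deriv u)" by (intro disk_L2I_tcoeff hol)
  have "tcoeff (\<lambda>z. u z + z * deriv u z) n = tcoeff f n" for n
    by (simp add: tcoeff_deriv_times[OF hol(1)] u a_def del: of_nat_Suc of_nat_add)
  then have "fps_expansion (\<lambda>z. u z + z * deriv u z) 0 = fps_expansion f 0"
    by (simp add: fps_eq_iff)
  then have "u z + z * deriv u z = f z" if "z \<in> unit_disk" for z
    using hol holf that by (intro tcoeff_eq_imp_eq[of "\<lambda>z. u z + z * deriv u z" f]) (auto intro!: holomorphic_intros)
  then have "f = on_disk (\<lambda>z. u z + z * deriv u z)"
    using assms by (auto simp: on_disk_def fun_eq_iff bergman_iff)
  with u(1) d show ?thesis by (rule that)
qed

text \<open>With \<open>f = (z u)'\<close> and \<open>r = p - c\<close>, the operator \<open>T - c\<close> becomes the first-order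
  differential operator \<open>u \<mapsto> (1 + z r) u' + r u\<close>.\<close>

definition diff_op :: "complex poly \<Rightarrow> (complex \<Rightarrow> complex) \<Rightarrow> complex \<Rightarrow> complex" where
  "diff_op r u z = poly (1 + pCons 0 r) z * deriv u z + poly r z * u z"

lemma disk_L2_poly_mult: "disk_L2 u \<Longrightarrow> disk_L2 (\<lambda>z. poly p z * u z)"
proof -
  assume u: "disk_L2 u"
  obtain B where "\<And>z. z \<in> cball 0 1 \<Longrightarrow> cmod (poly p z) \<le> B"
    using poly_bounded_disk by blast
  then show ?thesis by (intro disk_L2_mult(1)[OF u, where B = B]) (auto intro: holomorphic_intros)
qed

lemma disk_L2_deriv_times:
  assumes "disk_L2 u" "disk_L2 (deriv u)"
  shows "disk_L2 (\<lambda>z. u z + z * deriv u z)"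
    and "bnorm (\<lambda>z. u z + z * deriv u z) \<le> 2 * (bnorm u + bnorm (deriv u))"
proof -
  have *: "disk_L2 (\<lambda>z. z * deriv u z)" "bnorm (\<lambda>z. z * deriv u z) \<le> 1 * bnorm (deriv u)"
    by (rule disk_L2_mult[OF assms(2), where B = 1]; auto intro: holomorphic_intros)+
  show "disk_L2 (\<lambda>z. u z + z * deriv u z)"
    by (intro disk_L2_add assms *)
  show "bnorm (\<lambda>z. u z + z * deriv u z) \<le> 2 * (bnorm u + bnorm (deriv u))"
    using disk_L2_add(2)[OF assms(1) *(1)] *(2) by simp
qed

lemma disk_L2_diff_op:
  assumes "disk_L2 u" "disk_L2 (deriv u)"
  shows "disk_L2 (diff_op r u)"
  unfolding diff_op_def[abs_def] by (intro disk_L2_add disk_L2_poly_mult assms)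

section \<open>Membership in the spectrum in terms of the differential equation\<close>

lemma toeplitz_minus_eq:
  assumes "disk_L2 u" "disk_L2 (deriv u)"
  shows "(\<lambda>z. toeplitz (\<lambda>z. cnj z + poly p z) (on_disk (\<lambda>z. u z + z * deriv u z)) z
      - c * on_disk (\<lambda>z. u z + z * deriv u z) z) = on_disk (diff_op (p - [:c:]) u)"
  unfolding toeplitz_eq[OF assms] by (auto simp: on_disk_def diff_op_def fun_eq_iff algebra_simps)

text \<open>The two consequences of a bounded inverse that later arguments contradict: the lower
  bound by kernels and approximate eigenvectors, solvability by suitable right-hand sides.\<close>

lemma not_in_spectrumD:
  assumes "c \<notin> bergman_spectrum (toeplitz (\<lambda>z. cnj z + poly p z))"
  shows not_in_spectrum_bounded_below:
      "\<exists>C. \<forall>u. disk_L2 u \<longrightarrow> disk_L2 (deriv u) \<longrightarrow>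
        bnorm (\<lambda>z. u z + z * deriv u z) \<le> C * bnorm (diff_op (p - [:c:]) u)" (is ?below)
    and not_in_spectrum_solvable:
      "disk_L2 g \<Longrightarrow> \<exists>u. disk_L2 u \<and> disk_L2 (deriv u) \<and> (\<forall>z\<in>unit_disk. diff_op (p - [:c:]) u z = g z)"
proof -
  let ?T = "toeplitz (\<lambda>z. cnj z + poly p z)"
  obtain S where S': "(\<forall>f\<in>bergman. S f \<in> bergman) \<and>
      (\<forall>f\<in>bergman. S (\<lambda>z. ?T f z - c * f z) = f) \<and>
      (\<forall>f\<in>bergman. (\<lambda>z. ?T (S f) z - c * S f z) = f) \<and>
      (\<exists>C. \<forall>f\<in>bergman. bnorm (S f) \<le> C * bnorm f)"
    using assms unfolding bergman_spectrum_def mem_Collect_eq not_not by (elim exE)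
  then obtain C where C: "\<forall>f\<in>bergman. bnorm (S f) \<le> C * bnorm f" by (elim conjE exE)
  note S = S'[THEN conjunct1, rule_format] S'[THEN conjunct2, THEN conjunct1, rule_format]
    S'[THEN conjunct2, THEN conjunct2, THEN conjunct1, rule_format] C[rule_format]
  show ?below
  proof (intro exI allI impI)
    fix u assume u: "disk_L2 u" "disk_L2 (deriv u)"
    let ?f = "on_disk (\<lambda>z. u z + z * deriv u z)"
    have f: "?f \<in> bergman" by (intro on_disk_in_bergman disk_L2_deriv_times u)
    have g: "on_disk (diff_op (p - [:c:]) u) \<in> bergman"
      by (intro on_disk_in_bergman disk_L2_diff_op u)
    have "S (on_disk (diff_op (p - [:c:]) u)) = ?f"
      using S(2)[OF f] unfolding toeplitz_minus_eq[OF u] .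
    then show "bnorm (\<lambda>z. u z + z * deriv u z) \<le> C * bnorm (diff_op (p - [:c:]) u)"
      using S(4)[OF g] by (simp add: bnorm_on_disk)
  qed
  show "\<exists>u. disk_L2 u \<and> disk_L2 (deriv u) \<and> (\<forall>z\<in>unit_disk. diff_op (p - [:c:]) u z = g z)" if "disk_L2 g"
  proof -
    have g: "on_disk g \<in> bergman" by (intro on_disk_in_bergman that)
    obtain u where u: "disk_L2 u" "disk_L2 (deriv u)" and eq: "S (on_disk g) = on_disk (\<lambda>z. u z + z * deriv u z)"
      using bergman_primitive[OF S(1)[OF g]] by blast
    have "on_disk (diff_op (p - [:c:]) u) = on_disk g"
      using S(3)[OF g] unfolding eq toeplitz_minus_eq[OF u] .
    then have "diff_op (p - [:c:]) u z = g z" if "z \<in> unit_disk" for z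
      using that by (auto simp: on_disk_def dest!: fun_cong[of _ _ z])
    with u show ?thesis by blast
  qed
qed

text \<open>A choice of solutions gives a right inverse \<open>S\<close>; injectivity makes it a
  left inverse, since a function and the solution found for its image solve the same equation. The
  preimage is \<open>u + z u'\<close>, whence the bounds on both \<open>u\<close> and
  \<open>deriv u\<close> and the constant \<open>4 * C\<close>.\<close>

lemma not_in_spectrumI:
  assumes inj: "\<And>u z. disk_L2 u \<Longrightarrow> disk_L2 (deriv u) \<Longrightarrow> (\<And>z. z \<in> unit_disk \<Longrightarrow> diff_op (p - [:c:]) u z = 0)
      \<Longrightarrow> z \<in> unit_disk \<Longrightarrow> u z = 0"
    and surj: "\<And>g. disk_L2 g \<Longrightarrow> \<exists>u. disk_L2 u \<and> disk_L2 (deriv u) \<and>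
      (\<forall>z\<in>unit_disk. diff_op (p - [:c:]) u z = g z) \<and> bnorm u \<le> C * bnorm g \<and> bnorm (deriv u) \<le> C * bnorm g"
  shows "c \<notin> bergman_spectrum (toeplitz (\<lambda>z. cnj z + poly p z))"
proof -
  let ?T = "toeplitz (\<lambda>z. cnj z + poly p z)"
  have "\<exists>w. w \<in> bergman \<and> (\<lambda>z. ?T w z - c * w z) = g \<and> bnorm w \<le> 4 * C * bnorm g" if g: "g \<in> bergman" for g
  proof -
    obtain u where u: "disk_L2 u" "disk_L2 (deriv u)" "\<forall>z\<in>unit_disk. diff_op (p - [:c:]) u z = g z"
      and C: "bnorm u \<le> C * bnorm g" "bnorm (deriv u) \<le> C * bnorm g"
      using surj[of g] g by (auto simp: bergman_iff)
    have "on_disk (diff_op (p - [:c:]) u) = g"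
      using u(3) g by (auto simp: on_disk_def fun_eq_iff bergman_iff)
    moreover have "bnorm (\<lambda>z. u z + z * deriv u z) \<le> 4 * C * bnorm g"
      using disk_L2_deriv_times(2)[OF u(1,2)] C by simp
    ultimately show ?thesis
      using toeplitz_minus_eq[OF u(1,2), of p c] on_disk_in_bergman[OF disk_L2_deriv_times(1)[OF u(1,2)]]
      by (intro exI[of _ "on_disk (\<lambda>z. u z + z * deriv u z)"]) (simp add: bnorm_on_disk)
  qed
  then obtain S where S: "\<And>g. g \<in> bergman \<Longrightarrow> S g \<in> bergman"
      "\<And>g. g \<in> bergman \<Longrightarrow> (\<lambda>z. ?T (S g) z - c * S g z) = g"
      "\<And>g. g \<in> bergman \<Longrightarrow> bnorm (S g) \<le> 4 * C * bnorm g"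
    by metis
  have "S (\<lambda>z. ?T f z - c * f z) = f" if f: "f \<in> bergman" for f
  proof -
    obtain u where u: "disk_L2 u" "disk_L2 (deriv u)" and fu: "f = on_disk (\<lambda>z. u z + z * deriv u z)"
      using bergman_primitive[OF f] by blast
    have Tf: "(\<lambda>z. ?T f z - c * f z) = on_disk (diff_op (p - [:c:]) u)"
      unfolding fu toeplitz_minus_eq[OF u] ..
    then have g: "(\<lambda>z. ?T f z - c * f z) \<in> bergman"
      by (simp add: on_disk_in_bergman disk_L2_diff_op u)
    obtain v where v: "disk_L2 v" "disk_L2 (deriv v)"
      and fv: "S (\<lambda>z. ?T f z - c * f z) = on_disk (\<lambda>z. v z + z * deriv v z)"
      using bergman_primitive[OF S(1)[OF g]] by blast
    have eq: "on_disk (diff_op (p - [:c:]) v) = on_disk (diff_op (p - [:c:]) u)"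
      using S(2)[OF g] unfolding Tf[symmetric] unfolding fv toeplitz_minus_eq[OF v] .
    have d: "deriv (\<lambda>z. u z + (-1) * v z) z = deriv u z + (-1) * deriv v z" if "z \<in> unit_disk" for z
    proof -
      have "u field_differentiable at z" "v field_differentiable at z"
        using u(1) v(1) that unfolding disk_L2_def
        by (metis holomorphic_on_imp_differentiable_at open_ball)+
      then show ?thesis by simp
    qed
    have "u z + (-1) * v z = 0" if "z \<in> unit_disk" for z
    proof (rule inj[OF _ _ _ that])
      show "disk_L2 (\<lambda>z. u z + (-1) * v z)" by (intro disk_L2_add disk_L2_cmult u v)
      have "disk_L2 (\<lambda>z. deriv u z + (-1) * deriv v z)" by (intro disk_L2_add disk_L2_cmult u v)
      then show "disk_L2 (deriv (\<lambda>z. u z + (-1) * v z))"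
        by (subst disk_L2_cong[OF d])
      fix z assume z: "z \<in> unit_disk"
      then have "diff_op (p - [:c:]) v z = diff_op (p - [:c:]) u z"
        using fun_cong[OF eq, of z] by (simp add: on_disk_def)
      then show "diff_op (p - [:c:]) (\<lambda>z. u z + (-1) * v z) z = 0"
        unfolding diff_op_def d[OF z] by (simp add: algebra_simps)
    qed
    then have uv: "u z = v z" if "z \<in> unit_disk" for z using that by simp
    then have "deriv u z = deriv v z" if "z \<in> unit_disk" for z
      using that by (intro deriv_cong_ev eventually_mono[OF eventually_nhds_in_open[of unit_disk]]) auto
    with uv have "on_disk (\<lambda>z. v z + z * deriv v z) = f"
      unfolding fu by (auto simp: on_disk_def fun_eq_iff)
    then show ?thesis unfolding fv .
  qed
  then show ?thesis
    unfolding bergman_spectrum_def mem_Collect_eq not_not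
    by (intro exI[of _ S] conjI ballI S exI[of _ "4 * C"])
qed

section \<open>Roots on the circle and absence of roots\<close>

text \<open>A point slightly outside the closed disk is close to its radial projection
  \<open>z / |z|\<close>, and compactness gives a uniform margin \<open>e\<close>.\<close>

lemma cball_subset_larger_ball:
  assumes "open S" "cball 0 1 \<subseteq> (S :: complex set)"
  obtains R where "R > 1" "ball 0 R \<subseteq> S"
proof -
  obtain e where e: "e > 0" "(\<Union>x\<in>cball 0 1. cball x e) \<subseteq> S"
    using compact_subset_open_imp_cball_epsilon_subset[OF compact_cball assms] by blast
  have "z \<in> S" if z: "z \<in> ball 0 (1 + e)" for z
  proof (cases "cmod z \<le> 1")
    case False
    have "z / of_real (cmod z) - z = z * of_real (1 / cmod z - 1)"
      by (simp add: algebra_simps)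
    then have "cmod (z / of_real (cmod z) - z) = cmod z * \<bar>1 / cmod z - 1\<bar>"
      by (simp only: norm_mult norm_of_real)
    also have "\<dots> = cmod z - 1"
      using False by (cases "z = 0") (simp_all add: abs_if field_simps)
    finally have "z \<in> cball (z / of_real (cmod z)) e"
      using z by (simp add: dist_norm)
    moreover have "z / of_real (cmod z) \<in> cball 0 1"
      using False by (simp add: norm_divide)
    ultimately show ?thesis using e(2) by blast
  qed (use assms in auto)
  then show ?thesis using e(1) by (intro that[of "1 + e"]) auto
qed

text \<open>The integrating factor \<open>exp M\<close> with \<open>M\<close> a primitive of
  \<open>m / s\<close>. The primitive is taken on a slightly larger disk, so that \<open>w\<close>
  and \<open>1 / w\<close> are bounded on the unit disk.\<close>

lemma ex_exponential_factor:
  fixes m s :: "complex poly"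
  assumes s: "\<And>z. z \<in> cball 0 1 \<Longrightarrow> poly s z \<noteq> 0"
  obtains w B where "w holomorphic_on unit_disk"
    "\<And>z. z \<in> unit_disk \<Longrightarrow> (w has_field_derivative poly m z / poly s z * w z) (at z)"
    "\<And>z. w z \<noteq> 0"
    "\<And>z. z \<in> unit_disk \<Longrightarrow> cmod (w z) \<le> B"
    "\<And>z. z \<in> unit_disk \<Longrightarrow> cmod (1 / w z) \<le> B"
    "\<And>z. z \<in> unit_disk \<Longrightarrow> cmod (1 / poly s z) \<le> B"
proof -
  have "open {z. poly s z \<noteq> 0}"
    by (intro open_Collect_neq continuous_intros)
  moreover have "cball 0 1 \<subseteq> {z. poly s z \<noteq> 0}"
    using s by blast
  ultimately obtain R where R: "R > 1" "ball 0 R \<subseteq> {z. poly s z \<noteq> 0}"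
    using cball_subset_larger_ball by blast
  have "(\<lambda>z. poly m z / poly s z) holomorphic_on ball 0 R"
    using R(2) by (intro holomorphic_intros) auto
  then obtain M where M: "\<And>z. z \<in> ball 0 R \<Longrightarrow> (M has_field_derivative poly m z / poly s z) (at z within ball 0 R)"
    by (rule holomorphic_convex_primitive'[OF convex_ball open_ball]) blast
  then have M': "(M has_field_derivative poly m z / poly s z) (at z)" if "z \<in> ball 0 R" for z
    using that by (metis at_within_open open_ball)
  have sub: "unit_disk \<subseteq> cball 0 1" "cball 0 1 \<subseteq> ball (0::complex) R" using R(1) by auto
  have contM: "continuous_on (cball 0 1) M"
  proof (intro continuous_at_imp_continuous_on ballI)
    fix z :: complex assume "z \<in> cball 0 1"
    then have "z \<in> ball 0 R" using sub(2) by blast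
    then show "isCont M z" by (rule DERIV_isCont[OF M'])
  qed
  have bnd: "\<exists>B. \<forall>z\<in>cball 0 1. cmod (g z) \<le> B" if "continuous_on (cball 0 1) g" for g :: "complex \<Rightarrow> complex"
    using compact_imp_bounded[OF compact_continuous_image[OF that compact_cball]]
    by (auto simp: bounded_iff)
  obtain B1 where B1: "\<forall>z\<in>cball 0 1. cmod (exp (M z)) \<le> B1"
    using bnd[of "\<lambda>z. exp (M z)"] contM by (auto intro: continuous_intros)
  obtain B2 where B2: "\<forall>z\<in>cball 0 1. cmod (1 / exp (M z)) \<le> B2"
    using bnd[of "\<lambda>z. 1 / exp (M z)"] contM by (fastforce intro: continuous_intros)
  obtain B3 where B3: "\<forall>z\<in>cball 0 1. cmod (1 / poly s z) \<le> B3"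
    using bnd[of "\<lambda>z. 1 / poly s z"] s by (fastforce intro: continuous_intros)
  have D: "((\<lambda>z. exp (M z)) has_field_derivative poly m z / poly s z * exp (M z)) (at z)" if "z \<in> unit_disk" for z
  proof -
    have "z \<in> ball 0 R" using that sub by blast
    from DERIV_chain2[OF DERIV_exp M'[OF this]] show ?thesis by (simp add: mult.commute)
  qed
  show ?thesis
  proof (rule that[of "\<lambda>z. exp (M z)" "max B1 (max B2 B3)"])
    show "(\<lambda>z. exp (M z)) holomorphic_on unit_disk"
      using D unfolding holomorphic_on_open[OF open_ball] by blast
    fix z :: complex assume "z \<in> unit_disk"
    then have "z \<in> cball 0 1" by simp
    then show "cmod (exp (M z)) \<le> max B1 (max B2 B3)" "cmod (1 / exp (M z)) \<le> max B1 (max B2 B3)"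
      "cmod (1 / poly s z) \<le> max B1 (max B2 B3)"
      using B1 B2 B3 by (meson le_max_iff_disj)+
  qed (use D in auto)
qed

lemma bnorm_eq_0:
  assumes "\<And>z. z \<in> unit_disk \<Longrightarrow> u z = 0"
  shows "bnorm u = 0"
proof -
  have "bnorm u = bnorm (\<lambda>_. 0)" using assms by (rule bnorm_cong)
  then show ?thesis by (simp add: bnorm_def set_lebesgue_integral_def)
qed

lemma kernel_in_spectrum:
  assumes u: "disk_L2 u" "disk_L2 (deriv u)" and 0: "\<And>z. z \<in> unit_disk \<Longrightarrow> diff_op (p - [:c:]) u z = 0"
    and z: "z \<in> unit_disk" "u z + z * deriv u z \<noteq> 0"
  shows "c \<in> bergman_spectrum (toeplitz (\<lambda>z. cnj z + poly p z))"
proof (rule ccontr)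
  assume "\<not> ?thesis"
  then obtain C where "bnorm (\<lambda>z. u z + z * deriv u z) \<le> C * bnorm (diff_op (p - [:c:]) u)"
    using not_in_spectrum_bounded_below u by blast
  then have "bnorm (\<lambda>z. u z + z * deriv u z) = 0"
    using bnorm_eq_0[OF 0] bnorm_nonneg[of "\<lambda>z. u z + z * deriv u z"] by simp
  then show False
    using bnorm_eq_0_imp[OF disk_L2_deriv_times(1)[OF u] _ z(1)] z(2) by simp
qed

text \<open>With \<open>m = - r\<close> and \<open>s = q\<close> the integrating factor itself
  solves \<open>q u' + r u = 0\<close>. At 0 the corresponding element \<open>u + z u'\<close> has
  the value \<open>w 0\<close>, which is not zero.\<close>

lemma no_root_in_spectrum:
  assumes q: "\<And>z. z \<in> cball 0 1 \<Longrightarrow> poly (1 + pCons 0 (p - [:c:])) z \<noteq> 0"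
  shows "c \<in> bergman_spectrum (toeplitz (\<lambda>z. cnj z + poly p z))"
proof -
  define r where "r = p - [:c:]"
  obtain w B where w: "w holomorphic_on unit_disk"
    "\<And>z. z \<in> unit_disk \<Longrightarrow> (w has_field_derivative poly (- r) z / poly (1 + pCons 0 r) z * w z) (at z)"
    "\<And>z. w z \<noteq> 0"
    "\<And>z. z \<in> unit_disk \<Longrightarrow> cmod (w z) \<le> B"
    "\<And>z. z \<in> unit_disk \<Longrightarrow> cmod (1 / poly (1 + pCons 0 r) z) \<le> B"
    using ex_exponential_factor[of "1 + pCons 0 r" "- r"] q unfolding r_def by metis
  have D: "deriv w z = poly (- r) z * (1 / poly (1 + pCons 0 r) z * w z)" if "z \<in> unit_disk" for z
    using DERIV_imp_deriv[OF w(2)[OF that]] by simp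
  have wL: "disk_L2 w" by (rule disk_L2_bounded[OF w(1,4)])
  have "disk_L2 (\<lambda>z. poly (- r) z * (1 / poly (1 + pCons 0 r) z * w z))"
    using q by (intro disk_L2_poly_mult disk_L2_mult(1)[OF wL, where B = B] w(5) holomorphic_intros) (auto simp: r_def)
  then have dL: "disk_L2 (deriv w)" by (subst disk_L2_cong[OF D])
  show ?thesis
  proof (rule kernel_in_spectrum[OF wL dL])
    show "diff_op (p - [:c:]) w z = 0" if "z \<in> unit_disk" for z
      using q[of z] that unfolding diff_op_def D[OF that] r_def[symmetric] by simp
    show "w 0 + 0 * deriv w 0 \<noteq> 0" using w(3) by simp
  qed simp
qed

text \<open>\<open>u\<close> is a Szego kernel and \<open>u + z u' = 1 / (1 - c z)^2\<close> a
  Bergman kernel. As \<open>|c|\<close> tends to 1, the norm of the latter grows like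
  \<open>1 / (1 - |c|^2)\<close>, while that of \<open>u\<close> is at most the square root of
  this.\<close>

lemma cauchy_kernel_bnorm:
  fixes c :: complex
  assumes c: "cmod c < 1"
  defines "u \<equiv> (\<lambda>z. 1 / (1 - c * z))"
  shows "disk_L2 u" "disk_L2 (deriv u)"
    and "\<And>z. z \<in> unit_disk \<Longrightarrow> deriv u z = c / (1 - c * z) ^ 2"
    and "(bnorm u)\<^sup>2 \<le> 1 / (1 - (cmod c)\<^sup>2)"
    and "bnorm (\<lambda>z. u z + z * deriv u z) = 1 / (1 - (cmod c)\<^sup>2)"
proof -
  have lt: "cmod (c * z) < 1" if "z \<in> unit_disk" for z
    using mult_strict_mono'[OF c, of "cmod z" 1] that by (simp add: norm_mult)
  have ge: "1 - cmod c \<le> cmod (1 - c * z)" if "z \<in> unit_disk" for z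
  proof -
    have "1 - cmod (c * z) \<le> cmod (1 - c * z)" by (metis norm_one norm_triangle_ineq2)
    moreover have "cmod (c * z) \<le> cmod c"
      using that mult_left_le[of "cmod z" "cmod c"] by (simp add: norm_mult)
    ultimately show ?thesis by linarith
  qed
  have nz: "1 - c * z \<noteq> 0" if "z \<in> unit_disk" for z
    using lt[OF that] by auto
  have sums: "(\<lambda>n. c ^ n * z ^ n) sums u z" if "z \<in> unit_disk" for z
    using geometric_sums[OF lt[OF that]] by (simp add: u_def power_mult_distrib)
  note tc = tcoeff_unique[of "\<lambda>n. c ^ n" u, OF sums]
  have hol: "u holomorphic_on unit_disk" using tc(1) by simp
  have tu: "tcoeff u n = c ^ n" for n using tc(2) by simp
  show D: "deriv u z = c / (1 - c * z) ^ 2" if "z \<in> unit_disk" for z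
    unfolding u_def using nz[OF that]
    by (intro DERIV_imp_deriv) (auto intro!: derivative_eq_intros simp: power2_eq_square)
  show uL: "disk_L2 u"
  proof (rule disk_L2_bounded[OF hol])
    show "cmod (u z) \<le> 1 / (1 - cmod c)" if "z \<in> unit_disk" for z
      using ge[OF that] c by (simp add: u_def norm_divide frac_le)
  qed
  have holD: "deriv u holomorphic_on unit_disk" using hol by (simp add: holomorphic_deriv)
  show dL: "disk_L2 (deriv u)"
  proof (rule disk_L2_bounded[OF holD])
    show "cmod (deriv u z) \<le> cmod c / (1 - cmod c)\<^sup>2" if "z \<in> unit_disk" for z
      using ge[OF that] c by (simp add: D[OF that] norm_divide norm_power frac_le power_mono)
  qed
  define x where "x = (cmod c)\<^sup>2"
  have x: "0 \<le> x" "x < 1" using c by (auto simp: x_def power_less_one_iff)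
  have geo: "(\<lambda>n. x ^ n) sums (1 / (1 - x))" using x by (intro geometric_sums) simp
  have wu: "weighted_sq (tcoeff u) n = x ^ n / (real n + 1)" for n
    by (simp add: weighted_sq_def tu norm_power x_def power_mult[symmetric] mult.commute)
  show "(bnorm u)\<^sup>2 \<le> 1 / (1 - (cmod c)\<^sup>2)"
    unfolding disk_L2_tcoeff(2)[OF uL] x_def[symmetric] sums_unique[OF geo]
  proof (rule suminf_le)
    show "weighted_sq (tcoeff u) n \<le> x ^ n" for n
      using x by (simp add: wu divide_le_eq mult_le_cancel_left1 not_less)
  qed (use disk_L2_tcoeff(1)[OF uL] geo in \<open>auto simp: sums_iff\<close>)
  have wf: "weighted_sq (tcoeff (\<lambda>z. u z + z * deriv u z)) n = of_nat (Suc n) * x ^ n" for n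
    unfolding weighted_sq_def tcoeff_deriv_times[OF hol] tu norm_mult norm_power
    by (simp add: x_def power_mult[symmetric] mult.commute power_mult_distrib del: of_nat_Suc)
       (simp add: power2_eq_square add.commute)
  have "(bnorm (\<lambda>z. u z + z * deriv u z))\<^sup>2 = (1 / (1 - x))\<^sup>2"
    using disk_L2_tcoeff(2)[OF disk_L2_deriv_times(1)[OF uL dL]] geometric_deriv_sums[of x] x
    by (simp only: wf) (simp add: sums_iff power_divide)
  then show "bnorm (\<lambda>z. u z + z * deriv u z) = 1 / (1 - (cmod c)\<^sup>2)"
    using x bnorm_nonneg unfolding x_def[symmetric] by (simp add: power2_eq_iff_nonneg)
qed

text \<open>The functions \<open>u = 1/(1 - t (cnj z0) z)\<close>, \<open>t \<rightarrow> 1\<close>, are approximate eigenvectors: the zero of the leading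
  coefficient at \<open>z0\<close> cancels one of the two poles of \<open>u'\<close>.\<close>

lemma circle_root_in_spectrum:
  assumes z0: "cmod z0 = 1" and root: "poly (1 + pCons 0 (p - [:c:])) z0 = 0"
  shows "c \<in> bergman_spectrum (toeplitz (\<lambda>z. cnj z + poly p z))"
proof (rule ccontr)
  assume "\<not> ?thesis"
  then obtain C where C: "\<And>u. disk_L2 u \<Longrightarrow> disk_L2 (deriv u) \<Longrightarrow>
      bnorm (\<lambda>z. u z + z * deriv u z) \<le> C * bnorm (diff_op (p - [:c:]) u)"
    using not_in_spectrum_bounded_below by blast
  define r where "r = p - [:c:]"
  obtain s where s: "1 + pCons 0 r = [:- z0, 1:] * s"
    using root unfolding r_def poly_eq_0_iff_dvd by (auto elim: dvdE)
  obtain B1 where B1: "B1 > 0" "\<And>z. z \<in> cball 0 1 \<Longrightarrow> cmod (poly s z) \<le> B1" using poly_bounded_disk by blast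
  obtain B2 where B2: "B2 > 0" "\<And>z. z \<in> cball 0 1 \<Longrightarrow> cmod (poly r z) \<le> B2" using poly_bounded_disk by blast
  define K where "K = 2 * B1 + B2"
  have "K > 0" using B1 B2 by (simp add: K_def)
  define D where "D = \<bar>C\<bar> * K"
  \<comment> \<open>If \<open>C\<close> existed, \<open>1 / (1 - t^2) \<le> D * bnorm u\<close>
    would hold with \<open>bnorm u\<close> at most the square root of the left side.\<close>
  have bound: "1 / (1 - t\<^sup>2) \<le> D\<^sup>2" if t: "0 < t" "t < 1" for t :: real
  proof -
    define a where "a = of_real t * cnj z0"
    have a: "cmod a = t" using t z0 by (simp add: a_def norm_mult)
    then have a1: "cmod a < 1" using t by simp
    define u where "u = (\<lambda>z. 1 / (1 - a * z))"
    note ck = cauchy_kernel_bnorm[OF a1, folded u_def]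
    have zz: "cnj z0 * z0 = 1" using z0 by (metis complex_norm_square mult.commute of_real_1 one_power2)
    \<comment> \<open>On the one hand \<open>|1 - a z| = |z0 - t z| \<ge> 1 - t\<close>; on the
      other \<open>z - z0\<close> differs from \<open>t z - z0\<close> by \<open>(1 - t) z\<close>.
      Together they give the factor 2.\<close>
    have est: "t \<noteq> 1 \<and> 1 - a * z \<noteq> 0 \<and> cmod (z - z0) \<le> 2 * cmod (1 - a * z)" if z: "z \<in> unit_disk" for z
    proof -
      have "1 - a * z = cnj z0 * (z0 - of_real t * z)"
        by (simp add: a_def right_diff_distrib zz)
      then have eq: "cmod (1 - a * z) = cmod (z0 - of_real t * z)"
        using z0 by (simp add: norm_mult)
      have "cmod z0 - cmod (of_real t * z) \<le> cmod (z0 - of_real t * z)"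
        by (rule norm_triangle_ineq2)
      moreover have "cmod (of_real t * z) \<le> t"
        using t z by (simp add: norm_mult mult_left_le)
      ultimately have 1: "1 - t \<le> cmod (z0 - of_real t * z)" using z0 by linarith
      have "z - z0 = of_real (1 - t) * z - (z0 - of_real t * z)" by (simp add: algebra_simps)
      then have "cmod (z - z0) \<le> cmod (of_real (1 - t) * z) + cmod (z0 - of_real t * z)"
        by (metis norm_triangle_ineq4)
      also have "cmod (of_real (1 - t) * z) \<le> 1 - t"
        using t z unfolding norm_mult norm_of_real by (simp add: mult_left_le)
      finally show ?thesis using 1 t eq by auto
    qed
    \<comment> \<open>Here \<open>deriv u z = a / (1 - a * z) * u z\<close>; the root factor
      \<open>z - z0\<close> is paired with this denominator, which leaves a bounded multiplier of
      \<open>u\<close>.\<close>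
    have eq: "diff_op r u z = ((z - z0) / (1 - a * z) * (a * poly s z) + poly r z) * u z" if z: "z \<in> unit_disk" for z
      using est[OF z] unfolding diff_op_def s ck(3)[OF z] by (simp add: u_def power2_eq_square add_divide_distrib diff_divide_distrib algebra_simps)
    have "bnorm (\<lambda>z. ((z - z0) / (1 - a * z) * (a * poly s z) + poly r z) * u z) \<le> K * bnorm u"
    proof (rule disk_L2_mult(2)[OF ck(1)])
      show "(\<lambda>z. (z - z0) / (1 - a * z) * (a * poly s z) + poly r z) holomorphic_on unit_disk"
        using est by (intro holomorphic_intros) auto
      fix z assume z: "z \<in> unit_disk"
      have "cmod ((z - z0) / (1 - a * z)) \<le> 2"
        using est[OF z] by (simp add: norm_divide divide_le_eq)
      moreover have "cmod (a * poly s z) \<le> B1"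
        using B1 z a1 mult_mono[of "cmod a" 1 "cmod (poly s z)" B1] by (simp add: norm_mult)
      ultimately have "cmod ((z - z0) / (1 - a * z)) * cmod (a * poly s z) \<le> 2 * B1"
        by (intro mult_mono) auto
      then have "cmod ((z - z0) / (1 - a * z) * (a * poly s z)) \<le> 2 * B1"
        by (simp only: norm_mult)
      moreover have "cmod (poly r z) \<le> B2" using B2 z by simp
      ultimately show "cmod ((z - z0) / (1 - a * z) * (a * poly s z) + poly r z) \<le> K"
        unfolding K_def by (intro order_trans[OF norm_triangle_ineq] add_mono)
    qed
    then have "bnorm (diff_op r u) \<le> K * bnorm u" by (subst bnorm_cong[OF eq])
    then have 1: "\<bar>C\<bar> * bnorm (diff_op r u) \<le> \<bar>C\<bar> * (K * bnorm u)"
      by (rule mult_left_mono) simp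
    have "bnorm (\<lambda>z. u z + z * deriv u z) = 1 / (1 - t\<^sup>2)"
      using ck(5) unfolding a u_def .
    then have "1 / (1 - t\<^sup>2) \<le> C * bnorm (diff_op r u)"
      using C[OF ck(1,2)] by (simp only: r_def)
    also have "\<dots> \<le> \<bar>C\<bar> * bnorm (diff_op r u)"
      by (intro mult_right_mono bnorm_nonneg) simp
    also have "\<dots> \<le> D * bnorm u"
      using 1 by (simp only: D_def mult.assoc)
    finally have "1 / (1 - t\<^sup>2) \<le> D * bnorm u" .
    moreover have pos: "0 < 1 / (1 - t\<^sup>2)" using t by (simp add: power_less_one_iff)
    ultimately have "(1 / (1 - t\<^sup>2))\<^sup>2 \<le> (D * bnorm u)\<^sup>2"
      by (intro power_mono) auto
    also have "\<dots> \<le> D\<^sup>2 * (1 / (1 - t\<^sup>2))"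
      unfolding power_mult_distrib using ck(4) by (intro mult_left_mono) (simp_all add: a)
    finally show ?thesis
      using pos unfolding power2_eq_square[of "1 / (1 - t\<^sup>2)"] by (simp only: mult_le_cancel_right_pos)
  qed
  \<comment> \<open>Chosen such that \<open>1 / y\<close> exceeds \<open>D^2\<close>; the radius is
    then \<open>t = sqrt (1 - y)\<close>.\<close>
  define y where "y = 1 / (D\<^sup>2 + 2)"
  have y: "0 < y" "y < 1" by (auto simp: y_def add_pos_nonneg field_simps intro: add_nonneg_pos)
  have "1 / y \<le> D\<^sup>2"
    using bound[of "sqrt (1 - y)"] y by simp
  then show False by (simp add: y_def)
qed

section \<open>Roots in the open disk\<close>

definition root_poly :: "complex list \<Rightarrow> complex poly" where
  "root_poly as = prod_list (map (\<lambda>a. [:- a, 1:]) as)"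

lemma root_poly_simps [simp]:
  "root_poly [] = 1" "root_poly (a # as) = [:- a, 1:] * root_poly as"
  by (simp_all add: root_poly_def)

lemma root_poly_nonzero [simp]: "root_poly as \<noteq> 0"
  by (induction as) (simp_all del: mult_pCons_left)

lemma degree_root_poly [simp]: "degree (root_poly as) = length as"
proof (induction as)
  case (Cons a as)
  have "degree ([:- a, 1:] * root_poly as) = degree [:- a, 1:] + degree (root_poly as)"
    by (rule degree_mult_eq) simp_all
  with Cons show ?case by (simp del: mult_pCons_left)
qed simp

lemma coeff_root_poly [simp]: "coeff (root_poly as) (length as) = 1"
proof -
  have "lead_coeff (root_poly as) = 1"
  proof (induction as)
    case (Cons a as)
    have "lead_coeff ([:- a, 1:] * root_poly as) = lead_coeff [:- a, 1:] * lead_coeff (root_poly as)"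
      by (rule lead_coeff_mult)
    with Cons show ?case by (simp del: mult_pCons_left)
  qed simp
  then show ?thesis by simp
qed

text \<open>Multiplication by \<open>X - a\<close> with \<open>|a| < 1\<close> is \<open>1 - a E\<close> for the backward shift \<open>E\<close>, which is invertible on
  bounded sequences.  The bound on the tail of \<open>F\<close> involves the tail of the product only.\<close>

lemma fps_tail_bound_linear:
  fixes F :: "complex fps"
  assumes a: "cmod a < 1" and F: "\<And>n. cmod (fps_nth F n) \<le> M"
    and B: "\<And>m. m \<ge> n + 1 \<Longrightarrow> cmod (fps_nth (fps_of_poly [:- a, 1:] * F) m) \<le> B"
    and j: "j \<ge> n"
  shows "cmod (fps_nth F j) \<le> B / (1 - cmod a)"
proof -
  \<comment> \<open>The bound \<open>M\<close> makes this supremum finite, which permits absorbing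
    \<open>cmod a * ?S\<close>; the resulting estimate is independent of \<open>M\<close>.\<close>
  let ?S = "SUP j\<in>{n..}. cmod (fps_nth F j)"
  have bdd: "bdd_above ((\<lambda>j. cmod (fps_nth F j)) ` {n..})"
    using F by (intro bdd_aboveI[of _ M]) auto
  have le: "cmod (fps_nth F j) \<le> ?S" if "j \<ge> n" for j
    using that by (intro cSUP_upper bdd) auto
  have "cmod (fps_nth F j) \<le> B + cmod a * ?S" if "j \<ge> n" for j
  proof -
    have "fps_nth (fps_of_poly [:- a, 1:] * F) (Suc j) = fps_nth F j - a * fps_nth F (Suc j)"
      by (simp add: fps_of_poly_linear distrib_right)
    then have "fps_nth F j = fps_nth (fps_of_poly [:- a, 1:] * F) (Suc j) + a * fps_nth F (Suc j)" by simp
    then have "cmod (fps_nth F j) \<le> cmod (fps_nth (fps_of_poly [:- a, 1:] * F) (Suc j)) + cmod a * cmod (fps_nth F (Suc j))"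
      by (metis norm_mult norm_triangle_ineq)
    also have "\<dots> \<le> B + cmod a * ?S"
      using B[of "Suc j"] le[of "Suc j"] that by (intro add_mono mult_left_mono) auto
    finally show ?thesis .
  qed
  then have "?S \<le> B + cmod a * ?S" by (intro cSUP_least) auto
  then have "?S * (1 - cmod a) \<le> B" by (simp add: algebra_simps)
  then have "?S \<le> B / (1 - cmod a)" using a by (simp add: field_simps)
  then show ?thesis using le[OF j] by linarith
qed

text \<open>Linear factors are removed one at a time. Each costs \<open>1 / (1 - cmod a)\<close> and
  moves the start of the tail by one, which accounts for \<open>n + length as\<close>.\<close>

lemma fps_tail_bound:
  fixes F :: "complex fps"
  assumes "\<And>a. a \<in> set as \<Longrightarrow> cmod a < 1" "\<And>n. cmod (fps_nth F n) \<le> M"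
    and "\<And>m. m \<ge> n + length as \<Longrightarrow> cmod (fps_nth (fps_of_poly (root_poly as) * F) m) \<le> B"
    and "j \<ge> n"
  shows "cmod (fps_nth F j) \<le> prod_list (map (\<lambda>a. 1 / (1 - cmod a)) as) * B"
  using assms
proof (induction as arbitrary: F M n j)
  case (Cons a as)
  let ?G = "fps_of_poly [:- a, 1:] * F" and ?K = "prod_list (map (\<lambda>a. 1 / (1 - cmod a)) as)"
  have "cmod (fps_nth ?G m) \<le> M + cmod a * M" for m
  proof -
    have "fps_nth ?G m = (if m = 0 then 0 else fps_nth F (m - 1)) - a * fps_nth F m"
      by (simp add: fps_of_poly_linear distrib_right)
    then have "cmod (fps_nth ?G m) \<le> cmod (if m = 0 then 0 else fps_nth F (m - 1)) + cmod (a * fps_nth F m)"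
      by (metis norm_triangle_ineq4)
    also have "\<dots> \<le> M + cmod a * M"
      using Cons.prems(2) order_trans[OF norm_ge_zero Cons.prems(2)]
      by (intro add_mono) (auto simp: norm_mult intro!: mult_left_mono)
    finally show ?thesis .
  qed
  moreover have "cmod (fps_nth (fps_of_poly (root_poly as) * ?G) m) \<le> B" if "m \<ge> (n + 1) + length as" for m
    using Cons.prems(3)[of m] that by (simp add: fps_of_poly_mult mult_ac del: mult_pCons_left mult_pCons_right)
  ultimately have "cmod (fps_nth ?G m) \<le> ?K * B" if "m \<ge> n + 1" for m
    using that Cons.prems(1) by (intro Cons.IH[of ?G _ "n + 1"]) auto
  then have "cmod (fps_nth F j) \<le> ?K * B / (1 - cmod a)"
    using Cons.prems by (intro fps_tail_bound_linear[of a F M n]) auto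
  then show ?case by (simp add: mult.commute)
qed auto

text \<open>The equation reads \<open>(Q V)' = H V + G\<close> with \<open>degree H \<le> N\<close>.
  Beyond \<open>degree G\<close>, differentiation gains a factor \<open>l + 1\<close> in coefficient
  \<open>l\<close>, so the tail of \<open>Q V\<close> is at most \<open>C * ?S / n0\<close>, where
  \<open>?S\<close> is the supremum of the tail of \<open>V\<close>. By
  \<open>fps_tail_bound\<close>, \<open>?S \<le> K * C * ?S / n0\<close>, and
  \<open>K * C < n0\<close> forces \<open>?S = 0\<close>. The indices fit exactly: the tail bound
  needs coefficients of \<open>Q V\<close> from \<open>n + Suc N\<close> on, and these involve
  \<open>V\<close> from \<open>n\<close> on.\<close>

lemma bounded_solution_eventually_zero:
  fixes V :: "complex fps"
  assumes roots: "\<And>a. a \<in> set as \<Longrightarrow> cmod a < 1" and N: "length as = Suc N" and R: "degree R \<le> N"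
    and V: "\<And>n. cmod (fps_nth V n) \<le> M"
    and eq: "fps_of_poly (root_poly as) * fps_deriv V + fps_of_poly R * V = fps_of_poly G"
  shows "\<exists>n0. \<forall>n\<ge>n0. fps_nth V n = 0"
proof -
  let ?Q = "root_poly as"
  define H where "H = pderiv ?Q - R"
  have degH: "degree H \<le> N"
    unfolding H_def using R N by (intro degree_diff_le) (simp_all add: degree_pderiv)
  have QV: "fps_deriv (fps_of_poly ?Q * V) = fps_of_poly H * V + fps_of_poly G"
    unfolding eq[symmetric] H_def by (simp add: fps_of_poly_diff fps_of_poly_pderiv algebra_simps)
  define K where "K = prod_list (map (\<lambda>a. 1 / (1 - cmod a)) as)"
  define C where "C = (\<Sum>i\<le>N. cmod (coeff H i))"
  have K: "K \<ge> 0" unfolding K_def using roots by (induction as) (auto simp: less_imp_le)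
  have C: "C \<ge> 0" unfolding C_def by (simp add: sum_nonneg)
  define n0 where "n0 = Suc (degree G) + nat \<lceil>K * C\<rceil> + 1"
  have n0: "K * C < real n0" "degree G < n0"
    unfolding n0_def by linarith+
  have "fps_nth V n = 0" if n: "n \<ge> n0" for n
  proof -
    let ?S = "SUP j\<in>{n..}. cmod (fps_nth V j)"
    have bdd: "bdd_above ((\<lambda>j. cmod (fps_nth V j)) ` {n..})"
      using V by (intro bdd_aboveI[of _ M]) auto
    have le: "cmod (fps_nth V j) \<le> ?S" if "j \<ge> n" for j
      using that by (intro cSUP_upper bdd) auto
    have S0: "?S \<ge> 0" using le[of n] norm_ge_zero order_trans by blast
    have "cmod (fps_nth (fps_of_poly ?Q * V) m) \<le> C * ?S / real n0" if m: "m \<ge> n + length as" for m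
    proof -
      obtain l where l: "m = Suc l" "l \<ge> n + N" using m N by (cases m) auto
      have "of_nat (Suc l) * fps_nth (fps_of_poly ?Q * V) (Suc l) = fps_nth (fps_of_poly H * V) l + coeff G l"
        using arg_cong[OF QV, of "\<lambda>F. fps_nth F l"]
        by (simp only: fps_deriv_nth fps_add_nth fps_of_poly_nth Suc_eq_plus1)
      also have "coeff G l = 0" using l n n0 by (intro coeff_eq_0) auto
      finally have e: "of_nat (Suc l) * fps_nth (fps_of_poly ?Q * V) (Suc l) = (\<Sum>i\<le>l. coeff H i * fps_nth V (l - i))"
        by (simp add: fps_mult_nth atLeast0AtMost)
      also have "\<dots> = (\<Sum>i\<le>N. coeff H i * fps_nth V (l - i))"
        using l degH by (intro sum.mono_neutral_right) (auto intro!: coeff_eq_0)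
      finally have "real (Suc l) * cmod (fps_nth (fps_of_poly ?Q * V) (Suc l)) = cmod (\<Sum>i\<le>N. coeff H i * fps_nth V (l - i))"
        by (metis norm_mult norm_of_nat)
      also have "\<dots> \<le> (\<Sum>i\<le>N. cmod (coeff H i) * ?S)"
        using l by (intro sum_norm_le) (auto simp: norm_mult intro!: mult_left_mono le)
      also have "\<dots> = C * ?S" by (simp add: C_def sum_distrib_right)
      finally have *: "real (Suc l) * cmod (fps_nth (fps_of_poly ?Q * V) (Suc l)) \<le> C * ?S" .
      have "real n0 * cmod (fps_nth (fps_of_poly ?Q * V) m) \<le> real (Suc l) * cmod (fps_nth (fps_of_poly ?Q * V) (Suc l))"
        unfolding l(1) using l n by (intro mult_right_mono) auto
      with * have "real n0 * cmod (fps_nth (fps_of_poly ?Q * V) m) \<le> C * ?S" by linarith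
      then show ?thesis using n0 by (simp add: field_simps)
    qed
    then have "cmod (fps_nth V j) \<le> K * (C * ?S / real n0)" if "j \<ge> n" for j
      unfolding K_def using roots V that by (intro fps_tail_bound[of as V M n])
    then have "?S \<le> K * (C * ?S / real n0)" by (intro cSUP_least) auto
    then have "?S * (real n0 - K * C) \<le> 0"
      using n0 by (simp add: field_simps)
    then have "?S \<le> 0" using n0 by (simp add: mult_le_0_iff)
    then have "cmod (fps_nth V n) \<le> 0" using le[of n] by linarith
    then show ?thesis by simp
  qed
  then show ?thesis by blast
qed

section \<open>Leading coefficients and unsolvable right-hand sides\<close>

lemma coeff_mult_top:
  fixes p q :: "'a::comm_semiring_0 poly"
  assumes "degree p \<le> m" "degree q \<le> n"
  shows "coeff (p * q) (m + n) = coeff p m * coeff q n"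
proof -
  have "coeff (p * q) (m + n) = (\<Sum>i\<le>m + n. coeff p i * coeff q (m + n - i))"
    by (rule coeff_mult)
  also have "\<dots> = (\<Sum>i\<in>{m}. coeff p i * coeff q (m + n - i))"
  proof (rule sum.mono_neutral_right)
    show "\<forall>i\<in>{..m + n} - {m}. coeff p i * coeff q (m + n - i) = 0"
    proof
      fix i assume "i \<in> {..m + n} - {m}"
      then have "i > m \<or> m + n - i > n" by auto
      then show "coeff p i * coeff q (m + n - i) = 0"
        using assms coeff_eq_0[of p i] coeff_eq_0[of q "m + n - i"] by auto
    qed
  qed auto
  finally show ?thesis by simp
qed

text \<open>Both terms can reach degree \<open>degree v + N\<close>, and \<open>- coeff R N\<close>
  acts as the exponent at infinity: the top coefficient cancels for nonzero \<open>v\<close> exactly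
  when \<open>degree v\<close> equals it.\<close>

lemma ode_top_coeff:
  assumes N: "length as = Suc N" and R: "degree R \<le> N"
  shows "coeff (root_poly as * pderiv v + R * v) (degree v + N) = (of_nat (degree v) + coeff R N) * lead_coeff v"
    and "degree (root_poly as * pderiv v + R * v) \<le> degree v + N"
proof -
  have "coeff (root_poly as * pderiv v) (degree v + N) = of_nat (degree v) * lead_coeff v \<and>
    degree (root_poly as * pderiv v) \<le> degree v + N"
  proof (cases "degree v")
    case 0
    then show ?thesis by (simp add: pderiv_eq_0_iff[THEN iffD2])
  next
    case (Suc d)
    have d: "degree (pderiv v) = d" using Suc by (simp add: degree_pderiv)
    have "degree v + N = Suc N + d" using Suc by simp
    moreover have "coeff (root_poly as * pderiv v) (Suc N + d) = coeff (root_poly as) (Suc N) * coeff (pderiv v) d"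
      using N d by (intro coeff_mult_top) auto
    moreover have "coeff (root_poly as) (Suc N) = 1" using coeff_root_poly[of as] by (simp only: N)
    ultimately show ?thesis
      using Suc N d degree_mult_le[of "root_poly as" "pderiv v"] by (simp add: coeff_pderiv add.commute)
  qed
  moreover have "coeff (R * v) (N + degree v) = coeff R N * lead_coeff v"
    using R by (intro coeff_mult_top) auto
  moreover have "degree (R * v) \<le> degree v + N"
    using degree_mult_le[of R v] R by simp
  ultimately show "coeff (root_poly as * pderiv v + R * v) (degree v + N) = (of_nat (degree v) + coeff R N) * lead_coeff v"
    "degree (root_poly as * pderiv v + R * v) \<le> degree v + N"
    by (simp_all add: algebra_simps degree_add_le)
qed

lemma eventually_zero_fps_poly:
  fixes V :: "complex fps"
  assumes "\<forall>n\<ge>n0. fps_nth V n = 0"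
  obtains v where "V = fps_of_poly v"
proof
  show "V = fps_of_poly (poly_of_list (map (fps_nth V) [0..<n0]))"
    using assms by (auto simp: fps_eq_iff nth_default_def not_less)
qed

text \<open>A polynomial right-hand side forces a polynomial solution, whose degree can be read off unless the exponent
  \<open>d\<close> at infinity is a natural number; in that case \<open>z^(d+N)\<close> is not attained.\<close>

lemma ex_unsolvable:
  assumes roots: "\<And>a. a \<in> set as \<Longrightarrow> cmod a < 1" and N: "length as = Suc (Suc N)" and R: "degree R \<le> Suc N"
  obtains G :: "complex poly" where
    "\<And>V M. (\<And>n. cmod (fps_nth V n) \<le> M) \<Longrightarrow>
      fps_of_poly (root_poly as) * fps_deriv V + fps_of_poly R * V \<noteq> fps_of_poly G"
proof -
  have ex: "\<exists>v. G = root_poly as * pderiv v + R * v"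
    if sol: "\<And>n. cmod (fps_nth V n) \<le> M" "fps_of_poly (root_poly as) * fps_deriv V + fps_of_poly R * V = fps_of_poly G"
    for V M G
  proof -
    obtain v where "V = fps_of_poly v"
      using eventually_zero_fps_poly bounded_solution_eventually_zero[OF roots N R sol] by metis
    then have "fps_of_poly G = fps_of_poly (root_poly as * pderiv v + R * v)"
      unfolding sol(2)[symmetric] by (simp add: fps_of_poly_add fps_of_poly_mult fps_of_poly_pderiv)
    then show ?thesis by (auto simp: fps_of_poly_eq_iff)
  qed
  have "\<exists>G. \<forall>v. G \<noteq> root_poly as * pderiv v + R * v"
  proof (cases "\<exists>d. of_nat d + coeff R (Suc N) = 0")
    case True
    then obtain d where d: "of_nat d + coeff R (Suc N) = 0" by blast
    have False if eq: "monom 1 (d + Suc N) = root_poly as * pderiv v + R * v" for v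
    proof -
      have top: "coeff (monom 1 (d + Suc N)) (degree v + Suc N) = (of_nat (degree v) + coeff R (Suc N)) * lead_coeff v"
        unfolding eq by (rule ode_top_coeff[OF N R])
      have "v \<noteq> 0" using eq by (auto simp: monom_eq_0_iff)
      show False
      \<comment> \<open>If \<open>degree v = d\<close>, the coefficient of
        \<open>z^(d + Suc N)\<close> on the right is 0; otherwise the right side has a nonzero
        coefficient in another degree.\<close>
      proof (cases "degree v = d")
        case True
        then show False using top d by simp
      next
        case False
        then have "of_nat (degree v) + coeff R (Suc N) = 0" using top \<open>v \<noteq> 0\<close> by simp
        then have "of_nat (degree v) = (of_nat d :: complex)" using d by (metis add_right_cancel)
        then show False using False by simp
      qed
    qed
    then show ?thesis by blast
  next
    case False
    \<comment> \<open>The degree \<open>degree v + Suc N\<close> is positive, so \<open>1\<close>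
      has coefficient 0 there while the right side does not. This is where a second root
      enters.\<close>
    have False if eq: "1 = root_poly as * pderiv v + R * v" for v
    proof -
      have top: "coeff 1 (degree v + Suc N) = (of_nat (degree v) + coeff R (Suc N)) * lead_coeff v"
        unfolding eq by (rule ode_top_coeff[OF N R])
      moreover have "v \<noteq> 0" using eq by auto
      ultimately show False using False by simp
    qed
    then show ?thesis by blast
  qed
  then show ?thesis using that ex by metis
qed

section \<open>Backward recurrence for a single simple root\<close>

lemma product_growth:
  fixes e :: "nat \<Rightarrow> real"
  assumes "\<And>n. 0 \<le> e n" "\<And>n. e n \<le> L" "1 \<le> L" "1 \<le> \<sigma>" "\<And>n. n \<ge> J \<Longrightarrow> e n \<le> \<sigma>"
  shows "(\<Prod>j<i. e (n + j)) \<le> L ^ (J - n) * \<sigma> ^ i"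
proof (induction i arbitrary: n)
  case (Suc i)
  have "(\<Prod>j<Suc i. e (n + j)) = e n * (\<Prod>j<i. e (Suc n + j))"
    by (subst prod.lessThan_Suc_shift) simp
  also have "\<dots> \<le> e n * (L ^ (J - Suc n) * \<sigma> ^ i)"
    by (intro mult_left_mono Suc.IH assms)
  also have "\<dots> \<le> L ^ (J - n) * \<sigma> ^ Suc i"
  \<comment> \<open>At most \<open>J - n\<close> of the factors have an index below
    \<open>J\<close>; each of these costs \<open>L\<close>.\<close>
  proof (cases "n < J")
    case True
    have "e n * (L ^ (J - Suc n) * \<sigma> ^ i) \<le> L * (L ^ (J - Suc n) * \<sigma> ^ i)"
      using assms by (intro mult_right_mono) auto
    also have "\<dots> = L ^ (J - n) * \<sigma> ^ i"
      using True by (simp add: Suc_diff_Suc[symmetric])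
    also have "\<dots> \<le> L ^ (J - n) * \<sigma> ^ Suc i"
      using assms by (intro mult_left_mono power_increasing) auto
    finally show ?thesis .
  next
    case False
    then have "e n * \<sigma> ^ i \<le> \<sigma> * \<sigma> ^ i"
      using assms by (intro mult_right_mono) auto
    then show ?thesis using False by simp
  qed
  finally show ?case .
qed (use assms in simp)

text \<open>The ratio tends to 1, hence is bounded and eventually below any
  \<open>\<sigma> > 1\<close>. A vanishing denominator gives the value 0.\<close>

lemma ratio_bounds:
  fixes \<rho> :: complex
  assumes \<sigma>: "\<sigma> > 1"
  obtains L J where "L \<ge> 1" "\<And>n. cmod (of_nat (n + 1) / (of_nat n + \<rho>)) \<le> L"
    "\<And>n. n \<ge> J \<Longrightarrow> cmod (of_nat (n + 1) / (of_nat n + \<rho>)) \<le> \<sigma>"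
proof -
  define e where "e n = cmod (of_nat (n + 1) / (of_nat n + \<rho>))" for n
  have "(\<lambda>n. (1 + 1 / of_nat n) / (1 + \<rho> / of_nat n)) \<longlonglongrightarrow> (1 + 0) / (1 + 0 :: complex)"
    by (intro tendsto_intros lim_const_over_n) simp
  moreover have "\<forall>\<^sub>F n in sequentially. (1 + 1 / of_nat n) / (1 + \<rho> / of_nat n) = of_nat (n + 1) / (of_nat n + \<rho>)"
  proof (intro eventually_mono[OF eventually_gt_at_top[of 0]])
    fix n :: nat assume "n > 0"
    then have "1 + 1 / of_nat n = (of_nat (n + 1) / of_nat n :: complex)" "1 + \<rho> / of_nat n = (of_nat n + \<rho>) / of_nat n"
      by (simp_all add: field_simps)
    then show "(1 + 1 / of_nat n) / (1 + \<rho> / of_nat n) = of_nat (n + 1) / (of_nat n + \<rho>)"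
      using \<open>n > 0\<close> by simp
  qed
  ultimately have "(\<lambda>n. of_nat (n + 1) / (of_nat n + \<rho>)) \<longlonglongrightarrow> (1 + 0) / (1 + 0 :: complex)"
    by (rule Lim_transform_eventually)
  then have lim: "e \<longlonglongrightarrow> 1"
    unfolding e_def using tendsto_norm by fastforce
  obtain L where L: "\<And>n. norm (e n) \<le> L" 
    using convergent_imp_Bseq[OF convergentI[OF lim]] by (auto simp: Bseq_def)
  obtain J where "\<forall>n\<ge>J. e n < \<sigma>"
    using order_tendstoD(2)[OF lim \<sigma>] by (auto simp: eventually_sequentially)
  then show ?thesis
    using L by (intro that[of "max L 1" J]) (force simp: e_def le_max_iff_disj intro: less_imp_le)+
qed

text \<open>Each weight is split into two square roots; the total weight is at most
  \<open>1 / (1 - \<tau>)\<close>.\<close>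

lemma weighted_cauchy_schwarz:
  fixes x :: "nat \<Rightarrow> real"
  assumes \<tau>: "0 \<le> \<tau>" "\<tau> < 1"
  shows "(\<Sum>i<I. \<tau> ^ i * x i)\<^sup>2 \<le> 1 / (1 - \<tau>) * (\<Sum>i<I. \<tau> ^ i * (x i)\<^sup>2)"
proof -
  have "(\<Sum>i<I. \<tau> ^ i * x i) = (\<Sum>i<I. sqrt (\<tau> ^ i) * (sqrt (\<tau> ^ i) * x i))"
    using \<tau> by (simp add: mult.assoc[symmetric])
  also have "\<dots>\<^sup>2 \<le> (\<Sum>i<I. (sqrt (\<tau> ^ i))\<^sup>2) * (\<Sum>i<I. (sqrt (\<tau> ^ i) * x i)\<^sup>2)"
    by (rule Cauchy_Schwarz_ineq_sum)
  also have "\<dots> = (\<Sum>i<I. \<tau> ^ i) * (\<Sum>i<I. \<tau> ^ i * (x i)\<^sup>2)"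
    using \<tau> by (simp add: power_mult_distrib)
  also have "(\<Sum>i<I. \<tau> ^ i) \<le> 1 / (1 - \<tau>)"
    using \<tau> sum_le_suminf[of "\<lambda>i. \<tau> ^ i" "{..<I}"] by (simp add: suminf_geometric summable_geometric)
  then have "(\<Sum>i<I. \<tau> ^ i) * (\<Sum>i<I. \<tau> ^ i * (x i)\<^sup>2) \<le> 1 / (1 - \<tau>) * (\<Sum>i<I. \<tau> ^ i * (x i)\<^sup>2)"
    using \<tau> by (intro mult_right_mono sum_nonneg) auto
  finally show ?thesis .
qed

text \<open>The recurrence \<open>(n + \<rho>) v\<^sub>n = G\<^sub>n + a (n + 1) v\<^sub>n\<^sub>+\<^sub>1\<close> is solved backwards from infinity;
  since \<open>|a| < 1\<close>, the resulting kernel decays geometrically off the diagonal.\<close>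

lemma ex_backward_solution:
  fixes a \<rho> :: complex
  assumes a: "cmod a < 1" and \<rho>: "\<And>n. of_nat n + \<rho> \<noteq> 0"
  obtains K where "K \<ge> 0"
    "\<And>G. summable (weighted_sq G) \<Longrightarrow> \<exists>v. (\<forall>n. (of_nat n + \<rho>) * v n = G n + a * of_nat (n + 1) * v (n + 1)) \<and>
      (\<forall>M. (\<Sum>n<M. (real n + 1) * (cmod (v n))\<^sup>2) \<le> K * (\<Sum>n. weighted_sq G n))"
proof -
  \<comment> \<open>A rate above 1 with \<open>\<tau> = cmod a * \<sigma>\<close> still below 1, so
    that the geometric decay outweighs the ratios \<open>e n\<close>.\<close>
  define \<sigma> where "\<sigma> = 2 / (1 + cmod a)"
  define \<tau> where "\<tau> = cmod a * \<sigma>"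
  have pa: "0 < 1 + cmod a" by (simp add: add_pos_nonneg)
  have \<sigma>: "\<sigma> > 1" using a pa by (simp add: \<sigma>_def)
  have \<tau>: "0 \<le> \<tau>" "\<tau> < 1" using a pa by (simp_all add: \<tau>_def \<sigma>_def divide_less_eq)
  define e where "e n = of_nat (n + 1) / (of_nat n + \<rho>)" for n
  obtain L J where LJ: "L \<ge> 1" "\<And>n. cmod (e n) \<le> L" "\<And>n. n \<ge> J \<Longrightarrow> cmod (e n) \<le> \<sigma>"
    using ratio_bounds[OF \<sigma>, of \<rho>] unfolding e_def by metis
  \<comment> \<open>Unrolling the recurrence gives \<open>v n\<close> as the sum of
    \<open>G (n + i) * c n i\<close>, where \<open>c n i\<close> is \<open>a ^ i\<close> times
    \<open>(n + 1) ... (n + i)\<close> divided by \<open>(n + \<rho>) ... (n + i + \<rho>)\<close>.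
    The \<open>i + 1\<close> ratios \<open>e\<close> carry one numerator too many, which the last
    division removes.\<close>
  define c where "c n i = a ^ i * (\<Prod>j<Suc i. e (n + j)) / of_nat (n + i + 1)" for n i
  define C where "C = L ^ J * \<sigma>"
  have C: "C \<ge> 0" using LJ \<sigma> by (simp add: C_def)
  have c_bound: "cmod (c n i) \<le> C * \<tau> ^ i / (real (n + i) + 1)" for n i
  proof -
    have "(\<Prod>j<Suc i. cmod (e (n + j))) \<le> L ^ (J - n) * \<sigma> ^ Suc i"
      using LJ \<sigma> by (intro product_growth[of "\<lambda>n. cmod (e n)"]) auto
    also have "\<dots> \<le> L ^ J * \<sigma> ^ Suc i"
      using LJ \<sigma> by (intro mult_right_mono power_increasing) auto
    finally have "cmod (\<Prod>j<Suc i. e (n + j)) \<le> L ^ J * \<sigma> ^ Suc i" by (simp only: prod_norm)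
    then have "cmod a ^ i * cmod (\<Prod>j<Suc i. e (n + j)) \<le> cmod a ^ i * (L ^ J * \<sigma> ^ Suc i)"
      by (rule mult_left_mono) simp
    also have "\<dots> = C * \<tau> ^ i" by (simp add: C_def \<tau>_def power_mult_distrib)
    finally have "cmod a ^ i * cmod (\<Prod>j<Suc i. e (n + j)) \<le> C * \<tau> ^ i" .
    moreover have "cmod (c n i) = cmod a ^ i * cmod (\<Prod>j<Suc i. e (n + j)) / (real (n + i) + 1)"
      unfolding c_def norm_divide norm_mult norm_power norm_of_nat by simp
    ultimately show ?thesis by (simp add: divide_right_mono)
  qed
  have c_0: "(of_nat n + \<rho>) * c n 0 = 1" for n
    using \<rho>[of n] of_nat_neq_0[of n] by (simp add: c_def e_def del: of_nat_Suc)
  have c_Suc: "(of_nat n + \<rho>) * c n (Suc i) = a * of_nat (n + 1) * c (n + 1) i" for n i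
  proof -
    have "(\<Prod>j<Suc (Suc i). e (n + j)) = e n * (\<Prod>j<Suc i. e (n + 1 + j))"
      by (subst prod.lessThan_Suc_shift) simp
    then have "c n (Suc i) = a * e n * c (n + 1) i"
      by (simp add: c_def mult_ac del: prod.lessThan_Suc of_nat_Suc)
    then show ?thesis using \<rho>[of n] by (simp add: e_def del: of_nat_Suc of_nat_add)
  qed
  define K where "K = (C / (1 - \<tau>))\<^sup>2"
  show ?thesis
  proof (rule that[of K])
    show "K \<ge> 0" by (simp add: K_def)
    fix G assume G: "summable (weighted_sq G)"
    obtain B where B: "\<And>n. cmod (G n) \<le> B * (real n + 1)"
      using weighted_sq_summable_imp_linear_growth[OF G] by blast
    have sm: "summable (\<lambda>i. G (n + i) * c n i)" for n
    proof (rule summable_comparison_test')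
      show "summable (\<lambda>i. B * C * \<tau> ^ i)"
        using \<tau> by (intro summable_mult summable_geometric) simp
      fix i :: nat assume "i \<ge> 0"
      have "cmod (G (n + i)) * cmod (c n i) \<le> (B * (real (n + i) + 1)) * (C * \<tau> ^ i / (real (n + i) + 1))"
        using B[of "n + i"] c_bound[of n i] order_trans[OF norm_ge_zero B[of "n + i"]] by (intro mult_mono) auto
      also have "\<dots> = B * C * \<tau> ^ i"
        using of_nat_0_le_iff[of "n + i", where ?'a = real] by (simp add: field_simps)
      finally show "norm (G (n + i) * c n i) \<le> B * C * \<tau> ^ i"
        by (simp add: norm_mult)
    qed
    define v where "v n = (\<Sum>i. G (n + i) * c n i)" for n
    have rec: "(of_nat n + \<rho>) * v n = G n + a * of_nat (n + 1) * v (n + 1)" for n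
    proof -
      have "(of_nat n + \<rho>) * v n = (\<Sum>i. (of_nat n + \<rho>) * (G (n + i) * c n i))"
        unfolding v_def by (rule suminf_mult[OF sm, symmetric])
      also have "\<dots> = (\<Sum>i. (of_nat n + \<rho>) * (G (n + Suc i) * c n (Suc i))) + (of_nat n + \<rho>) * (G (n + 0) * c n 0)"
        using suminf_split_head[OF summable_mult[OF sm[of n], of "of_nat n + \<rho>"]] by (simp only: diff_add_cancel)
      also have "(of_nat n + \<rho>) * (G (n + 0) * c n 0) = G n"
        using c_0[of n] by (simp add: mult.left_commute)
      also have "(\<Sum>i. (of_nat n + \<rho>) * (G (n + Suc i) * c n (Suc i))) = (\<Sum>i. (a * of_nat (n + 1)) * (G (n + 1 + i) * c (n + 1) i))"
      proof -
        have "(of_nat n + \<rho>) * (G (n + Suc i) * c n (Suc i)) = (a * of_nat (n + 1)) * (G (n + 1 + i) * c (n + 1) i)" for i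
        proof -
          have "(of_nat n + \<rho>) * (G (n + Suc i) * c n (Suc i)) = G (n + Suc i) * ((of_nat n + \<rho>) * c n (Suc i))"
            by (simp only: mult_ac)
          also have "\<dots> = G (n + 1 + i) * (a * of_nat (n + 1) * c (n + 1) i)"
            by (simp only: c_Suc) simp
          finally show ?thesis by (simp only: mult_ac)
        qed
        then show ?thesis by (simp only:)
      qed
      also have "\<dots> = a * of_nat (n + 1) * v (n + 1)"
        unfolding v_def by (rule suminf_mult[OF sm])
      finally show ?thesis by simp
    qed
    have bound: "(\<Sum>n<M. (real n + 1) * (cmod (v n))\<^sup>2) \<le> K * (\<Sum>n. weighted_sq G n)" for M
    proof -
      \<comment> \<open>A Schur test on truncated sums, so that sums may be exchanged freely.
        Cauchy-Schwarz with weights \<open>\<tau> ^ i\<close> bounds each \<open>V I n\<close>, and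
        summing over \<open>n\<close> first supplies the second factor
        \<open>1 / (1 - \<tau>)\<close> of \<open>K\<close>.\<close>
      define V where "V I n = (\<Sum>i<I. G (n + i) * c n i)" for I n
      have lim: "(\<lambda>I. \<Sum>n<M. (real n + 1) * (cmod (V I n))\<^sup>2) \<longlonglongrightarrow> (\<Sum>n<M. (real n + 1) * (cmod (v n))\<^sup>2)"
        unfolding V_def v_def by (intro tendsto_intros summable_LIMSEQ sm)
      have "(\<Sum>n<M. (real n + 1) * (cmod (V I n))\<^sup>2) \<le> K * (\<Sum>n. weighted_sq G n)" for I
      proof -
        have "(real n + 1) * (cmod (V I n))\<^sup>2 \<le> C\<^sup>2 / (1 - \<tau>) * (\<Sum>i<I. \<tau> ^ i * weighted_sq G (n + i))" for n
        proof -
          \<comment> \<open>The \<open>1 / (n + i + 1)\<close> from the bound on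
            \<open>c n i\<close> is kept with \<open>G\<close>. After squaring, one power pays for
            the weight \<open>n + 1\<close> and the other produces
            \<open>weighted_sq\<close>.\<close>
          define x where "x i = cmod (G (n + i)) / (real (n + i) + 1)" for i
          have "cmod (V I n) \<le> (\<Sum>i<I. C * (\<tau> ^ i * x i))"
            unfolding V_def
          proof (rule sum_norm_le)
            fix i
            have "cmod (G (n + i)) * cmod (c n i) \<le> cmod (G (n + i)) * (C * \<tau> ^ i / (real (n + i) + 1))"
              by (intro mult_left_mono c_bound) simp
            then show "cmod (G (n + i) * c n i) \<le> C * (\<tau> ^ i * x i)"
              by (simp add: norm_mult x_def mult_ac)
          qed
          then have "cmod (V I n) \<le> C * (\<Sum>i<I. \<tau> ^ i * x i)" by (simp only: sum_distrib_left)
          then have "(cmod (V I n))\<^sup>2 \<le> (C * (\<Sum>i<I. \<tau> ^ i * x i))\<^sup>2" by (rule power_mono) simp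
          also have "\<dots> \<le> C\<^sup>2 * (1 / (1 - \<tau>) * (\<Sum>i<I. \<tau> ^ i * (x i)\<^sup>2))"
            unfolding power_mult_distrib by (intro mult_left_mono weighted_cauchy_schwarz \<tau>) simp
          finally have "(real n + 1) * (cmod (V I n))\<^sup>2 \<le> (real n + 1) * (C\<^sup>2 * (1 / (1 - \<tau>) * (\<Sum>i<I. \<tau> ^ i * (x i)\<^sup>2)))"
            by (rule mult_left_mono) simp
          also have "\<dots> = C\<^sup>2 / (1 - \<tau>) * (\<Sum>i<I. \<tau> ^ i * ((real n + 1) * (x i)\<^sup>2))"
            by (simp add: sum_distrib_left mult_ac)
          also have "\<dots> \<le> C\<^sup>2 / (1 - \<tau>) * (\<Sum>i<I. \<tau> ^ i * weighted_sq G (n + i))"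
          proof (intro mult_left_mono sum_mono)
            fix i
            have p: "0 < real (n + i) + 1" by (simp add: add_nonneg_pos)
            have "(real n + 1) * (x i)\<^sup>2 \<le> (real (n + i) + 1) * (x i)\<^sup>2" by (intro mult_right_mono) auto
            also have "\<dots> = weighted_sq G (n + i)"
              using p by (simp add: x_def weighted_sq_def power2_eq_square)
            finally show "(real n + 1) * (x i)\<^sup>2 \<le> weighted_sq G (n + i)" .
          qed (use \<tau> in auto)
          finally show ?thesis .
        qed
        then have "(\<Sum>n<M. (real n + 1) * (cmod (V I n))\<^sup>2) \<le> (\<Sum>n<M. C\<^sup>2 / (1 - \<tau>) * (\<Sum>i<I. \<tau> ^ i * weighted_sq G (n + i)))"
          by (intro sum_mono)
        also have "\<dots> = C\<^sup>2 / (1 - \<tau>) * (\<Sum>i<I. \<tau> ^ i * (\<Sum>n<M. weighted_sq G (n + i)))"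
          unfolding sum_distrib_left[symmetric] by (subst sum.swap) (simp only: sum_distrib_left)
        also have "\<dots> \<le> C\<^sup>2 / (1 - \<tau>) * (\<Sum>i<I. \<tau> ^ i * (\<Sum>n. weighted_sq G n))"
        proof (intro mult_left_mono sum_mono)
          fix i
          have "(\<Sum>n<M. weighted_sq G (n + i)) = sum (weighted_sq G) ((\<lambda>n. n + i) ` {..<M})"
            by (subst sum.reindex) auto
          also have "\<dots> \<le> (\<Sum>n. weighted_sq G n)"
            using G by (intro sum_le_suminf) (auto simp: weighted_sq_nonneg)
          finally show "(\<Sum>n<M. weighted_sq G (n + i)) \<le> (\<Sum>n. weighted_sq G n)" .
        qed (use \<tau> in auto)
        also have "\<dots> = C\<^sup>2 / (1 - \<tau>) * (\<Sum>n. weighted_sq G n) * (\<Sum>i<I. \<tau> ^ i)"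
          unfolding sum_distrib_right[symmetric] by (simp only: mult_ac)
        also have "\<dots> \<le> C\<^sup>2 / (1 - \<tau>) * (\<Sum>n. weighted_sq G n) * (1 / (1 - \<tau>))"
          using \<tau> sum_le_suminf[of "\<lambda>i. \<tau> ^ i" "{..<I}"] suminf_nonneg[OF G] weighted_sq_nonneg
          by (intro mult_left_mono mult_nonneg_nonneg) (simp_all add: suminf_geometric summable_geometric)
        also have "\<dots> = K * (\<Sum>n. weighted_sq G n)"
          by (simp add: K_def power_divide power2_eq_square)
        finally show ?thesis .
      qed
      then show ?thesis by (intro LIMSEQ_le_const2[OF lim]) blast
    qed
    from rec bound show "\<exists>v. (\<forall>n. (of_nat n + \<rho>) * v n = G n + a * of_nat (n + 1) * v (n + 1)) \<and>
      (\<forall>M. (\<Sum>n<M. (real n + 1) * (cmod (v n))\<^sup>2) \<le> K * (\<Sum>n. weighted_sq G n))" by blast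
  qed
qed

section \<open>Removing the zero-free factor of the leading coefficient\<close>

lemma has_fps_expansion_poly: "poly p has_fps_expansion fps_of_poly (p :: complex poly)"
proof (induction p)
  case (pCons a p)
  have "(\<lambda>z. a + z * poly p z) has_fps_expansion fps_const a + fps_X * fps_of_poly p"
    by (intro fps_expansion_intros pCons.IH)
  then show ?case by (simp add: fps_of_poly_pCons mult.commute)
qed simp

text \<open>Writing \<open>u = w v\<close> with \<open>w' = (m/s) w\<close> replaces \<open>(1 + z r) u' + r u\<close> by \<open>Q v' + R v\<close>, up to invertible factors.\<close>

locale reduction =
  fixes r Q s R m :: "complex poly" and w :: "complex \<Rightarrow> complex" and B :: real
  assumes q: "1 + pCons 0 r = Q * s" and Rm: "R * s - r = Q * m"
    and s_nz: "\<And>z. z \<in> cball 0 1 \<Longrightarrow> poly s z \<noteq> 0"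
    and w_hol: "w holomorphic_on unit_disk"
    and w_deriv: "\<And>z. z \<in> unit_disk \<Longrightarrow> (w has_field_derivative poly m z / poly s z * w z) (at z)"
    and w_nz: "\<And>z. w z \<noteq> 0"
    and w_le: "\<And>z. z \<in> unit_disk \<Longrightarrow> cmod (w z) \<le> B"
    and winv_le: "\<And>z. z \<in> unit_disk \<Longrightarrow> cmod (1 / w z) \<le> B"
    and sinv_le: "\<And>z. z \<in> unit_disk \<Longrightarrow> cmod (1 / poly s z) \<le> B"
begin

lemma deriv_mult_w:
  assumes "v holomorphic_on unit_disk" "z \<in> unit_disk"
  shows "deriv (\<lambda>z. w z * v z) z = w z * (deriv v z + poly m z * (1 / poly s z * v z))"
proof -
  have "(v has_field_derivative deriv v z) (at z)"
    using assms by (intro holomorphic_derivI[of _ unit_disk]) auto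
  from DERIV_imp_deriv[OF DERIV_mult[OF w_deriv[OF assms(2)] this]]
  show ?thesis by (simp add: algebra_simps)
qed

text \<open>The derivative of \<open>w\<close> contributes \<open>Q * m\<close> to the coefficient
  of \<open>v\<close>, and \<open>Rm\<close> says \<open>Q * m + r = R * s\<close>; hence
  \<open>s\<close> factors out.\<close>

lemma diff_op_mult_w:
  assumes v: "v holomorphic_on unit_disk" and z: "z \<in> unit_disk"
  shows "diff_op r (\<lambda>z. w z * v z) z = w z * (poly s z * (poly Q z * deriv v z + poly R z * v z))"
proof -
  have s: "poly s z \<noteq> 0" using z by (intro s_nz) auto
  have "poly R z * poly s z - poly r z = poly Q z * poly m z"
    using arg_cong[OF Rm, of "\<lambda>p. poly p z"] by simp
  then have *: "poly R z * poly s z = poly r z + poly Q z * poly m z" by (simp add: algebra_simps)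
  have "diff_op r (\<lambda>z. w z * v z) z = w z * (poly Q z * poly s z * deriv v z + (poly r z + poly Q z * poly m z) * v z)"
    unfolding diff_op_def deriv_mult_w[OF assms] q using s by (simp add: algebra_simps)
  then show ?thesis unfolding *[symmetric] by (simp add: algebra_simps)
qed

lemma w_inverse_hol: "(\<lambda>z. 1 / w z) holomorphic_on unit_disk"
  using w_hol w_nz by (intro holomorphic_intros) auto

lemma s_inverse_hol: "(\<lambda>z. 1 / poly s z) holomorphic_on unit_disk"
  using s_nz by (intro holomorphic_intros) auto

lemma B_nonneg: "B \<ge> 0"
  using w_le[of 0] norm_ge_zero order_trans by (metis centre_in_ball zero_less_one)

lemma mult_w_bound:
  obtains K where "K \<ge> 0"
    "\<And>v. disk_L2 v \<Longrightarrow> disk_L2 (deriv v) \<Longrightarrow> disk_L2 (\<lambda>z. w z * v z) \<and> disk_L2 (deriv (\<lambda>z. w z * v z)) \<and>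
      bnorm (\<lambda>z. w z * v z) \<le> K * (bnorm v + bnorm (deriv v)) \<and>
      bnorm (deriv (\<lambda>z. w z * v z)) \<le> K * (bnorm v + bnorm (deriv v))"
proof -
  obtain D where D: "D > 0" "\<And>z. z \<in> cball 0 1 \<Longrightarrow> cmod (poly m z) \<le> D"
    using poly_bounded_disk by blast
  define K where "K = B * (2 * (1 + D * B)) + B"
  have K: "K \<ge> B" "K \<ge> B * (2 * (1 + D * B))" "K \<ge> 0" using B_nonneg D by (auto simp: K_def)
  show ?thesis
  proof (rule that[of K], rule K(3), intro conjI)
    fix v assume v: "disk_L2 v" "disk_L2 (deriv v)"
    then have hol: "v holomorphic_on unit_disk" by (simp add: disk_L2_def)
    note 1 = disk_L2_mult[OF v(1) w_hol w_le]
    show "disk_L2 (\<lambda>z. w z * v z)" by (rule 1)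
    have "bnorm (\<lambda>z. w z * v z) \<le> B * bnorm v" by (rule 1)
    also have "\<dots> \<le> K * (bnorm v + bnorm (deriv v))"
      using K bnorm_nonneg B_nonneg by (intro mult_mono) auto
    finally show "bnorm (\<lambda>z. w z * v z) \<le> K * (bnorm v + bnorm (deriv v))" .
    note 2 = disk_L2_mult[OF v(1) s_inverse_hol sinv_le]
    have 3: "disk_L2 (\<lambda>z. poly m z * (1 / poly s z * v z))"
      "bnorm (\<lambda>z. poly m z * (1 / poly s z * v z)) \<le> D * bnorm (\<lambda>z. 1 / poly s z * v z)"
      using D by (intro disk_L2_mult[OF 2(1), where B = D] holomorphic_intros; auto)+
    note 4 = disk_L2_add[OF v(2) 3(1)]
    note 5 = disk_L2_mult[OF 4(1) w_hol w_le]
    note d = deriv_mult_w[OF hol]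
    show "disk_L2 (deriv (\<lambda>z. w z * v z))" using 5(1) by (subst disk_L2_cong[OF d])
    have "bnorm (deriv (\<lambda>z. w z * v z)) = bnorm (\<lambda>z. w z * (deriv v z + poly m z * (1 / poly s z * v z)))"
      by (rule bnorm_cong[OF d])
    also have "\<dots> \<le> B * bnorm (\<lambda>z. deriv v z + poly m z * (1 / poly s z * v z))" by (rule 5)
    also have "\<dots> \<le> B * (2 * (bnorm (deriv v) + D * (B * bnorm v)))"
    proof (rule mult_left_mono[OF _ B_nonneg])
      have "D * bnorm (\<lambda>z. 1 / poly s z * v z) \<le> D * (B * bnorm v)"
        using 2(2) D by (intro mult_left_mono) auto
      then show "bnorm (\<lambda>z. deriv v z + poly m z * (1 / poly s z * v z)) \<le> 2 * (bnorm (deriv v) + D * (B * bnorm v))"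
        by (intro order_trans[OF 4(2)] mult_left_mono add_left_mono) (rule order_trans[OF 3(2)], simp_all)
    qed
    also have "\<dots> \<le> B * (2 * ((1 + D * B) * (bnorm v + bnorm (deriv v))))"
    proof (intro mult_left_mono B_nonneg)
      have "0 \<le> D * B * bnorm (deriv v)" "0 \<le> bnorm v" using D B_nonneg bnorm_nonneg by auto
      then show "bnorm (deriv v) + D * (B * bnorm v) \<le> (1 + D * B) * (bnorm v + bnorm (deriv v))"
        by (simp add: algebra_simps)
    qed simp
    also have "\<dots> = B * (2 * (1 + D * B)) * (bnorm v + bnorm (deriv v))" by simp
    also have "\<dots> \<le> K * (bnorm v + bnorm (deriv v))"
      using K bnorm_nonneg by (intro mult_right_mono add_nonneg_nonneg) auto
    finally show "bnorm (deriv (\<lambda>z. w z * v z)) \<le> K * (bnorm v + bnorm (deriv v))" .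
  qed
qed

text \<open>Converse to \<open>mult_w_bound\<close>: as \<open>w\<close>, \<open>1 / w\<close> and
  \<open>m / s\<close> are bounded, multiplication by \<open>w\<close> is an isomorphism of the
  space of \<open>u\<close> with \<open>u\<close> and \<open>deriv u\<close> square
  integrable.\<close>

lemma divide_w:
  assumes u: "disk_L2 u" "disk_L2 (deriv u)"
  obtains v where "disk_L2 v" "disk_L2 (deriv v)" "\<And>z. u z = w z * v z"
proof -
  define v where "v z = 1 / w z * u z" for z
  have uv: "u = (\<lambda>z. w z * v z)" using w_nz by (auto simp: v_def)
  have v: "disk_L2 v"
    unfolding v_def[abs_def] by (rule disk_L2_mult(1)[OF u(1) w_inverse_hol winv_le])
  then have hol: "v holomorphic_on unit_disk" by (simp add: disk_L2_def)
  have d: "deriv v z = 1 / w z * deriv u z + poly (- m) z * (1 / poly s z * v z)" if "z \<in> unit_disk" for z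
    using deriv_mult_w[OF hol that] w_nz[of z] unfolding uv[symmetric] by (simp add: field_simps)
  have "disk_L2 (\<lambda>z. 1 / w z * deriv u z + poly (- m) z * (1 / poly s z * v z))"
    by (intro disk_L2_add disk_L2_poly_mult disk_L2_mult(1)[OF u(2) w_inverse_hol winv_le]
        disk_L2_mult(1)[OF v s_inverse_hol sinv_le])
  then have "disk_L2 (deriv v)" by (subst disk_L2_cong[OF d])
  with v show ?thesis using uv by (intro that[of v]) metis+
qed

end

text \<open>Square integrability of the derivative makes \<open>(n + 1) * |v_(n+1)|^2\<close>
  summable. This supplies the bounded coefficients on which
  \<open>bounded_solution_eventually_zero\<close> rests.\<close>

lemma tcoeff_bounded_of_deriv:
  assumes v: "v holomorphic_on unit_disk" "disk_L2 (deriv v)"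
  obtains M where "\<And>n. cmod (tcoeff v n) \<le> M"
proof -
  obtain C where C: "\<And>n. weighted_sq (tcoeff (deriv v)) n \<le> C"
    using summable_imp_Bseq[OF disk_L2_tcoeff(1)[OF v(2)]] by (auto simp: Bseq_def weighted_sq_nonneg)
  have "cmod (tcoeff v n) \<le> cmod (tcoeff v 0) + (1 + C)" for n
  proof (cases n)
    case (Suc k)
    have "weighted_sq (tcoeff (deriv v)) k = (real k + 1) * (cmod (tcoeff v (Suc k)))\<^sup>2"
      unfolding weighted_sq_def tcoeff_deriv[OF v(1)] norm_mult norm_of_nat
      by (simp add: power_mult_distrib power2_eq_square add.commute)
    then have "(real k + 1) * (cmod (tcoeff v (Suc k)))\<^sup>2 \<le> C" using C[of k] by simp
    moreover have "(cmod (tcoeff v (Suc k)))\<^sup>2 \<le> (real k + 1) * (cmod (tcoeff v (Suc k)))\<^sup>2"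
      by (simp add: mult_le_cancel_right1)
    moreover have "cmod (tcoeff v (Suc k)) \<le> 1 + (cmod (tcoeff v (Suc k)))\<^sup>2"
      using sum_squares_bound[of 1 "cmod (tcoeff v (Suc k))"] norm_ge_zero[of "tcoeff v (Suc k)"]
      unfolding power2_eq_square by linarith
    ultimately show ?thesis unfolding Suc using norm_ge_zero[of "tcoeff v 0"] by linarith
  qed (use C[of 0] weighted_sq_nonneg[of "tcoeff (deriv v)" 0] in simp)
  then show ?thesis by (rule that)
qed

lemma ode_fps:
  assumes v: "v holomorphic_on unit_disk" and g: "g holomorphic_on unit_disk"
  shows "(\<forall>z\<in>unit_disk. poly Q z * deriv v z + poly R z * v z = g z) \<longleftrightarrow>
    fps_of_poly Q * fps_deriv (fps_expansion v 0) + fps_of_poly R * fps_expansion v 0 = fps_expansion g 0"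
proof -
  let ?F = "\<lambda>z. poly Q z * deriv v z + poly R z * v z"
  have "?F has_fps_expansion fps_of_poly Q * fps_deriv (fps_expansion v 0) + fps_of_poly R * fps_expansion v 0"
    by (intro fps_expansion_intros disk_has_fps_expansion has_fps_expansion_poly v)
  then have eq: "fps_expansion ?F 0 = fps_of_poly Q * fps_deriv (fps_expansion v 0) + fps_of_poly R * fps_expansion v 0"
    by (rule fps_expansion_eqI)
  have hol: "?F holomorphic_on unit_disk"
    using v by (intro holomorphic_intros) auto
  show ?thesis
  proof
    assume "\<forall>z\<in>unit_disk. ?F z = g z"
    then have "eventually (\<lambda>z. ?F z = g z) (nhds 0)"
      by (intro eventually_mono[OF eventually_nhds_in_open[of unit_disk]]) auto
    then show "fps_of_poly Q * fps_deriv (fps_expansion v 0) + fps_of_poly R * fps_expansion v 0 = fps_expansion g 0"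
      unfolding eq[symmetric] by (rule fps_expansion_cong)
  next
    assume "fps_of_poly Q * fps_deriv (fps_expansion v 0) + fps_of_poly R * fps_expansion v 0 = fps_expansion g 0"
    then show "\<forall>z\<in>unit_disk. ?F z = g z"
      using tcoeff_eq_imp_eq[OF hol g] unfolding eq by blast
  qed
qed

text \<open>Newton interpolation: \<open>R\<close> agrees with \<open>r / s\<close> at the listed
  roots, repeated ones included, and each new root is met by adding a multiple of the product for
  the earlier ones. The condition on \<open>coeff R\<close> also makes sense for the empty list,
  where \<open>R = 0\<close>.\<close>

lemma ex_remainder:
  assumes "\<And>a. a \<in> set as \<Longrightarrow> poly s a \<noteq> 0"
  shows "\<exists>R m. R * s - r = root_poly as * m \<and> (\<forall>i\<ge>length as. coeff R i = 0)"
  using assms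
proof (induction as)
  case Nil
  show ?case by (intro exI[of _ 0] exI[of _ "- r"]) simp
next
  case (Cons a as)
  then obtain R m where Rm: "R * s - r = root_poly as * m" "\<forall>i\<ge>length as. coeff R i = 0" by auto
  define c where "c = - poly m a / poly s a"
  have "poly (m + smult c s) a = 0" using Cons.prems[of a] by (simp add: c_def)
  then obtain m' where m': "m + smult c s = [:- a, 1:] * m'"
    by (auto simp only: poly_eq_0_iff_dvd elim: dvdE)
  have "(R + smult c (root_poly as)) * s - r = (R * s - r) + root_poly as * smult c s"
    by (simp add: algebra_simps)
  also have "\<dots> = root_poly as * (m + smult c s)" by (simp only: Rm distrib_left)
  also have "\<dots> = root_poly (a # as) * m'" by (simp only: m' root_poly_simps mult_ac)
  finally have "(R + smult c (root_poly as)) * s - r = root_poly (a # as) * m'" .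
  moreover have "\<forall>i\<ge>length (a # as). coeff (R + smult c (root_poly as)) i = 0"
    using Rm(2) by (auto simp: coeff_eq_0)
  ultimately show ?case by blast
qed

lemma ex_reduction:
  assumes "1 + pCons 0 r = root_poly as * s" "\<And>z. z \<in> cball 0 1 \<Longrightarrow> poly s z \<noteq> 0"
    and "\<And>a. a \<in> set as \<Longrightarrow> cmod a < 1"
  obtains R m w B where "reduction r (root_poly as) s R m w B" "\<And>i. i \<ge> length as \<Longrightarrow> coeff R i = 0"
proof -
  have "\<And>a. a \<in> set as \<Longrightarrow> poly s a \<noteq> 0" using assms(2,3) by (simp add: less_imp_le)
  then obtain R m where Rm: "R * s - r = root_poly as * m" "\<forall>i\<ge>length as. coeff R i = 0"
    using ex_remainder by blast
  show ?thesis
  proof (rule ex_exponential_factor[OF assms(2), of m])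
    fix w B
    assume "w holomorphic_on unit_disk"
      "\<And>z. z \<in> unit_disk \<Longrightarrow> (w has_field_derivative poly m z / poly s z * w z) (at z)"
      "\<And>z. w z \<noteq> 0" "\<And>z. z \<in> unit_disk \<Longrightarrow> cmod (w z) \<le> B"
      "\<And>z. z \<in> unit_disk \<Longrightarrow> cmod (1 / w z) \<le> B" "\<And>z. z \<in> unit_disk \<Longrightarrow> cmod (1 / poly s z) \<le> B"
    then have "reduction r (root_poly as) s R m w B"
      using assms(1,2) Rm(1) by unfold_locales
    then show ?thesis using that Rm(2) by blast
  qed
qed

section \<open>The spectrum for two or more roots, and for one simple root, in the open disk\<close>

lemma two_roots_in_spectrum:
  assumes q: "1 + pCons 0 (p - [:c:]) = root_poly as * s" and s: "\<And>z. z \<in> cball 0 1 \<Longrightarrow> poly s z \<noteq> 0"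
    and roots: "\<And>a. a \<in> set as \<Longrightarrow> cmod a < 1" and len: "length as = Suc (Suc N)"
  shows "c \<in> bergman_spectrum (toeplitz (\<lambda>z. cnj z + poly p z))"
proof (rule ccontr)
  assume not: "\<not> ?thesis"
  obtain R m w B where "reduction (p - [:c:]) (root_poly as) s R m w B" and R: "\<And>i. i \<ge> length as \<Longrightarrow> coeff R i = 0"
    using ex_reduction[OF q s roots] by blast
  then interpret reduction "p - [:c:]" "root_poly as" s R m w B by simp
  have "degree R \<le> Suc N" using R len by (intro degree_le) auto
  then obtain G where G: "\<And>V M. (\<And>n. cmod (fps_nth V n) \<le> M) \<Longrightarrow>
      fps_of_poly (root_poly as) * fps_deriv V + fps_of_poly R * V \<noteq> fps_of_poly G"
    using ex_unsolvable[OF roots len] by blast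
  have wL: "disk_L2 w" by (rule disk_L2_bounded[OF w_hol w_le])
  \<comment> \<open>This right-hand side becomes exactly the unsolvable polynomial \<open>G\<close>
    once \<open>u = w v\<close> is substituted.\<close>
  have "disk_L2 (\<lambda>z. poly (s * G) z * w z)" by (rule disk_L2_poly_mult[OF wL])
  then obtain u where u: "disk_L2 u" "disk_L2 (deriv u)"
    and eq: "\<And>z. z \<in> unit_disk \<Longrightarrow> diff_op (p - [:c:]) u z = poly (s * G) z * w z"
    using not_in_spectrum_solvable[OF not] by blast
  obtain v where v: "disk_L2 v" "disk_L2 (deriv v)" "\<And>z. u z = w z * v z"
    using divide_w[OF u] by blast
  then have hol: "v holomorphic_on unit_disk" by (simp add: disk_L2_def)
  have uv: "u = (\<lambda>z. w z * v z)" using v(3) by blast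
  have "poly (root_poly as) z * deriv v z + poly R z * v z = poly G z" if z: "z \<in> unit_disk" for z
  proof -
    have "poly s z \<noteq> 0" using z by (intro s) auto
    moreover have "w z * (poly s z * (poly (root_poly as) z * deriv v z + poly R z * v z)) = w z * (poly s z * poly G z)"
      using eq[OF z] unfolding uv diff_op_mult_w[OF hol z] by (simp add: mult_ac)
    ultimately show ?thesis using w_nz[of z] by simp
  qed
  moreover have "fps_expansion (poly G) 0 = fps_of_poly G"
    by (rule fps_expansion_eqI[OF has_fps_expansion_poly])
  ultimately have "fps_of_poly (root_poly as) * fps_deriv (fps_expansion v 0) + fps_of_poly R * fps_expansion v 0 = fps_of_poly G"
    using ode_fps[OF hol poly_holomorphic_on[OF holomorphic_on_ident, of G], of "root_poly as" R] by simp
  moreover obtain M where "\<And>n. cmod (tcoeff v n) \<le> M"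
    using tcoeff_bounded_of_deriv[OF hol v(2)] by blast
  ultimately show False using G by blast
qed

text \<open>With one root, \<open>R\<close> is the constant
  \<open>\<rho> = r(a) / s(a) = - n\<close>, and \<open>(z - a) v' = n v\<close> has the solution
  \<open>(z - a) ^ n\<close>, so \<open>w v\<close> lies in the kernel.\<close>

lemma one_root_natural_in_spectrum:
  assumes q: "1 + pCons 0 (p - [:c:]) = [:- a, 1:] * s" and s: "\<And>z. z \<in> cball 0 1 \<Longrightarrow> poly s z \<noteq> 0"
    and a: "cmod a < 1" and n: "poly (p - [:c:]) a = - of_nat n * poly s a"
  shows "c \<in> bergman_spectrum (toeplitz (\<lambda>z. cnj z + poly p z))"
proof -
  have q': "1 + pCons 0 (p - [:c:]) = root_poly [a] * s" using q by simp
  have roots: "\<And>b. b \<in> set [a] \<Longrightarrow> cmod b < 1" using a by simp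
  obtain R m w B where red: "reduction (p - [:c:]) (root_poly [a]) s R m w B" and R: "\<And>i. i \<ge> length [a] \<Longrightarrow> coeff R i = 0"
    using ex_reduction[OF q' s roots] by blast
  interpret reduction "p - [:c:]" "root_poly [a]" s R m w B by (rule red)
  have sa: "poly s a \<noteq> 0" using a by (intro s) auto
  have "degree R \<le> 0" using R by (intro degree_le) auto
  then obtain \<rho> where \<rho>: "R = [:\<rho>:]" by (metis degree_eq_zeroE le_zero_eq)
  have "\<rho> * poly s a = poly (p - [:c:]) a"
    using arg_cong[OF Rm, of "\<lambda>p. poly p a"] by (simp add: \<rho>)
  then have "\<rho> * poly s a = - of_nat n * poly s a" using n by simp
  then have \<rho>n: "\<rho> = - of_nat n" using sa by (metis mult_right_cancel)
  define v where "v z = (z - a) ^ n" for z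
  have D: "(v has_field_derivative of_nat n * (z - a) ^ (n - 1)) (at z)" for z
    unfolding v_def by (auto intro!: derivative_eq_intros)
  have d: "deriv v = (\<lambda>z. of_nat n * (z - a) ^ (n - 1))" using DERIV_imp_deriv[OF D] by blast
  have hol: "v holomorphic_on unit_disk" unfolding v_def by (intro holomorphic_intros)
  have v: "disk_L2 v" "disk_L2 (deriv v)"
  proof -
    have *: "cmod (z - a) \<le> 2" if "z \<in> unit_disk" for z
      using that a norm_triangle_ineq4[of z a] by simp
    show "disk_L2 v"
      by (rule disk_L2_bounded[OF hol, of "2 ^ n"]) (auto simp: v_def norm_power intro!: power_mono *)
    have "disk_L2 (\<lambda>z. (z - a) ^ (n - 1))"
      by (rule disk_L2_bounded[of _ "2 ^ (n - 1)"]) (auto simp: norm_power intro!: power_mono * holomorphic_intros)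
    then show "disk_L2 (deriv v)" unfolding d by (rule disk_L2_cmult)
  qed
  obtain K where "disk_L2 (\<lambda>z. w z * v z) \<and> disk_L2 (deriv (\<lambda>z. w z * v z))"
    using mult_w_bound v by metis
  moreover have "diff_op (p - [:c:]) (\<lambda>z. w z * v z) z = 0" if z: "z \<in> unit_disk" for z
  proof -
    have "(z - a) * deriv v z = of_nat n * v z" unfolding d v_def by (cases n) auto
    then show ?thesis unfolding diff_op_mult_w[OF hol z] \<rho> \<rho>n by (simp add: algebra_simps)
  qed
  \<comment> \<open>The eigenvector is \<open>u + z u'\<close>, with coefficients
    \<open>(k + 1) * tcoeff u k\<close>; if it vanished, so would \<open>u = w v\<close>, which is
    nonzero away from \<open>a\<close>.\<close>
  moreover have "\<exists>z\<in>unit_disk. (w z * v z) + z * deriv (\<lambda>z. w z * v z) z \<noteq> 0"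
  proof (rule ccontr)
    assume "\<not> ?thesis"
    then have *: "(w z * v z) + z * deriv (\<lambda>z. w z * v z) z = 0" if "z \<in> unit_disk" for z using that by blast
    have holu: "(\<lambda>z. w z * v z) holomorphic_on unit_disk" by (intro holomorphic_intros w_hol hol)
    have "tcoeff (\<lambda>z. w z * v z + z * deriv (\<lambda>z. w z * v z) z) k = tcoeff (\<lambda>_. 0) k" for k
      using fps_expansion_cong[of "\<lambda>z. w z * v z + z * deriv (\<lambda>z. w z * v z) z" "\<lambda>_. 0" 0] *
      by (metis (mono_tags, lifting) centre_in_ball eventually_nhds open_ball zero_less_one)
    moreover have "tcoeff (\<lambda>_. 0) k = 0" for k
      using fps_expansion_eqI[OF has_fps_expansion_0] by (metis fps_zero_nth)
    ultimately have "tcoeff (\<lambda>z. w z * v z) k = 0" for k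
      using tcoeff_deriv_times[OF holu, of k] by (simp del: of_nat_Suc of_nat_add add: of_nat_eq_0_iff)
    then have wv: "w z * v z = 0" if "z \<in> unit_disk" for z
      using tcoeff_sums[OF holu that] by (simp add: sums_iff)
    have "z = a" if "z \<in> unit_disk" for z
      using wv[OF that] w_nz[of z] by (simp add: v_def)
    from this[of 0] this[of "1/2"] show False by (simp add: norm_divide)
  qed
  ultimately show ?thesis using kernel_in_spectrum by blast
qed

text \<open>Comparing coefficients turns \<open>(z - a) v' + \<rho> v = g\<close> into the backward
  recurrence. Its bound on the sum of \<open>(n + 1) * |v_n|^2\<close> controls \<open>v\<close> and
  \<open>deriv v\<close> at once.\<close>

lemma ex_linear_ode_solution:
  fixes a \<rho> :: complex
  assumes a: "cmod a < 1" and \<rho>: "\<And>n. of_nat n + \<rho> \<noteq> 0"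
  obtains C where "C \<ge> 0"
    "\<And>g. disk_L2 g \<Longrightarrow> \<exists>v. disk_L2 v \<and> disk_L2 (deriv v) \<and>
      (\<forall>z\<in>unit_disk. poly [:- a, 1:] z * deriv v z + poly [:\<rho>:] z * v z = g z) \<and>
      bnorm v \<le> C * bnorm g \<and> bnorm (deriv v) \<le> C * bnorm g"
proof -
  obtain K where K: "K \<ge> 0"
    "\<And>G. summable (weighted_sq G) \<Longrightarrow> \<exists>v. (\<forall>n. (of_nat n + \<rho>) * v n = G n + a * of_nat (n + 1) * v (n + 1)) \<and>
      (\<forall>M. (\<Sum>n<M. (real n + 1) * (cmod (v n))\<^sup>2) \<le> K * (\<Sum>n. weighted_sq G n))"
    using ex_backward_solution[OF assms] by blast
  show ?thesis
  proof (rule that[of "sqrt K"])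
    fix g assume g: "disk_L2 g"
    then have holg: "g holomorphic_on unit_disk" by (simp add: disk_L2_def)
    note sg = disk_L2_tcoeff[OF g]
    obtain b where b: "\<And>n. (of_nat n + \<rho>) * b n = tcoeff g n + a * of_nat (n + 1) * b (n + 1)"
      and bound: "\<And>M. (\<Sum>n<M. (real n + 1) * (cmod (b n))\<^sup>2) \<le> K * (bnorm g)\<^sup>2"
      using K(2)[OF sg(1)] unfolding sg(2)[symmetric] by blast
    have sm: "summable (\<lambda>n. (real n + 1) * (cmod (b n))\<^sup>2)"
      by (rule summableI_nonneg_bounded[OF _ bound]) simp
    have tot: "(\<Sum>n. (real n + 1) * (cmod (b n))\<^sup>2) \<le> K * (bnorm g)\<^sup>2"
      by (rule suminf_le_const[OF sm bound])
    have w1: "weighted_sq b n \<le> (real n + 1) * (cmod (b n))\<^sup>2" for n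
    proof -
      have "1 \<le> (real n + 1) * (real n + 1)" by (simp add: algebra_simps)
      then have "(cmod (b n))\<^sup>2 * 1 \<le> (cmod (b n))\<^sup>2 * ((real n + 1) * (real n + 1))"
        by (intro mult_left_mono) auto
      then show ?thesis by (simp add: weighted_sq_def divide_le_eq mult_ac add_nonneg_pos)
    qed
    have sb: "summable (weighted_sq b)"
      using w1 by (intro summable_comparison_test'[OF sm, of 0]) (simp add: weighted_sq_nonneg)
    obtain v where v: "disk_L2 v" "\<And>n. tcoeff v n = b n" "(bnorm v)\<^sup>2 = (\<Sum>n. weighted_sq b n)"
      using ex_disk_L2_tcoeff[OF sb] by blast
    then have hol: "v holomorphic_on unit_disk" "deriv v holomorphic_on unit_disk"
      by (auto simp: disk_L2_def intro!: holomorphic_deriv)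
    have w2: "weighted_sq (tcoeff (deriv v)) n \<le> (real (Suc n) + 1) * (cmod (b (Suc n)))\<^sup>2" for n
    proof -
      have "weighted_sq (tcoeff (deriv v)) n = (real n + 1) * (cmod (b (Suc n)))\<^sup>2"
        unfolding weighted_sq_def tcoeff_deriv[OF hol(1)] norm_mult norm_of_nat v(2)
        by (simp add: power_mult_distrib power2_eq_square add.commute)
      also have "\<dots> \<le> (real (Suc n) + 1) * (cmod (b (Suc n)))\<^sup>2" by (intro mult_right_mono) auto
      finally show ?thesis .
    qed
    have sm': "summable (\<lambda>n. (real (Suc n) + 1) * (cmod (b (Suc n)))\<^sup>2)"
      using sm by (subst summable_Suc_iff[of "\<lambda>n. (real n + 1) * (cmod (b n))\<^sup>2"])
    have sd: "summable (weighted_sq (tcoeff (deriv v)))"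
      using w2 by (intro summable_comparison_test'[OF sm', of 0]) (simp add: weighted_sq_nonneg)
    have dv: "disk_L2 (deriv v)" by (rule disk_L2I_tcoeff[OF hol(2) sd])
    have "(bnorm v)\<^sup>2 \<le> K * (bnorm g)\<^sup>2"
      unfolding v(3) using suminf_le[OF w1 sb sm] tot by linarith
    moreover have "(bnorm (deriv v))\<^sup>2 \<le> K * (bnorm g)\<^sup>2"
    proof -
      have "(bnorm (deriv v))\<^sup>2 \<le> (\<Sum>n. (real (Suc n) + 1) * (cmod (b (Suc n)))\<^sup>2)"
        unfolding disk_L2_tcoeff(2)[OF dv] by (rule suminf_le[OF w2 sd sm'])
      also have "\<dots> \<le> (\<Sum>n. (real n + 1) * (cmod (b n))\<^sup>2)"
        using suminf_split_head[OF sm] by simp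
      finally show ?thesis using tot by linarith
    qed
    moreover have "x \<le> sqrt K * bnorm g" if "x\<^sup>2 \<le> K * (bnorm g)\<^sup>2" for x
    proof (rule power2_le_imp_le)
      show "x\<^sup>2 \<le> (sqrt K * bnorm g)\<^sup>2" using that K(1) by (simp add: power_mult_distrib)
    qed (use K(1) bnorm_nonneg in simp)
    moreover have "\<forall>z\<in>unit_disk. poly [:- a, 1:] z * deriv v z + poly [:\<rho>:] z * v z = g z"
      unfolding ode_fps[OF hol(1) holg]
    proof (rule fps_ext)
      fix n
      let ?V = "fps_expansion v 0"
      have "fps_nth (fps_of_poly [:- a, 1:] * fps_deriv ?V + fps_of_poly [:\<rho>:] * ?V) n
        = of_nat n * b n - a * (of_nat (n + 1) * b (n + 1)) + \<rho> * b n"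
        by (cases n) (simp_all add: fps_of_poly_linear fps_of_poly_const distrib_right v(2) del: of_nat_Suc)
      also have "\<dots> = tcoeff g n" using b[of n] by (simp add: algebra_simps)
      finally show "fps_nth (fps_of_poly [:- a, 1:] * fps_deriv ?V + fps_of_poly [:\<rho>:] * ?V) n = tcoeff g n" .
    qed
    ultimately show "\<exists>v. disk_L2 v \<and> disk_L2 (deriv v) \<and>
      (\<forall>z\<in>unit_disk. poly [:- a, 1:] z * deriv v z + poly [:\<rho>:] z * v z = g z) \<and>
      bnorm v \<le> sqrt K * bnorm g \<and> bnorm (deriv v) \<le> sqrt K * bnorm g"
      using v(1) dv by blast
  qed (use K in simp)
qed

text \<open>A solution with bounded coefficients is a polynomial, and its top coefficient would be
  multiplied by \<open>degree V + \<rho>\<close>, which is not zero.\<close>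

lemma linear_ode_unique:
  assumes a: "cmod a < 1" and \<rho>: "\<And>n. of_nat n + \<rho> \<noteq> 0"
    and v: "v holomorphic_on unit_disk" "disk_L2 (deriv v)"
    and eq: "\<forall>z\<in>unit_disk. poly [:- a, 1:] z * deriv v z + poly [:\<rho>:] z * v z = 0"
    and z: "z \<in> unit_disk"
  shows "v z = 0"
proof -
  let ?V = "fps_expansion v 0"
  have "fps_expansion (\<lambda>_. 0) 0 = (0 :: complex fps)" by (rule fps_expansion_eqI[OF has_fps_expansion_0])
  then have "fps_of_poly [:- a, 1:] * fps_deriv ?V + fps_of_poly [:\<rho>:] * ?V = fps_of_poly 0"
    using ode_fps[OF v(1), of "\<lambda>_. 0" "[:- a, 1:]" "[:\<rho>:]"] eq by simp
  then have e: "fps_of_poly (root_poly [a]) * fps_deriv ?V + fps_of_poly [:\<rho>:] * ?V = fps_of_poly 0" by simp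
  obtain M where M: "\<And>n. cmod (tcoeff v n) \<le> M" using tcoeff_bounded_of_deriv[OF v] by blast
  have "\<exists>n0. \<forall>n\<ge>n0. tcoeff v n = 0"
    using a by (intro bounded_solution_eventually_zero[OF _ _ _ M e, of 0]) auto
  then obtain V where V: "?V = fps_of_poly V" using eventually_zero_fps_poly by blast
  have "fps_of_poly (root_poly [a] * pderiv V + [:\<rho>:] * V) = fps_of_poly 0"
    using e unfolding V by (simp only: fps_of_poly_add fps_of_poly_mult fps_of_poly_pderiv)
  then have "root_poly [a] * pderiv V + [:\<rho>:] * V = 0" by (simp only: fps_of_poly_eq_iff)
  then have "(of_nat (degree V) + coeff [:\<rho>:] 0) * lead_coeff V = 0"
    using ode_top_coeff(1)[of "[a]" 0 "[:\<rho>:]" V] by (simp del: root_poly_simps)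
  then have "V = 0" using \<rho>[of "degree V"] by simp
  then show ?thesis using tcoeff_sums[OF v(1) z] V by (simp add: sums_iff)
qed

lemma one_root_not_in_spectrum:
  assumes q: "1 + pCons 0 (p - [:c:]) = [:- a, 1:] * s" and s: "\<And>z. z \<in> cball 0 1 \<Longrightarrow> poly s z \<noteq> 0"
    and a: "cmod a < 1" and n: "\<And>n. poly (p - [:c:]) a \<noteq> - of_nat n * poly s a"
  shows "c \<notin> bergman_spectrum (toeplitz (\<lambda>z. cnj z + poly p z))"
proof -
  have q': "1 + pCons 0 (p - [:c:]) = root_poly [a] * s" using q by simp
  have roots: "\<And>b. b \<in> set [a] \<Longrightarrow> cmod b < 1" using a by simp
  obtain R m w B where red: "reduction (p - [:c:]) (root_poly [a]) s R m w B" and R: "\<And>i. i \<ge> length [a] \<Longrightarrow> coeff R i = 0"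
    using ex_reduction[OF q' s roots] by blast
  interpret reduction "p - [:c:]" "root_poly [a]" s R m w B by (rule red)
  have Qa: "root_poly [a] = [:- a, 1:]" by simp
  have "degree R \<le> 0" using R by (intro degree_le) auto
  then obtain \<rho> where \<rho>: "R = [:\<rho>:]" by (metis degree_eq_zeroE le_zero_eq)
  have \<rho>a: "\<rho> * poly s a = poly (p - [:c:]) a"
    using arg_cong[OF Rm, of "\<lambda>p. poly p a"] by (simp add: \<rho>)
  have \<rho>n: "of_nat k + \<rho> \<noteq> 0" for k
  proof
    assume "of_nat k + \<rho> = 0"
    then have "\<rho> = - of_nat k" by (simp add: add_eq_0_iff)
    then show False using n[of k] \<rho>a by metis
  qed
  obtain C where C: "C \<ge> 0" "\<And>g. disk_L2 g \<Longrightarrow> \<exists>v. disk_L2 v \<and> disk_L2 (deriv v) \<and>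
      (\<forall>z\<in>unit_disk. poly [:- a, 1:] z * deriv v z + poly [:\<rho>:] z * v z = g z) \<and>
      bnorm v \<le> C * bnorm g \<and> bnorm (deriv v) \<le> C * bnorm g"
    using ex_linear_ode_solution[OF a \<rho>n] by blast
  obtain K where K: "K \<ge> 0"
    "\<And>v. disk_L2 v \<Longrightarrow> disk_L2 (deriv v) \<Longrightarrow> disk_L2 (\<lambda>z. w z * v z) \<and> disk_L2 (deriv (\<lambda>z. w z * v z)) \<and>
      bnorm (\<lambda>z. w z * v z) \<le> K * (bnorm v + bnorm (deriv v)) \<and>
      bnorm (deriv (\<lambda>z. w z * v z)) \<le> K * (bnorm v + bnorm (deriv v))"
    using mult_w_bound by blast
  show ?thesis
  proof (rule not_in_spectrumI[where C = "K * (2 * (C * (B * B)))"])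
    fix u z assume u: "disk_L2 u" "disk_L2 (deriv u)"
      and 0: "\<And>z. z \<in> unit_disk \<Longrightarrow> diff_op (p - [:c:]) u z = 0" and z: "z \<in> unit_disk"
    obtain v where v: "disk_L2 v" "disk_L2 (deriv v)" "\<And>z. u z = w z * v z"
      using divide_w[OF u] by blast
    then have hol: "v holomorphic_on unit_disk" by (simp add: disk_L2_def)
    have uv: "u = (\<lambda>z. w z * v z)" using v(3) by blast
    have "poly [:- a, 1:] z * deriv v z + poly [:\<rho>:] z * v z = 0" if z: "z \<in> unit_disk" for z
    proof -
      have "poly s z \<noteq> 0" using z by (intro s) auto
      moreover have "w z * (poly s z * (poly [:- a, 1:] z * deriv v z + poly [:\<rho>:] z * v z)) = 0"
        using 0[OF z] unfolding uv diff_op_mult_w[OF hol z] by (simp only: Qa \<rho>)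
      ultimately show ?thesis using w_nz[of z] by (simp only: mult_eq_0_iff) simp
    qed
    then have "v z = 0" using linear_ode_unique[OF a \<rho>n hol v(2) _ z] by blast
    then show "u z = 0" by (simp add: v(3))
  next
    fix g assume g: "disk_L2 g"
    note 1 = disk_L2_mult[OF g s_inverse_hol sinv_le]
    note 2 = disk_L2_mult[OF 1(1) w_inverse_hol winv_le]
    let ?g = "\<lambda>z. 1 / w z * (1 / poly s z * g z)"
    obtain v where v: "disk_L2 v" "disk_L2 (deriv v)"
      "\<forall>z\<in>unit_disk. poly [:- a, 1:] z * deriv v z + poly [:\<rho>:] z * v z = ?g z"
      and b: "bnorm v \<le> C * bnorm ?g" "bnorm (deriv v) \<le> C * bnorm ?g"
      using C(2)[OF 2(1)] by blast
    then have hol: "v holomorphic_on unit_disk" by (simp add: disk_L2_def)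
    have "bnorm ?g \<le> B * bnorm (\<lambda>z. 1 / poly s z * g z)" by (rule 2)
    also have "\<dots> \<le> B * (B * bnorm g)" by (intro mult_left_mono 1 B_nonneg)
    finally have "C * bnorm ?g \<le> C * (B * (B * bnorm g))" by (rule mult_left_mono[OF _ C(1)])
    then have "bnorm v + bnorm (deriv v) \<le> 2 * (C * (B * (B * bnorm g)))" using b by linarith
    from mult_left_mono[OF this K(1)] have le: "K * (bnorm v + bnorm (deriv v)) \<le> K * (2 * (C * (B * B))) * bnorm g"
      by (simp only: mult_ac)
    have "diff_op (p - [:c:]) (\<lambda>z. w z * v z) z = g z" if z: "z \<in> unit_disk" for z
    proof -
      have "poly s z \<noteq> 0" using z by (intro s) auto
      have "poly [:- a, 1:] z * deriv v z + poly [:\<rho>:] z * v z = ?g z" using v(3) z by blast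
      then have "diff_op (p - [:c:]) (\<lambda>z. w z * v z) z = w z * (poly s z * ?g z)"
        unfolding diff_op_mult_w[OF hol z] by (simp only: Qa \<rho>)
      then show ?thesis using w_nz[of z] \<open>poly s z \<noteq> 0\<close> by simp
    qed
    then show "\<exists>u. disk_L2 u \<and> disk_L2 (deriv u) \<and> (\<forall>z\<in>unit_disk. diff_op (p - [:c:]) u z = g z) \<and>
        bnorm u \<le> K * (2 * (C * (B * B))) * bnorm g \<and> bnorm (deriv u) \<le> K * (2 * (C * (B * B))) * bnorm g"
      using K(2)[OF v(1,2)] le by (intro exI[of _ "\<lambda>z. w z * v z"]) (auto intro: order_trans)
  qed
qed

section \<open>Isolated points of the spectrum\<close>

definition shifted_poly :: "complex poly \<Rightarrow> complex \<Rightarrow> complex poly" where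
  "shifted_poly p c = 1 + pCons 0 (p - [:c:])"

text \<open>The function \<open>E\<close> of the overview; passing from \<open>p\<close> to
  \<open>p - [:c:]\<close> would not change it.\<close>

definition exponent_poly :: "complex poly \<Rightarrow> complex poly" where
  "exponent_poly p = pCons 0 (pderiv (1 + pCons 0 p)) - (1 + pCons 0 p)"

abbreviation toeplitz_spectrum :: "complex poly \<Rightarrow> complex set" where
  "toeplitz_spectrum p \<equiv> bergman_spectrum (toeplitz (\<lambda>z. cnj z + poly p z))"

lemma poly_shifted_poly: "poly (shifted_poly p c) z = 1 + z * (poly p z - c)"
  by (simp add: shifted_poly_def)

lemma shifted_poly_nonzero: "shifted_poly p c \<noteq> 0"
proof
  assume "shifted_poly p c = 0"
  then have "poly (shifted_poly p c) 0 = 0" by simp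
  then show False by (simp add: poly_shifted_poly)
qed

lemma finite_roots_shifted_poly: "finite {z. poly (shifted_poly p c) z = 0}"
  using poly_roots_finite[OF shifted_poly_nonzero] .

lemma shifted_poly_root_iff:
  "poly (shifted_poly p c) z = 0 \<longleftrightarrow> z \<noteq> 0 \<and> c = 1 / z + poly p z"
proof (cases "z = 0")
  case False
  have "poly (shifted_poly p c) z = z * (1 / z + poly p z - c)"
    using False by (simp add: poly_shifted_poly algebra_simps)
  then show ?thesis using False by auto
qed (simp add: poly_shifted_poly)

text \<open>\<open>s a\<close> is the derivative of \<open>shifted_poly p c\<close> at its root
  \<open>a\<close>. The two identities give \<open>\<rho> = r(a) / s(a) = - 1 / E(a)\<close> for the
  reduced equation when \<open>E(a)\<close> is nonzero.\<close>

lemma exponent_at_root: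
  assumes "shifted_poly p c = [:- a, 1:] * s"
  shows "a * poly s a = poly (exponent_poly p) a" and "a * poly (p - [:c:]) a = - 1"
proof -
  have "poly (shifted_poly p c) a = 0" using assms by simp
  then have r: "1 + a * (poly p a - c) = 0" by (simp add: poly_shifted_poly)
  then show "a * poly (p - [:c:]) a = - 1" by (simp add: add_eq_0_iff)
  have "shifted_poly p c = (1 + pCons 0 p) - [:0, c:]" by (simp add: shifted_poly_def)
  then have "poly (pderiv (shifted_poly p c)) a = poly (pderiv (1 + pCons 0 p)) a - c"
    by (simp only: pderiv_diff poly_diff) (simp add: pderiv_pCons)
  moreover have "poly (pderiv (shifted_poly p c)) a = poly s a"
    unfolding assms pderiv_mult by (simp add: pderiv_pCons)
  ultimately have "poly s a = poly (pderiv (1 + pCons 0 p)) a - c" by simp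
  then have "a * poly s a = a * poly (pderiv (1 + pCons 0 p)) a - a * c" by (simp only: right_diff_distrib)
  then show "a * poly s a = poly (exponent_poly p) a"
    using r by (simp add: exponent_poly_def algebra_simps)
qed

lemma poly_factor_disk_roots:
  fixes q :: "complex poly"
  assumes "q \<noteq> 0"
  shows "\<exists>as s. q = root_poly as * s \<and> (\<forall>a\<in>set as. cmod a < 1) \<and> (\<forall>z. cmod z < 1 \<longrightarrow> poly s z \<noteq> 0)"
  using assms
proof (induction "degree q" arbitrary: q rule: less_induct)
  case less
  show ?case
  proof (cases "\<exists>a. cmod a < 1 \<and> poly q a = 0")
    case True
    then obtain a q' where a: "cmod a < 1" and q': "q = [:- a, 1:] * q'"
      by (auto simp only: poly_eq_0_iff_dvd elim: dvdE)
    then have "q' \<noteq> 0" using less.prems by auto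
    then have "degree q = Suc (degree q')" unfolding q' by (subst degree_mult_eq) auto
    then obtain as s where "q' = root_poly as * s" "\<forall>a\<in>set as. cmod a < 1" "\<forall>z. cmod z < 1 \<longrightarrow> poly s z \<noteq> 0"
      using less.hyps[of q'] \<open>q' \<noteq> 0\<close> by auto
    then show ?thesis
      using a q' by (intro exI[of _ "a # as"] exI[of _ s]) (auto simp del: mult_pCons_left simp: mult.assoc)
  next
    case False
    then show ?thesis by (intro exI[of _ "[]"] exI[of _ q]) auto
  qed
qed

lemma circle_in_spectrum:
  "cmod z = 1 \<Longrightarrow> poly (shifted_poly p c) z = 0 \<Longrightarrow> c \<in> toeplitz_spectrum p"
  unfolding shifted_poly_def by (rule circle_root_in_spectrum)

text \<open>A root on the circle settles the claim. Otherwise the factor left after removing the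
  roots in the open disk is zero-free on the closed disk.\<close>

lemma distinct_roots_in_spectrum:
  assumes "a \<noteq> b" "cmod a < 1" "cmod b < 1" "poly (shifted_poly p c) a = 0" "poly (shifted_poly p c) b = 0"
  shows "c \<in> toeplitz_spectrum p"
proof (cases "\<exists>z. cmod z = 1 \<and> poly (shifted_poly p c) z = 0")
  case False
  obtain as s where q: "shifted_poly p c = root_poly as * s" and as: "\<forall>a\<in>set as. cmod a < 1"
    and s: "\<forall>z. cmod z < 1 \<longrightarrow> poly s z \<noteq> 0"
    using poly_factor_disk_roots[OF shifted_poly_nonzero] by blast
  have root: "poly (root_poly xs) z = 0 \<longleftrightarrow> z \<in> set xs" for xs z
    by (induction xs) (auto simp: algebra_simps)
  have "a \<in> set as" "b \<in> set as"
    using assms s by (auto simp: q root)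
  then have "card {a, b} \<le> card (set as)" by (intro card_mono) auto
  then have "length as \<ge> 2" using assms(1) card_length[of as] by simp
  then obtain N where N: "length as = Suc (Suc N)" by (metis add_2_eq_Suc le_Suc_ex)
  have "poly s z \<noteq> 0" if "z \<in> cball 0 1" for z
    using that s False by (cases "cmod z < 1") (auto simp: q less_le)
  then show ?thesis
    using two_roots_in_spectrum[OF _ _ _ N, of p c s] q as unfolding shifted_poly_def by blast
qed (use circle_in_spectrum in blast)

text \<open>\<open>E a \<noteq> 0\<close> says that the root is simple, so the cofactor
  \<open>s\<close> is zero-free on the closed disk and the one-root results apply with
  \<open>\<rho> = - 1 / E(a)\<close>.\<close>

lemma unique_root_spectrum_iff:
  assumes a: "cmod a < 1" and root: "poly (shifted_poly p c) a = 0"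
    and uniq: "\<And>z. z \<in> cball 0 1 \<Longrightarrow> poly (shifted_poly p c) z = 0 \<Longrightarrow> z = a"
    and E: "poly (exponent_poly p) a \<noteq> 0"
  shows "c \<in> toeplitz_spectrum p \<longleftrightarrow> (\<exists>n. of_nat n * poly (exponent_poly p) a = 1)"
proof -
  obtain s where s: "shifted_poly p c = [:- a, 1:] * s"
    using root by (auto simp only: poly_eq_0_iff_dvd elim: dvdE)
  note ex = exponent_at_root[OF s]
  have s_nz: "poly s z \<noteq> 0" if "z \<in> cball 0 1" for z
  proof
    assume "poly s z = 0"
    then have "z = a" using uniq[OF that] by (simp add: s)
    then show False using \<open>poly s z = 0\<close> ex(1) E by simp
  qed
  have a0: "a \<noteq> 0" using ex(2) by auto
  have iff: "poly (p - [:c:]) a = - of_nat n * poly s a \<longleftrightarrow> of_nat n * poly (exponent_poly p) a = 1" for n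
  proof -
    have "poly (p - [:c:]) a = - of_nat n * poly s a \<longleftrightarrow> a * poly (p - [:c:]) a = a * (- of_nat n * poly s a)"
      using a0 by (simp only: mult_left_cancel not_False_eq_True)
    also have "\<dots> \<longleftrightarrow> - 1 = - (of_nat n * (a * poly s a))" unfolding ex(2) by (simp add: mult_ac)
    finally show ?thesis unfolding ex(1) by (metis neg_equal_iff_equal)
  qed
  show ?thesis
  proof
    assume "c \<in> toeplitz_spectrum p"
    then show "\<exists>n. of_nat n * poly (exponent_poly p) a = 1"
      using one_root_not_in_spectrum[OF s[unfolded shifted_poly_def] s_nz a] iff by blast
  next
    assume "\<exists>n. of_nat n * poly (exponent_poly p) a = 1"
    then show "c \<in> toeplitz_spectrum p"
      using one_root_natural_in_spectrum[OF s[unfolded shifted_poly_def] s_nz a] iff by blast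
  qed
qed

section \<open>Spectral values that cannot be isolated\<close>

text \<open>Points of the circle near \<open>z0\<close> are sent by \<open>h\<close> to spectral
  values near \<open>c\<close>. There are infinitely many such values, since each fibre of
  \<open>h\<close> consists of roots of one nonzero polynomial.\<close>

lemma circle_root_limit_point:
  assumes z0: "cmod z0 = 1" "poly (shifted_poly p c) z0 = 0"
  shows "c islimpt toeplitz_spectrum p"
  unfolding islimpt_eq_infinite_ball
proof (intro allI impI)
  fix e :: real assume e: "e > 0"
  define h where "h z = 1 / z + poly p z" for z
  have "z0 \<noteq> 0" using z0 by auto
  then have "isCont h z0" unfolding h_def by (intro continuous_intros) auto
  moreover have "h z0 = c" using z0 by (simp add: h_def shifted_poly_root_iff)
  ultimately obtain d where d: "d > 0" "\<And>z. dist z z0 < d \<Longrightarrow> dist (h z) c < e"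
    using e unfolding continuous_at_eps_delta by (metis dist_commute)
  have "connected (sphere (0::complex) 1)" by (rule connected_sphere) simp
  moreover have "z0 \<in> sphere 0 1" "- z0 \<in> sphere 0 1" "- z0 \<noteq> z0" using z0 \<open>z0 \<noteq> 0\<close> by auto
  ultimately have "z0 islimpt sphere 0 1"
    by (intro connected_imp_perfect) (auto simp del: mem_sphere mem_sphere_0)
  then have inf: "infinite (sphere 0 1 \<inter> ball z0 d)" using d(1) by (simp add: islimpt_eq_infinite_ball)
  have fin: "finite (h -` {y} \<inter> (sphere 0 1 \<inter> ball z0 d))" for y
    by (rule finite_subset[OF _ finite_roots_shifted_poly[of p y]]) (auto simp: shifted_poly_root_iff h_def)
  then have "infinite (h ` (sphere 0 1 \<inter> ball z0 d))"
    using inf_img_fin_dom'[OF _ inf, of h] by blast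
  moreover have "h ` (sphere 0 1 \<inter> ball z0 d) \<subseteq> toeplitz_spectrum p \<inter> ball c e"
  proof clarify
    fix z assume z: "z \<in> sphere 0 1" "z \<in> ball z0 d"
    have "poly (shifted_poly p (h z)) z = 0" using z by (auto simp: shifted_poly_root_iff h_def)
    then show "h z \<in> toeplitz_spectrum p \<inter> ball c e"
      using z circle_in_spectrum[of z] d(2)[of z] by (simp add: dist_commute)
  qed
  ultimately show "infinite (toeplitz_spectrum p \<inter> ball c e)" using finite_subset by blast
qed

text \<open>Changing \<open>c\<close> to \<open>c'\<close> alters the polynomial by
  \<open>(c' - c) z\<close> up to sign, which on the closed disk is smaller than its minimum modulus
  for \<open>c'\<close> near \<open>c\<close>.\<close>

lemma no_root_limit_point:
  assumes "\<And>z. z \<in> cball 0 1 \<Longrightarrow> poly (shifted_poly p c) z \<noteq> 0"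
  shows "c islimpt toeplitz_spectrum p"
proof -
  have "\<exists>x\<in>cball 0 1. \<forall>z\<in>cball 0 1. cmod (poly (shifted_poly p c) x) \<le> cmod (poly (shifted_poly p c) z)"
    by (intro continuous_attains_inf continuous_intros) auto
  then obtain x where x: "x \<in> cball 0 1"
    "\<And>z. z \<in> cball 0 1 \<Longrightarrow> cmod (poly (shifted_poly p c) x) \<le> cmod (poly (shifted_poly p c) z)" by blast
  define m where "m = cmod (poly (shifted_poly p c) x)"
  have m: "m > 0" using assms[OF x(1)] by (simp add: m_def)
  have "ball c m \<subseteq> toeplitz_spectrum p"
  proof
    fix c' assume c': "c' \<in> ball c m"
    have "poly (shifted_poly p c') z \<noteq> 0" if z: "z \<in> cball 0 1" for z
    proof
      assume "poly (shifted_poly p c') z = 0"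
      then have "poly (shifted_poly p c) z = (c' - c) * z" by (simp add: poly_shifted_poly algebra_simps)
      then have "m \<le> cmod (c' - c) * cmod z" using x(2)[OF z] by (simp add: m_def norm_mult)
      also have "\<dots> \<le> cmod (c' - c)" using z by (simp add: mult_left_le)
      finally show False using c' by (simp add: dist_norm norm_minus_commute)
    qed
    then show "c' \<in> toeplitz_spectrum p" unfolding shifted_poly_def by (rule no_root_in_spectrum)
  qed
  then have "c \<in> interior (toeplitz_spectrum p)" using m by (meson centre_in_ball mem_interior)
  then show ?thesis by (rule interior_limit_point)
qed

lemma open_image_symbol:
  assumes "0 \<notin> ball (a::complex) e" "e > 0"
  shows "open ((\<lambda>z. 1 / z + poly p z) ` ball a e)"
proof (rule open_mapping_thm[of _ "ball a e"])
  show "(\<lambda>z. 1 / z + poly p z) holomorphic_on ball a e"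
    using assms by (intro holomorphic_intros) auto
  show "\<not> (\<lambda>z. 1 / z + poly p z) constant_on ball a e"
  proof
    assume "(\<lambda>z. 1 / z + poly p z) constant_on ball a e"
    then obtain y where "\<And>z. z \<in> ball a e \<Longrightarrow> 1 / z + poly p z = y" by (auto simp: constant_on_def)
    then have "ball a e \<subseteq> {z. poly (shifted_poly p y) z = 0}"
      using assms by (auto simp: shifted_poly_root_iff)
    then have "finite (ball a e)" using finite_roots_shifted_poly finite_subset by blast
    then show False using assms(2) finite_imp_not_open[of "ball a e"] by simp
  qed
qed auto

text \<open>By the open mapping theorem \<open>h\<close> takes all values near \<open>c\<close> both
  near \<open>a\<close> and near \<open>b\<close>, so neighbouring parameters still have two
  roots.\<close>

lemma distinct_roots_limit_point:
  assumes "a \<noteq> b" "cmod a < 1" "cmod b < 1" "poly (shifted_poly p c) a = 0" "poly (shifted_poly p c) b = 0"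
  shows "c islimpt toeplitz_spectrum p"
proof -
  define h where "h z = 1 / z + poly p z" for z
  have ab: "a \<noteq> 0" "b \<noteq> 0" "h a = c" "h b = c" using assms(4,5) by (auto simp: shifted_poly_root_iff h_def)
  \<comment> \<open>Half the distance keeps the balls disjoint; the other entries keep them away
    from 0 and inside the unit disk.\<close>
  define e where "e = Min {dist a b / 2, cmod a, cmod b, 1 - cmod a, 1 - cmod b}"
  have e: "e > 0" using assms ab by (auto simp: e_def)
  have le: "e \<le> dist a b / 2" "e \<le> cmod a" "e \<le> cmod b" "e \<le> 1 - cmod a" "e \<le> 1 - cmod b"
    unfolding e_def by (rule Min_le; simp)+
  have n0: "0 \<notin> ball a e" "0 \<notin> ball b e" using le by auto
  define U where "U = h ` ball a e \<inter> h ` ball b e"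
  have "open U" unfolding U_def h_def using n0 e by (intro open_Int open_image_symbol)
  moreover have "c \<in> U" unfolding U_def using e ab by (metis IntI centre_in_ball image_eqI)
  moreover have "U \<subseteq> toeplitz_spectrum p"
  proof
    fix y assume "y \<in> U"
    then obtain z1 z2 where z: "z1 \<in> ball a e" "z2 \<in> ball b e" "y = h z1" "y = h z2" by (auto simp: U_def)
    have "z1 \<noteq> z2" using z le(1) dist_triangle2[of a b z1] by (auto simp: dist_commute)
    moreover have "cmod z1 < 1" "cmod z2 < 1"
      using z le norm_triangle_sub[of z1 a] norm_triangle_sub[of z2 b] by (auto simp: dist_norm norm_minus_commute)
    moreover have "z1 \<noteq> 0" "z2 \<noteq> 0" using z n0 by auto
    ultimately show "y \<in> toeplitz_spectrum p"
      using z by (intro distinct_roots_in_spectrum[of z1 z2]) (auto simp: shifted_poly_root_iff h_def)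
  qed
  ultimately have "c \<in> interior (toeplitz_spectrum p)" by (meson interiorI)
  then show ?thesis by (rule interior_limit_point)
qed

lemma isolated_point_root:
  assumes "c \<in> isolated_points (toeplitz_spectrum p)"
  obtains a where "cmod a < 1" "poly (shifted_poly p c) a = 0"
    "\<And>z. z \<in> cball 0 1 \<Longrightarrow> poly (shifted_poly p c) z = 0 \<Longrightarrow> z = a"
    "poly (exponent_poly p) a = 0 \<or> (\<exists>n. of_nat n * poly (exponent_poly p) a = 1)"
proof -
  have c: "c \<in> toeplitz_spectrum p" "\<not> c islimpt toeplitz_spectrum p"
    using assms by (auto simp: isolated_points_def)
  obtain a where a: "a \<in> cball 0 1" "poly (shifted_poly p c) a = 0" using no_root_limit_point c(2) by blast
  have lt: "cmod z < 1" if "z \<in> cball 0 1" "poly (shifted_poly p c) z = 0" for z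
    using that circle_root_limit_point[of z p c] c(2) by (cases "cmod z = 1") auto
  have uniq: "z = a" if "z \<in> cball 0 1" "poly (shifted_poly p c) z = 0" for z
    using distinct_roots_limit_point[of z a p c] lt[OF that] lt[OF a] that a c(2) by blast
  show ?thesis
    using that[OF lt[OF a] a(2) uniq] unique_root_spectrum_iff[OF lt[OF a] a(2) uniq] c(1) by blast
qed

section \<open>Finiteness of the set of isolated points\<close>

text \<open>In this form \<open>E = z^2 h'\<close>, so nonzero \<open>E\<close> means local
  injectivity of \<open>h\<close>, and \<open>E 0 = -1\<close> shows that neither \<open>E\<close>
  nor \<open>n E - 1\<close> is the zero polynomial.\<close>

lemma poly_exponent_poly: "poly (exponent_poly p) z = z\<^sup>2 * poly (pderiv p) z - 1"
  by (simp add: exponent_poly_def pderiv_add pderiv_pCons algebra_simps power2_eq_square)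

lemma exponent_level_finite: "finite {a. of_nat n * poly (exponent_poly p) a = 1}"
proof -
  let ?f = "smult (of_nat n) (exponent_poly p) - 1"
  have "poly ?f 0 = - of_nat n - 1" by (simp add: poly_exponent_poly)
  moreover have "- of_nat n - 1 \<noteq> (0 :: complex)"
    by (metis add_uminus_conv_diff diff_0 minus_diff_eq neg_equal_0_iff_equal of_nat_Suc of_nat_neq_0 add.commute diff_minus_eq_add minus_add_distrib)
  ultimately have "?f \<noteq> 0" by (metis poly_0)
  from poly_roots_finite[OF this] show ?thesis by simp
qed

lemma exponent_roots_finite: "finite {a. poly (exponent_poly p) a = 0}"
proof (rule poly_roots_finite)
  have "poly (exponent_poly p) 0 \<noteq> 0" by (simp add: poly_exponent_poly)
  then show "exponent_poly p \<noteq> 0" by (metis poly_0)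
qed

text \<open>Every root \<open>b\<close> has \<open>|b| \<ge> 1\<close>, so each linear factor at
  \<open>a\<close> has modulus at least \<open>1 - |a|\<close>.\<close>

lemma monic_lower_bound:
  fixes s :: "complex poly"
  assumes "lead_coeff s = 1" "\<And>z. cmod z < 1 \<Longrightarrow> poly s z \<noteq> 0" "cmod a \<le> 1"
  shows "(1 - cmod a) ^ degree s \<le> cmod (poly s a)"
  using assms
proof (induction "degree s" arbitrary: s)
  case 0
  then have "s = [:1:]" by (metis degree_eq_zeroE lead_coeff_pCons(2) coeff_pCons_0)
  then show ?case by simp
next
  case (Suc n)
  obtain b where b: "poly s b = 0"
    using alg_closed_imp_poly_has_root[of s] Suc.hyps(2) by auto
  then obtain t where t: "s = [:- b, 1:] * t" by (auto simp only: poly_eq_0_iff_dvd elim: dvdE)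
  have "t \<noteq> 0" using t Suc.hyps(2) by auto
  then have deg: "degree s = Suc (degree t)" unfolding t by (subst degree_mult_eq) auto
  have lead: "lead_coeff t = 1" using Suc.prems(1) unfolding t lead_coeff_mult by simp
  have "cmod b \<ge> 1" using Suc.prems(2) b by (meson not_le)
  then have 1: "1 - cmod a \<le> cmod (a - b)" using norm_triangle_ineq2[of b a] by (simp add: norm_minus_commute)
  have "\<And>z. cmod z < 1 \<Longrightarrow> poly t z \<noteq> 0" using Suc.prems(2) by (auto simp: t)
  then have "(1 - cmod a) ^ degree t \<le> cmod (poly t a)"
    using Suc.hyps(2) deg lead Suc.prems(3) by (intro Suc.hyps(1)) auto
  then have "(1 - cmod a) * (1 - cmod a) ^ degree t \<le> cmod (a - b) * cmod (poly t a)"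
    using 1 Suc.prems(3) by (intro mult_mono) auto
  moreover have "poly s a = (a - b) * poly t a" by (simp add: t algebra_simps)
  ultimately show ?case by (simp add: deg norm_mult)
qed

text \<open>If \<open>a\<close> is the only root in the closed disk, the exponent \<open>E(a) = a s(a)\<close> is at least \<open>|a| (1 - |a|)^k\<close> in modulus;
  hence \<open>E(a) = 1/n\<close> is impossible for large \<open>n\<close> unless \<open>E\<close> vanishes on the unit circle.\<close>

lemma finite_isolated_points:
  assumes monic: "lead_coeff p = 1" and deg: "degree p > 0"
    and E: "\<And>z. cmod z = 1 \<Longrightarrow> poly (exponent_poly p) z \<noteq> 0"
  shows "finite (isolated_points (toeplitz_spectrum p))"
proof -
  let ?E = "poly (exponent_poly p)"
  define h where "h z = 1 / z + poly p z" for z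
  \<comment> \<open>The maximum is positive on the compact disk: at a zero of \<open>E\<close> one
    has \<open>0 < |x| < 1\<close>, where the second entry is positive. At a unique simple root the
    second entry is at most the first, so \<open>\<delta> \<le> |E(a)|\<close>, and
    \<open>n E(a) = 1\<close> gives \<open>n \<le> 1 / \<delta>\<close>.\<close>
  define f where "f z = max (cmod (?E z)) (cmod z * (1 - cmod z) ^ degree p)" for z
  have "\<exists>x\<in>cball 0 1. \<forall>z\<in>cball 0 1. f x \<le> f z"
    unfolding f_def by (intro continuous_attains_inf continuous_intros) auto
  then obtain x where x: "x \<in> cball 0 1" "\<And>z. z \<in> cball 0 1 \<Longrightarrow> f x \<le> f z" by blast
  define \<delta> where "\<delta> = f x"
  have \<delta>: "\<delta> > 0"
  proof (cases "?E x = 0")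
    case True
    then have "x \<noteq> 0" by (auto simp: poly_exponent_poly)
    moreover have "cmod x < 1" using x(1) E[of x] True by (cases "cmod x = 1") auto
    ultimately show ?thesis by (simp add: \<delta>_def f_def less_max_iff_disj)
  qed (simp add: \<delta>_def f_def less_max_iff_disj)
  define N where "N = nat \<lceil>1 / \<delta>\<rceil>"
  have "isolated_points (toeplitz_spectrum p) \<subseteq> h ` ({a. ?E a = 0} \<union> (\<Union>n\<le>N. {a. of_nat n * ?E a = 1}))"
  proof
    fix c assume "c \<in> isolated_points (toeplitz_spectrum p)"
    then obtain a where a: "cmod a < 1" "poly (shifted_poly p c) a = 0"
      and uniq: "\<And>z. z \<in> cball 0 1 \<Longrightarrow> poly (shifted_poly p c) z = 0 \<Longrightarrow> z = a"
      and cases: "?E a = 0 \<or> (\<exists>n. of_nat n * ?E a = 1)"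
      using isolated_point_root by blast
    have "c = h a" using a(2) by (simp add: shifted_poly_root_iff h_def)
    moreover have "a \<in> {a. ?E a = 0} \<union> (\<Union>n\<le>N. {a. of_nat n * ?E a = 1})"
    proof (cases "?E a = 0")
      case False
      then obtain n where n: "of_nat n * ?E a = 1" using cases by blast
      obtain s where s: "shifted_poly p c = [:- a, 1:] * s"
        using a(2) by (auto simp only: poly_eq_0_iff_dvd elim: dvdE)
      note ex = exponent_at_root[OF s]
      have "degree (p - [:c:]) = degree p"
        using deg degree_add_eq_left[of "- [:c:]" p] unfolding diff_conv_add_uminus by simp
      then have "degree (p - [:c:]) = degree p \<and> lead_coeff (p - [:c:]) = 1"
        using deg monic by (simp add: coeff_pCons split: nat.split)
      then have q: "degree (shifted_poly p c) = Suc (degree p)" "lead_coeff (shifted_poly p c) = 1"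
        using deg by (auto simp: shifted_poly_def one_pCons)
      have "s \<noteq> 0" using s shifted_poly_nonzero by auto
      then have "degree s = degree p" using q(1) unfolding s by (subst (asm) degree_mult_eq) auto
      moreover have "lead_coeff s = 1" using q(2) unfolding s lead_coeff_mult by simp
      moreover have "poly s z \<noteq> 0" if "cmod z < 1" for z
      proof
        assume "poly s z = 0"
        then have "z = a" using uniq[of z] that by (simp add: s)
        then show False using \<open>poly s z = 0\<close> ex(1) False by simp
      qed
      ultimately have "(1 - cmod a) ^ degree p \<le> cmod (poly s a)"
        using monic_lower_bound[of s a] a(1) by simp
      then have "cmod a * (1 - cmod a) ^ degree p \<le> cmod (?E a)"
        unfolding ex(1)[symmetric] norm_mult by (intro mult_left_mono) auto
      then have "\<delta> \<le> cmod (?E a)" using x(2)[of a] a(1) by (simp add: \<delta>_def f_def)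
      have "real n * cmod (?E a) = 1" using arg_cong[OF n, of cmod] by (simp add: norm_mult)
      moreover have "real n * \<delta> \<le> real n * cmod (?E a)" using \<open>\<delta> \<le> cmod (?E a)\<close> by (intro mult_left_mono) auto
      ultimately have "real n \<le> 1 / \<delta>" using \<delta> by (simp add: field_simps)
      then have "n \<le> N" unfolding N_def by linarith
      then show ?thesis using n by blast
    qed simp
    ultimately show "c \<in> h ` ({a. ?E a = 0} \<union> (\<Union>n\<le>N. {a. of_nat n * ?E a = 1}))" by blast
  qed
  moreover have "finite (h ` ({a. ?E a = 0} \<union> (\<Union>n\<le>N. {a. of_nat n * ?E a = 1})))"
    by (intro finite_imageI finite_UnI exponent_roots_finite finite_UN_I exponent_level_finite) auto
  ultimately show ?thesis by (rule finite_subset)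
qed

text \<open>For \<open>c\<close> near \<open>c0\<close> the only root in the closed disk is some
  \<open>b\<close> near \<open>\<alpha>\<close>, with \<open>b \<noteq> \<alpha>\<close> unless
  \<open>c = c0\<close>, and \<open>1 / E(b)\<close> is not a natural number. Uniqueness of
  \<open>b\<close> rests on the injectivity of \<open>h\<close> near \<open>\<alpha>\<close>, where
  \<open>h' = E / z^2\<close> does not vanish.\<close>

lemma isolated_pointI:
  assumes a: "cmod \<alpha> < 1" and root: "poly (shifted_poly p c0) \<alpha> = 0"
    and uniq: "\<And>z. z \<in> cball 0 1 \<Longrightarrow> poly (shifted_poly p c0) z = 0 \<Longrightarrow> z = \<alpha>"
    and n0: "of_nat n0 * poly (exponent_poly p) \<alpha> = 1"
  shows "c0 \<in> isolated_points (toeplitz_spectrum p)"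
proof -
  let ?E = "poly (exponent_poly p)"
  define h where "h z = 1 / z + poly p z" for z
  have \<alpha>: "\<alpha> \<noteq> 0" "h \<alpha> = c0" using root by (auto simp: shifted_poly_root_iff h_def)
  have E0: "?E \<alpha> \<noteq> 0" using n0 by auto
  have n0': "n0 \<noteq> 0" using n0 by (cases n0) auto
  have inv: "1 / ?E \<alpha> = of_nat n0" using n0 E0 by (simp add: field_simps)
  have spec: "c0 \<in> toeplitz_spectrum p" using unique_root_spectrum_iff[OF a root uniq E0] n0 by blast
  have "isCont (\<lambda>z. 1 / ?E z) \<alpha>" using E0 by (intro continuous_intros)
  \<comment> \<open>Within \<open>d1\<close> the only natural number that \<open>1 / E\<close> can
    equal is \<open>n0\<close>; within \<open>d2\<close> that value is taken at
    \<open>\<alpha>\<close> alone.\<close>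
  then obtain d1 where d1: "d1 > 0" "\<And>z. dist z \<alpha> < d1 \<Longrightarrow> dist (1 / ?E z) (of_nat n0) < 1 / 2"
    unfolding continuous_at_eps_delta inv by (metis half_gt_zero_iff zero_less_one)
  obtain d2 where d2: "d2 > 0" "\<And>z. of_nat n0 * ?E z = 1 \<Longrightarrow> z \<noteq> \<alpha> \<Longrightarrow> d2 \<le> dist \<alpha> z"
    using finite_set_avoid[OF exponent_level_finite[of n0 p], of \<alpha>] by auto
  define S where "S = unit_disk - {0::complex}"
  have S: "open S" "\<alpha> \<in> S" using a \<alpha> by (auto simp: S_def)
  have "h holomorphic_on S" unfolding h_def S_def by (intro holomorphic_intros) auto
  moreover have "deriv h \<alpha> \<noteq> 0"
  proof -
    have "(h has_field_derivative ?E \<alpha> / \<alpha>\<^sup>2) (at \<alpha>)"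
      unfolding h_def poly_exponent_poly using \<alpha>(1)
      by (auto intro!: derivative_eq_intros simp: field_simps power2_eq_square)
    then show ?thesis using E0 \<alpha>(1) by (simp add: DERIV_imp_deriv)
  qed
  ultimately obtain d3 where d3: "d3 > 0" "ball \<alpha> d3 \<subseteq> S" "inj_on h (ball \<alpha> d3)"
    using has_complex_derivative_locally_injective[OF _ S(2,1)] by blast
  define d where "d = min d1 (min d2 d3)"
  have d: "d > 0" "d \<le> d1" "d \<le> d2" "d \<le> d3" using d1 d2 d3 by (auto simp: d_def)
  \<comment> \<open>Away from \<open>\<alpha>\<close> the polynomial at \<open>c0\<close> has
    modulus at least \<open>m\<close>, so a parameter closer than \<open>m\<close> to
    \<open>c0\<close> creates no root there.\<close>
  obtain m where m: "m > 0" "\<And>z. z \<in> cball 0 1 - ball \<alpha> d \<Longrightarrow> m \<le> cmod (poly (shifted_poly p c0) z)"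
  proof (cases "cball 0 1 - ball \<alpha> d = {}")
    case False
    then have "\<exists>x\<in>cball 0 1 - ball \<alpha> d. \<forall>z\<in>cball 0 1 - ball \<alpha> d. cmod (poly (shifted_poly p c0) x) \<le> cmod (poly (shifted_poly p c0) z)"
      by (intro continuous_attains_inf continuous_intros compact_diff) auto
    then obtain x where x: "x \<in> cball 0 1 - ball \<alpha> d"
      "\<And>z. z \<in> cball 0 1 - ball \<alpha> d \<Longrightarrow> cmod (poly (shifted_poly p c0) x) \<le> cmod (poly (shifted_poly p c0) z)" by blast
    have "poly (shifted_poly p c0) x \<noteq> 0" using uniq[of x] x(1) d(1) by auto
    then show ?thesis using x(2) by (intro that[of "cmod (poly (shifted_poly p c0) x)"]) auto
  next
    case True
    show ?thesis by (rule that[of 1]) (use True in auto)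
  qed
  have "0 \<notin> ball \<alpha> d" using d3(2) subset_ball[OF d(4), of \<alpha>] by (auto simp only: S_def)
  then have "open (h ` ball \<alpha> d)" unfolding h_def using d(1) by (rule open_image_symbol)
  moreover have "c0 \<in> h ` ball \<alpha> d" using \<alpha>(2) d(1) by (metis centre_in_ball imageI)
  ultimately obtain e where e: "e > 0" "ball c0 e \<subseteq> h ` ball \<alpha> d" by (meson open_contains_ball)
  have notin: "c \<notin> toeplitz_spectrum p" if c: "c \<in> ball c0 (min e m)" "c \<noteq> c0" for c
  proof -
    obtain b where b: "b \<in> ball \<alpha> d" "h b = c" using c(1) e(2) by auto
    have bS: "b \<in> S" using b(1) d3(2) d(4) by auto
    have b1: "cmod b < 1" "b \<noteq> 0" using bS by (auto simp: S_def)
    have broot: "poly (shifted_poly p c) b = 0" using b(2) b1(2) by (auto simp: shifted_poly_root_iff h_def)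
    have buniq: "z = b" if z: "z \<in> cball 0 1" "poly (shifted_poly p c) z = 0" for z
    proof -
      have "z \<in> ball \<alpha> d"
      proof (rule ccontr)
        assume "z \<notin> ball \<alpha> d"
        then have "m \<le> cmod (poly (shifted_poly p c0) z)" using m(2) z(1) by blast
        also have "poly (shifted_poly p c0) z = (c - c0) * z"
          using z(2) by (simp add: poly_shifted_poly algebra_simps)
        also have "cmod ((c - c0) * z) \<le> cmod (c - c0)" using z(1) by (simp add: norm_mult mult_left_le)
        finally show False using c(1) by (simp add: dist_norm norm_minus_commute)
      qed
      moreover have "h z = c" using z(2) by (simp add: shifted_poly_root_iff h_def)
      ultimately show ?thesis using b d(4) inj_onD[OF d3(3), of z b] by auto
    qed
    have near: "dist (1 / ?E b) (of_nat n0) < 1 / 2" using b(1) d(2) by (intro d1(2)) (simp add: dist_commute)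
    have Eb: "?E b \<noteq> 0"
    proof
      assume "?E b = 0"
      then have "real n0 < 1 / 2" using near by (simp add: dist_norm)
      then show False using n0' by simp
    qed
    have "of_nat n * ?E b \<noteq> 1" for n
    proof
      assume n: "of_nat n * ?E b = 1"
      then have "1 / ?E b = of_nat n" using Eb by (simp add: field_simps)
      then have "cmod (of_nat n - of_nat n0) < 1 / 2" using near by (simp add: dist_norm)
      moreover have "of_nat n - of_nat n0 = (of_real (real n - real n0) :: complex)" by simp
      ultimately have "\<bar>real n - real n0\<bar> < 1 / 2" by (metis norm_of_real real_norm_def)
      then have "n = n0" by linarith
      moreover have "b \<noteq> \<alpha>" using b(2) \<alpha>(2) c(2) by auto
      ultimately have "d2 \<le> dist \<alpha> b" using d2(2) n by blast
      then show False using b(1) d(3) by simp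
    qed
    then show ?thesis using unique_root_spectrum_iff[OF b1(1) broot buniq Eb] by blast
  qed
  have "\<not> c0 islimpt toeplitz_spectrum p"
    unfolding islimpt_approachable
    using notin e(1) m(1) by (auto intro!: exI[of _ "min e m"] simp: dist_commute)
  then show ?thesis using spec by (simp add: isolated_points_def)
qed

theorem theorem4p3:
  fixes k :: nat and \<beta> \<alpha> :: complex and p :: "complex poly"
  assumes "k \<ge> 3"
    and "\<beta> ^ (k + 1) = 1 / (1 - of_real ((1/2) powr (1 / real k)) * exp (of_real pi * \<i> / of_nat k))"
    and "\<alpha> = - inverse (\<beta> ^ k)"
    and "p = ([:-\<alpha>, 1:] * [:\<beta>, 1:] ^ k - 1) div [:0, 1:]"
  shows "0 \<in> isolated_points (bergman_spectrum (toeplitz (\<lambda>z. cnj z + poly p z))) \<and>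
         finite (isolated_points (bergman_spectrum (toeplitz (\<lambda>z. cnj z + poly p z))))"
proof -
  define x where "x = (1/2::real) powr (1 / real k)"
  define w where "w = of_real x * exp (of_real pi * \<i> / of_nat k)"
  have k: "k \<ge> 3" "k > 0" using assms(1) by auto
  have x: "0 < x" "x < 1" using k by (auto simp: x_def powr01_less_one)
  have w_cis: "w = of_real x * cis (pi / real k)"
    by (simp add: w_def cis_conv_exp mult.commute)
  have wk: "w ^ k = - 1 / 2"
  proof -
    have "x ^ k = 1 / 2" unfolding x_def using k by (subst powr_power) auto
    then have "complex_of_real x ^ k = 1 / 2"
      by (metis of_real_1 of_real_divide of_real_numeral of_real_power)
    moreover have "cis (pi / real k) ^ k = -1" using k by (simp add: Complex.DeMoivre)
    ultimately show ?thesis unfolding w_cis power_mult_distrib by simp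
  qed
  \<comment> \<open>The place where \<open>k \<ge> 3\<close> matters:
    \<open>x < 1 \<le> 2 cos (pi / k)\<close> is what yields \<open>|1 - w| < 1\<close>.\<close>
  have cosk: "cos (pi / real k) \<ge> 1 / 2"
  proof -
    have "pi / real k \<le> pi / 3" using k by (intro divide_left_mono) auto
    then have "cos (pi / 3) \<le> cos (pi / real k)" by (intro cos_monotone_0_pi_le) auto
    then show ?thesis by (simp add: cos_60)
  qed
  have w1: "1 - w \<noteq> 0"
  proof
    assume "1 - w = 0"
    then have "- 1 / 2 = (1::complex)" using wk by simp
    from arg_cong[OF this, of Re] show False by simp
  qed
  have norm_w: "cmod (1 - w) < 1"
  proof -
    have "(cmod (1 - w))\<^sup>2 = (1 - x * cos (pi / real k))\<^sup>2 + (x * sin (pi / real k))\<^sup>2"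
      by (simp add: cmod_power2 w_cis)
    also have "\<dots> = 1 - 2 * x * cos (pi / real k) + x\<^sup>2 * ((sin (pi / real k))\<^sup>2 + (cos (pi / real k))\<^sup>2)"
    proof -
      have "(1 - x * c)\<^sup>2 + (x * s)\<^sup>2 = 1 - 2 * x * c + x\<^sup>2 * (s\<^sup>2 + c\<^sup>2)" for c s
        by (simp add: power2_eq_square algebra_simps)
      then show ?thesis .
    qed
    also have "\<dots> = 1 - 2 * x * cos (pi / real k) + x\<^sup>2" by simp
    also have "\<dots> < 1"
    proof -
      have "x * x < x * (2 * cos (pi / real k))" using x cosk by (intro mult_strict_left_mono) auto
      then show ?thesis by (simp add: power2_eq_square)
    qed
    finally show ?thesis by (simp add: abs_square_less_1)
  qed
  have \<beta>k: "\<beta> ^ (k + 1) = 1 / (1 - w)" using assms(2) by (simp add: w_def x_def)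
  have \<beta>0: "\<beta> \<noteq> 0"
  proof
    assume "\<beta> = 0"
    then have "1 / (1 - w) = 0" using \<beta>k by simp
    then show False using w1 by simp
  qed
  have \<beta>1: "cmod \<beta> > 1"
  proof (rule ccontr)
    assume "\<not> ?thesis"
    then have "cmod \<beta> ^ (k + 1) \<le> 1" by (intro power_le_one) auto
    moreover have "cmod \<beta> ^ (k + 1) = 1 / cmod (1 - w)"
      unfolding norm_power[symmetric] \<beta>k by (simp add: norm_divide)
    ultimately show False using norm_w w1 by (simp add: field_simps)
  qed
  have \<alpha>\<beta>: "\<alpha> * \<beta> ^ k = - 1" using \<beta>0 by (simp add: assms(3))
  have norm_\<alpha>: "cmod \<alpha> * cmod \<beta> ^ k = 1"
    using arg_cong[OF \<alpha>\<beta>, of cmod] by (simp add: norm_mult norm_power)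
  have \<alpha>1: "cmod \<alpha> < 1"
  proof -
    have "1 < cmod \<beta> ^ k" using \<beta>1 k by (simp add: one_less_power)
    moreover have "cmod \<alpha> \<noteq> 0" using \<alpha>\<beta> by auto
    ultimately have "cmod \<alpha> * 1 < cmod \<alpha> * cmod \<beta> ^ k" by (intro mult_strict_left_mono) auto
    then show ?thesis using norm_\<alpha> by simp
  qed
  have \<alpha>\<beta>1: "cmod \<alpha> * cmod \<beta> < 1"
  proof -
    have "1 < cmod \<beta> ^ (k - 1)" using \<beta>1 k by (intro one_less_power) auto
    moreover have "cmod \<alpha> * cmod \<beta> * cmod \<beta> ^ (k - 1) = 1"
      using norm_\<alpha> k by (cases k) (auto simp: mult_ac)
    moreover have "cmod \<alpha> * cmod \<beta> > 0" using \<alpha>\<beta> \<beta>0 by (auto intro!: mult_pos_pos)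
    ultimately show ?thesis by (metis mult_strict_left_mono mult.right_neutral)
  qed
  define Q where "Q = [:-\<alpha>, 1:] * [:\<beta>, 1:] ^ k"
  \<comment> \<open>The relation between \<open>\<alpha>\<close> and \<open>\<beta>\<close> makes
    \<open>Q(0) = 1\<close>, so the division defining \<open>p\<close> is exact.\<close>
  have "poly (Q - 1) 0 = 0" using \<alpha>\<beta> by (simp add: Q_def poly_power)
  then have "[:0, 1:] dvd Q - 1" using poly_eq_0_iff_dvd[of "Q - 1" 0] by simp
  then have "[:0, 1:] * p = Q - 1" unfolding assms(4) Q_def[symmetric] by (rule dvd_mult_div_cancel)
  then have qQ: "1 + pCons 0 p = Q" by simp
  have polyQ: "poly Q z = (z - \<alpha>) * (z + \<beta>) ^ k" for z by (simp add: Q_def poly_power algebra_simps)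
  have "degree Q = Suc k"
    unfolding Q_def by (simp add: degree_mult_eq degree_power_eq del: mult_pCons_left)
  moreover have "lead_coeff Q = 1"
    unfolding Q_def lead_coeff_mult lead_coeff_power by simp
  ultimately have degQ: "degree Q = Suc k" "lead_coeff Q = 1" by simp_all
  have "p \<noteq> 0" using qQ degQ(1) by auto
  then have "degree (1 + pCons 0 p) = Suc (degree p) \<and> lead_coeff (1 + pCons 0 p) = lead_coeff p"
    by (simp add: one_pCons)
  then have degp: "degree p = k" "lead_coeff p = 1" using degQ unfolding qQ by auto
  have pd: "poly (pderiv Q) z = (z + \<beta>) ^ k + (z - \<alpha>) * (of_nat k * (z + \<beta>) ^ (k - 1))" for z
    unfolding Q_def pderiv_mult
    by (simp add: pderiv_power pderiv_pCons poly_power algebra_simps)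
  have E: "poly (exponent_poly p) z = z * poly (pderiv Q) z - poly Q z" for z
    by (simp add: exponent_poly_def qQ)
  have E\<alpha>: "poly (exponent_poly p) \<alpha> = 1 / 2"
  proof -
    have "\<alpha> = - \<beta> * (1 - w)"
    proof -
      have "\<beta> * \<beta> ^ k = 1 / (1 - w)" using \<beta>k by simp
      then have "\<beta> * \<beta> ^ k * (1 - w) = 1" using w1 by (metis nonzero_eq_divide_eq)
      then have "(- \<beta> * (1 - w)) * \<beta> ^ k = - 1" by (simp add: mult_ac)
      then have "(- \<beta> * (1 - w)) * \<beta> ^ k = \<alpha> * \<beta> ^ k" by (simp only: \<alpha>\<beta>)
      then show ?thesis using \<beta>0 by (metis mult_right_cancel power_not_zero)
    qed
    then have "\<alpha> + \<beta> = \<beta> * w" by (simp add: algebra_simps)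
    then have "poly (exponent_poly p) \<alpha> = \<alpha> * \<beta> ^ k * w ^ k"
      unfolding E pd polyQ by (simp add: power_mult_distrib mult_ac)
    then show ?thesis unfolding \<alpha>\<beta> wk by simp
  qed
  \<comment> \<open>The root \<open>-\<beta>\<close> of \<open>Q\<close>, of multiplicity
    \<open>k\<close>, remains in \<open>E\<close> with the power \<open>k - 1\<close> split off; on
    the circle only the quadratic factor needs an estimate.\<close>
  have Efac: "poly (exponent_poly p) z
      = (z + \<beta>) ^ (k - 1) * (of_nat k * z\<^sup>2 - (of_nat k - 1) * \<alpha> * z + \<alpha> * \<beta>)" for z
  proof -
    have "(z + \<beta>) ^ k = (z + \<beta>) ^ (k - 1) * (z + \<beta>)" using k by (cases k) auto
    then show ?thesis unfolding E pd polyQ by (simp add: algebra_simps power2_eq_square)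
  qed
  have "poly (exponent_poly p) z \<noteq> 0" if z: "cmod z = 1" for z
  proof
    assume "poly (exponent_poly p) z = 0"
    moreover have "z + \<beta> \<noteq> 0" using z \<beta>1 by (metis add_eq_0_iff less_irrefl norm_minus_cancel)
    ultimately have "of_nat k * z\<^sup>2 - (of_nat k - 1) * \<alpha> * z + \<alpha> * \<beta> = 0"
      unfolding Efac by (metis mult_eq_0_iff power_not_zero)
    then have "of_nat k * z\<^sup>2 = (of_nat k - 1) * \<alpha> * z - \<alpha> * \<beta>"
      by (simp add: algebra_simps)
    \<comment> \<open>The contradiction is \<open>k \<le> (k - 1) |\<alpha>| + |\<alpha> \<beta>| <
      (k - 1) + 1\<close>.\<close>
    then have "cmod (of_nat k * z\<^sup>2) = cmod ((of_nat k - 1) * \<alpha> * z - \<alpha> * \<beta>)" by simp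
    also have "\<dots> \<le> cmod ((of_nat k - 1) * \<alpha> * z) + cmod (\<alpha> * \<beta>)" by (rule norm_triangle_ineq4)
    also have "cmod ((of_nat k - 1) * \<alpha> * z) = (real k - 1) * cmod \<alpha>"
    proof -
      have "of_nat k - 1 = complex_of_real (real k - 1)" by simp
      then have "cmod (of_nat k - 1) = real k - 1" using k by (metis norm_of_real abs_of_nonneg diff_ge_0_iff_ge of_nat_1 of_nat_le_iff One_nat_def Suc_leI)
      then show ?thesis using z by (simp only: norm_mult mult_1_right)
    qed
    also have "\<dots> \<le> (real k - 1) * 1" using \<alpha>1 k by (intro mult_left_mono) auto
    finally show False using \<alpha>\<beta>1 z by (simp add: norm_mult norm_power)
  qed
  then have fin: "finite (isolated_points (toeplitz_spectrum p))"
    using degp k by (intro finite_isolated_points) auto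
  have sh: "poly (shifted_poly p 0) z = (z - \<alpha>) * (z + \<beta>) ^ k" for z
    using polyQ[of z] qQ by (simp add: shifted_poly_def)
  have "0 \<in> isolated_points (toeplitz_spectrum p)"
  proof (rule isolated_pointI[OF \<alpha>1])
    show "poly (shifted_poly p 0) \<alpha> = 0" by (simp add: sh)
    show "z = \<alpha>" if "z \<in> cball 0 1" "poly (shifted_poly p 0) z = 0" for z
    proof -
      have "z + \<beta> \<noteq> 0" using that(1) \<beta>1 by (metis add_eq_0_iff mem_cball_0 norm_minus_cancel not_le)
      then show ?thesis using that(2) by (simp add: sh)
    qed
    show "of_nat 2 * poly (exponent_poly p) \<alpha> = 1" by (simp add: E\<alpha>)
  qed
  with fin show ?thesis by blast
qed

end
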